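(* Let $\digamma$ be (the set-valued map of) a holomorphic correspondence on $\widehat{\mathbb{C}}$ and let $\mathcal{T}_{\digamma}$ be the Koopman operator pertaining to $\digamma$. Suppose $\mu \in \mathscr{M}(\widehat{\mathbb{C}})$ is a $\digamma^{*}$-invariant measure. Then the following statements are equivalent. 1. $\mu$ is ergodic with respect to $\digamma$. 2. Every Borel set $E$ with $\mu(E)>0$ satisfies $\mu\left(\bigcup_{n \ge 1} (\digamma^{\dagger})^{n}(E)\right) = 1$. 3. For all Borel sets $E$ and $E'$ with $\mu(E)>0$ and $\mu(E')>0$, there exists $n \in \mathbb{Z}_{+}$ such that $\mu\left((\digamma^{\dagger})^{n}(E) \cap E'\right) > 0$. 4. If $f \in \mathscr{L}^{1}(\widehat{\mathbb{C}}, \mu)$ satisfies $\mathcal{T}_{\digamma} f \ge f$ $\mu$-almost everywhere, then $f$ is a constant function $\mu$-almost everywhere. 5. For $1 \le p < \infty$, if $f \in \mathscr{L}^{p}(\widehat{\mathbb{C}}, \mu)$ satisfies $\mathcal{T}_{\digamma} f = f$ $\mu$-almost everywhere, then $f$ is a constant function $\mu$-almost everywhere.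
   Context: A holomorphic correspondence on $\widehat{\mathbb{C}}$ is a formal sum $\Gamma = \sum_{\alpha=1}^{N} m_{\alpha}\Gamma_{\alpha}$, where the $m_\alpha$ are positive integers and the $\Gamma_\alpha \subseteq \widehat{\mathbb{C}}\times\widehat{\mathbb{C}}$ are distinct irreducible complex-analytic subvarieties of dimension $1$ such that, with $\pi_1,\pi_2$ the coordinate projections, each $\pi_i|_{\Gamma_\alpha}$ is surjective ($i=1,2$) and, for every $\alpha$ and any generic $z_0$, the sets $\pi_1(\pi_2^{-1}(\{z_0\})\cap\Gamma_\alpha)$ and $\pi_2(\pi_1^{-1}(\{z_0\})\cap\Gamma_\alpha)$ are finite. The support is $|\Gamma| = \bigcup_\alpha \Gamma_\alpha$. The associated set-valued map $\digamma$ is $\digamma(z)=\{w : (z,w)\in|\Gamma|\}$ and $\digamma^{\dagger}(z)=\{w : (w,z)\in|\Gamma|\}$ is the set of pre-images; images and pre-images are counted with multiplicity (in particular in sums). The topological degree $d_{\mathrm{top}}$ is the number of pre-images, counted with multiplicity, of a generic point. For sets, $\digamma^\dagger(A)=\bigcup_{z\in A}\digamma^\dagger(z)$, and $(\digamma^\dagger)^n$ is the $n$-fold iterate of $\digamma^\dagger$. $\mathbb{Z}_+$ denotes the positive integers. $\mathscr{M}(\widehat{\mathbb{C}})$ is the set of Borel probability measures on $\widehat{\mathbb{C}}$. $\mu\in\mathscr{M}(\widehat{\mathbb{C}})$ is $\digamma^{*}$-invariant if $\int f\,\mathrm{d}\mu = \frac{1}{d_{\mathrm{top}}}\int \sum_{w\in\digamma^{\dagger}(z)}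 f(w)\,\mathrm{d}\mu(z)$ for all $f\in\mathcal{C}(\widehat{\mathbb{C}},\mathbb{R})$. A Borel set $A\subseteq\widehat{\mathbb{C}}$ is almost invariant with respect to $(\digamma,\mu)$ if there is a Borel set $A'\subseteq A$ with $\mu(A')=\mu(A)$ and $\digamma^\dagger(A')\subseteq A$. A $\digamma^*$-invariant $\mu$ is ergodic with respect to $\digamma$ if every Borel set almost invariant with respect to $(\digamma,\mu)$ has $\mu$-measure $0$ or $1$. The Koopman operator on $\mathscr{L}^1(\widehat{\mathbb{C}},\mu)$ is $(\mathcal{T}_{\digamma}f)(z)=\frac{1}{d_{\mathrm{top}}}\sum_{w\in\digamma^\dagger(z)}f(w)$ (sum with multiplicity). Functions are real-valued. *)

theory Defs
  imports "HOL-Probability.Probability" "HOL-Library.Multiset"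
begin

section \<open>The Riemann sphere\<close>

datatype riemann_sphere = Affine complex | Infty

text \<open>The topology is that of the one-point compactification of the complex plane.\<close>

instantiation riemann_sphere :: topological_space
begin

definition open_riemann_sphere :: "riemann_sphere set \<Rightarrow> bool" where
  "open_riemann_sphere U \<longleftrightarrow>
     open (Affine -` U) \<and> (Infty \<in> U \<longrightarrow> compact (- (Affine -` U)))"

instance
proof
  show "open (UNIV :: riemann_sphere set)"
    by (simp add: open_riemann_sphere_def)
next
  fix S T :: "riemann_sphere set"
  assume "open S" "open T"
  then show "open (S \<inter> T)"
    by (auto simp: open_riemann_sphere_def Compl_Int compact_Un)
next
  fix K :: "riemann_sphere set set"
  assume K: "\<forall>S\<in>K. open S"
  have op: "open (Affine -` \<Union>K)"
    using K by (auto simp: open_riemann_sphere_def vimage_Union)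
  have "compact (- (Affine -` \<Union>K))" if "Infty \<in> \<Union>K"
  proof -
    from that obtain S where S: "S \<in> K" "Infty \<in> S" by auto
    with K have "compact (- (Affine -` S))"
      by (simp add: open_riemann_sphere_def)
    moreover have "closed (- (Affine -` \<Union>K))"
      using op by (simp add: closed_def)
    moreover have "- (Affine -` \<Union>K) = - (Affine -` S) \<inter> - (Affine -` \<Union>K)"
      using S by auto
    ultimately show ?thesis
      by (metis compact_Int_closed)
  qed
  with op show "open (\<Union>K)"
    by (simp add: open_riemann_sphere_def)
qed

end

text \<open>The two standard holomorphic parametrisations, inverse to the coordinates
  \<open>z\<close> and \<open>1/z\<close>.\<close>

definition Affine_at_Infty :: "complex \<Rightarrow> riemann_sphere" where
  "Affine_at_Infty z = (if z = 0 then Infty else Affine (inverse z))"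

definition sphere_charts :: "(complex \<Rightarrow> riemann_sphere) set" where
  "sphere_charts = {Affine, Affine_at_Infty}"


section \<open>Analytic subvarieties\<close>

definition holomorphic2_on :: "(complex \<times> complex \<Rightarrow> complex) \<Rightarrow> (complex \<times> complex) set \<Rightarrow> bool"
  where
  "holomorphic2_on f U \<longleftrightarrow>
     (\<forall>p\<in>U. \<exists>a b. (f has_derivative (\<lambda>(h, k). a * h + b * k)) (at p))"

definition analytic_subset_C2 :: "(complex \<times> complex) set \<Rightarrow> bool" where
  "analytic_subset_C2 A \<longleftrightarrow>
     (\<forall>p. \<exists>U F. open U \<and> p \<in> U \<and> finite F \<and> (\<forall>f\<in>F. holomorphic2_on f U) \<and>
        A \<inter> U = {q \<in> U. \<forall>f\<in>F. f q = 0})"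

text \<open>A point near which \<open>A\<close> is a one-dimensional complex submanifold, i.e. the zero set of
  a holomorphic function whose derivative does not vanish there.\<close>

definition regular_point_dim1_C2 :: "(complex \<times> complex) set \<Rightarrow> complex \<times> complex \<Rightarrow> bool" where
  "regular_point_dim1_C2 A p \<longleftrightarrow>
     p \<in> A \<and>
     (\<exists>U h a b. open U \<and> p \<in> U \<and> holomorphic2_on h U \<and>
        (h has_derivative (\<lambda>(x, y). a * x + b * y)) (at p) \<and> (a, b) \<noteq> (0, 0) \<and>
        A \<inter> U = {q \<in> U. h q = 0})"

definition chart_preimage ::
  "(complex \<Rightarrow> riemann_sphere) \<Rightarrow> (complex \<Rightarrow> riemann_sphere) \<Rightarrow>
   (riemann_sphere \<times> riemann_sphere) set \<Rightarrow> (complex \<times> complex) set" where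
  "chart_preimage \<phi> \<psi> A = map_prod \<phi> \<psi> -` A"

definition analytic_subvariety :: "(riemann_sphere \<times> riemann_sphere) set \<Rightarrow> bool" where
  "analytic_subvariety A \<longleftrightarrow>
     (\<forall>\<phi>\<in>sphere_charts. \<forall>\<psi>\<in>sphere_charts. analytic_subset_C2 (chart_preimage \<phi> \<psi> A))"

definition irreducible_subvariety :: "(riemann_sphere \<times> riemann_sphere) set \<Rightarrow> bool" where
  "irreducible_subvariety A \<longleftrightarrow>
     analytic_subvariety A \<and> A \<noteq> {} \<and>
     (\<forall>A\<^sub>1 A\<^sub>2. analytic_subvariety A\<^sub>1 \<and> analytic_subvariety A\<^sub>2 \<and> A = A\<^sub>1 \<union> A\<^sub>2
        \<longrightarrow> A\<^sub>1 = A \<or> A\<^sub>2 = A)"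

text \<open>The dimension of an analytic set is the largest dimension it has, as a complex
  manifold, at its regular points; the regular points of dimension two are the
  interior points.\<close>

definition dimension_one :: "(riemann_sphere \<times> riemann_sphere) set \<Rightarrow> bool" where
  "dimension_one A \<longleftrightarrow>
     (\<exists>\<phi>\<in>sphere_charts. \<exists>\<psi>\<in>sphere_charts. \<exists>p. regular_point_dim1_C2 (chart_preimage \<phi> \<psi> A) p) \<and>
     interior A = {}"


section \<open>Holomorphic correspondences\<close>

text \<open>A formal sum \<open>\<Sum>\<^sub>\<alpha> m\<^sub>\<alpha> \<Gamma>\<^sub>\<alpha>\<close> of distinct sets with positive integer coefficients is
  the nonempty multiset in which each \<open>\<Gamma>\<^sub>\<alpha>\<close> occurs \<open>m\<^sub>\<alpha>\<close> times. ``Generic'' means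
  ``outside a finite set'', the proper Zariski-closed subsets of the sphere being the
  finite ones.\<close>

type_synonym correspondence = "(riemann_sphere \<times> riemann_sphere) set multiset"

definition holomorphic_correspondence :: "correspondence \<Rightarrow> bool" where
  "holomorphic_correspondence \<Gamma> \<longleftrightarrow>
     \<Gamma> \<noteq> {#} \<and>
     (\<forall>C\<in>#\<Gamma>. irreducible_subvariety C \<and> dimension_one C \<and>
        fst ` C = UNIV \<and> snd ` C = UNIV \<and>
        (\<forall>\<^sub>F z\<^sub>0 in cofinite. finite (fst ` (snd -` {z\<^sub>0} \<inter> C)) \<and> finite (snd ` (fst -` {z\<^sub>0} \<inter> C))))"

definition support :: "correspondence \<Rightarrow> (riemann_sphere \<times> riemann_sphere) set" where
  "support \<Gamma> = \<Union>(set_mset \<Gamma>)"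

definition preimages :: "correspondence \<Rightarrow> riemann_sphere \<Rightarrow> riemann_sphere set" where
  "preimages \<Gamma> z = {w. (w, z) \<in> support \<Gamma>}"

definition preimage_set :: "correspondence \<Rightarrow> riemann_sphere set \<Rightarrow> riemann_sphere set" where
  "preimage_set \<Gamma> A = (\<Union>z\<in>A. preimages \<Gamma> z)"

text \<open>The multiplicity of \<open>w\<close> as a pre-image of \<open>z\<close> along a curve \<open>C\<close> is the local degree at
  \<open>(w, z)\<close> of the second projection restricted to \<open>C\<close>: the number of pre-images near \<open>w\<close> of
  every point \<open>z' \<noteq> z\<close> sufficiently close to \<open>z\<close>.\<close>

definition local_mult ::
  "(riemann_sphere \<times> riemann_sphere) set \<Rightarrow> riemann_sphere \<Rightarrow> riemann_sphere \<Rightarrow> nat" where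
  "local_mult C w z =
     (THE k. \<exists>U\<^sub>0. open U\<^sub>0 \<and> w \<in> U\<^sub>0 \<and>
        (\<forall>U. open U \<and> w \<in> U \<and> U \<subseteq> U\<^sub>0 \<longrightarrow>
           (\<forall>\<^sub>F z' in at z. card {w'\<in>U. (w', z') \<in> C} = k)))"

definition preimage_mult :: "correspondence \<Rightarrow> riemann_sphere \<Rightarrow> riemann_sphere \<Rightarrow> nat" where
  "preimage_mult \<Gamma> w z = (\<Sum>C\<in>#\<Gamma>. local_mult C w z)"

definition d_top :: "correspondence \<Rightarrow> nat" where
  "d_top \<Gamma> = (THE d. \<forall>\<^sub>F z in cofinite. (\<Sum>w\<in>preimages \<Gamma> z. preimage_mult \<Gamma> w z) = d)"

definition preimage_sum :: "correspondence \<Rightarrow> (riemann_sphere \<Rightarrow> real) \<Rightarrow> riemann_sphere \<Rightarrow> real" where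
  "preimage_sum \<Gamma> f z = (\<Sum>w\<in>preimages \<Gamma> z. real (preimage_mult \<Gamma> w z) * f w)"

definition koopman :: "correspondence \<Rightarrow> (riemann_sphere \<Rightarrow> real) \<Rightarrow> riemann_sphere \<Rightarrow> real" where
  "koopman \<Gamma> f z = 1 / real (d_top \<Gamma>) * preimage_sum \<Gamma> f z"


section \<open>Invariance and ergodicity\<close>

definition borel_prob_measures :: "riemann_sphere measure set" where
  "borel_prob_measures = {\<mu>. sets \<mu> = sets borel \<and> prob_space \<mu>}"

definition pullback_invariant :: "correspondence \<Rightarrow> riemann_sphere measure \<Rightarrow> bool" where
  "pullback_invariant \<Gamma> \<mu> \<longleftrightarrow>
     (\<forall>f. continuous_on UNIV f \<longrightarrow>
        (LINT z|\<mu>. f z) = 1 / real (d_top \<Gamma>) * (LINT z|\<mu>. preimage_sum \<Gamma> f z))"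

definition almost_invariant ::
  "correspondence \<Rightarrow> riemann_sphere measure \<Rightarrow> riemann_sphere set \<Rightarrow> bool" where
  "almost_invariant \<Gamma> \<mu> A \<longleftrightarrow>
     A \<in> sets borel \<and>
     (\<exists>A'\<in>sets borel. A' \<subseteq> A \<and> measure \<mu> A' = measure \<mu> A \<and> preimage_set \<Gamma> A' \<subseteq> A)"

definition ergodic :: "correspondence \<Rightarrow> riemann_sphere measure \<Rightarrow> bool" where
  "ergodic \<Gamma> \<mu> \<longleftrightarrow>
     (\<forall>A. almost_invariant \<Gamma> \<mu> A \<longrightarrow> measure \<mu> A = 0 \<or> measure \<mu> A = 1)"

definition L_p :: "real \<Rightarrow> riemann_sphere measure \<Rightarrow> (riemann_sphere \<Rightarrow> real) set" where
  "L_p p \<mu> = {f \<in> borel_measurable \<mu>. integrable \<mu> (\<lambda>x. \<bar>f x\<bar> powr p)}"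

definition ae_constant :: "riemann_sphere measure \<Rightarrow> (riemann_sphere \<Rightarrow> real) \<Rightarrow> bool" where
  "ae_constant \<mu> f \<longleftrightarrow> (\<exists>c. AE z in \<mu>. f z = c)"

end

theory Submission
  imports Defs "HOL-Complex_Analysis.Complex_Analysis"
begin

text \<open>
  The Koopman operator averages over pre-images with weights \<open>m(w, z) / d_top\<close>. Once it is known to be
  a Markov operator (the weights are positive, sum to one and depend measurably on \<open>z\<close>) which
  preserves the integral with respect to \<open>\<mu>\<close>, the equivalences are soft: a subinvariant integrable
  function is invariant, the truncations \<open>max 0 (f - c)\<close> of an invariant function are again
  subinvariant, so that its sublevel sets are almost invariant, and an almost invariant set contains
  a set of the same measure which is closed under taking pre-images.

  The analytic input is that for a point \<open>z\<close> with finite fibre the number of points of the curve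
  near \<open>(w, z)\<close> above \<open>z'\<close> is constant for \<open>z' \<noteq> z\<close> close to \<open>z\<close>. Locally the curve is the common zero
  set of finitely many holomorphic functions, one of which, \<open>f\<close>, does not vanish identically on the
  fibre. For holomorphic \<open>g\<close> the moments \<open>\<Sum> ord(f, w) g(w, z) w\<^sup>e\<close> over the zeros \<open>w\<close> of \<open>f(\<cdot>, z)\<close> are
  holomorphic in \<open>z\<close> by the argument principle, and the number of distinct zeros with \<open>g \<noteq> 0\<close> is the
  largest size of a nonvanishing generalised discriminant, which is a polynomial in the moments.
\<close>


subsection \<open>Counting points by moments\<close>

text \<open>\<open>local_mult\<close> is a definite description, so nothing is known about the
  weights before the local counts are shown to stabilise. The obstacle is that the argument
  principle counts zeros with their order, whereas \<open>local_mult\<close> counts distinct points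
  of a common zero set. In the moments the orders enter merely as positive weights; a discriminant
  kills every tuple with a repeated entry, and the surviving tuples of maximal length cannot cancel,
  since they contribute equally. In this way no branch of the curve has to be parametrised.

  Irreducibility enters through the absence of isolated points: a local count equal to zero at a
  point of the curve would isolate that point. This is where the positivity of the weights comes
  from. Positivity serves twice. A vanishing average of a nonnegative function forces it to vanish
  at every single pre-image. Moreover, projections of Borel sets, in general only analytic sets,
  become Borel here: up to a finite set, they are the sets where a weighted sum of an indicator is
  positive.\<close>

definition monomial_sum :: "nat \<Rightarrow> ((nat \<Rightarrow> complex) \<Rightarrow> complex) \<Rightarrow> bool" where
  "monomial_sum k P \<longleftrightarrow> (\<exists>(J :: (complex \<times> (nat \<Rightarrow> nat)) list).
     \<forall>x. P x = (\<Sum>(\<kappa>, e)\<leftarrow>J. \<kappa> * (\<Prod>a<k. x a ^ e a)))"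

lemma monomial_sum_const: "monomial_sum k (\<lambda>x. c)"
  unfolding monomial_sum_def by (rule exI[of _ "[(c, \<lambda>_. 0)]"]) simp

lemma monomial_sum_var:
  assumes "i < k"
  shows "monomial_sum k (\<lambda>x. x i)"
proof -
  have "(\<Prod>a<k. x a ^ (if a = i then 1 else 0)) = x i" for x :: "nat \<Rightarrow> complex"
  proof -
    have "(\<Prod>a<k. x a ^ (if a = i then 1 else 0)) = (\<Prod>a<k. if a = i then x a else 1)"
      by (intro prod.cong) auto
    also have "\<dots> = x i" using assms by (simp add: prod.delta)
    finally show ?thesis .
  qed
  then show ?thesis
    unfolding monomial_sum_def by (intro exI[of _ "[(1, \<lambda>a. if a = i then 1 else 0)]"]) simp
qed

lemma monomial_sum_add:
  assumes "monomial_sum k P" "monomial_sum k Q"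
  shows "monomial_sum k (\<lambda>x. P x + Q x)"
proof -
  from assms obtain J J' where
    "\<forall>x. P x = (\<Sum>(\<kappa>, e)\<leftarrow>J. \<kappa> * (\<Prod>a<k. x a ^ e a))"
    "\<forall>x. Q x = (\<Sum>(\<kappa>, e)\<leftarrow>J'. \<kappa> * (\<Prod>a<k. x a ^ e a))"
    unfolding monomial_sum_def by blast
  then show ?thesis
    unfolding monomial_sum_def by (intro exI[of _ "J @ J'"]) simp
qed

lemma monomial_sum_scaled_monomial:
  assumes "monomial_sum k Q"
  shows "monomial_sum k (\<lambda>x. \<kappa> * (\<Prod>a<k. x a ^ e a) * Q x)"
proof -
  from assms obtain J where J: "\<forall>x. Q x = (\<Sum>(\<kappa>, e)\<leftarrow>J. \<kappa> * (\<Prod>a<k. x a ^ e a))"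
    unfolding monomial_sum_def by blast
  have "\<kappa> * (\<Prod>a<k. x a ^ e a) * (\<Sum>(\<kappa>, e)\<leftarrow>J. \<kappa> * (\<Prod>a<k. x a ^ e a)) =
     (\<Sum>(\<kappa>', e')\<leftarrow>map (\<lambda>(\<kappa>', e'). (\<kappa> * \<kappa>', \<lambda>a. e a + e' a)) J. \<kappa>' * (\<Prod>a<k. x a ^ e' a))" for x
    by (induction J) (auto simp: algebra_simps power_add prod.distrib)
  with J have "\<forall>x. \<kappa> * (\<Prod>a<k. x a ^ e a) * Q x =
     (\<Sum>(\<kappa>', e')\<leftarrow>map (\<lambda>(\<kappa>', e'). (\<kappa> * \<kappa>', \<lambda>a. e a + e' a)) J. \<kappa>' * (\<Prod>a<k. x a ^ e' a))"
    by simp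
  then show ?thesis
    unfolding monomial_sum_def by (rule exI)
qed

lemma monomial_sum_mult:
  assumes "monomial_sum k P" "monomial_sum k Q"
  shows "monomial_sum k (\<lambda>x. P x * Q x)"
proof -
  from assms(1) obtain J where J: "\<forall>x. P x = (\<Sum>(\<kappa>, e)\<leftarrow>J. \<kappa> * (\<Prod>a<k. x a ^ e a))"
    unfolding monomial_sum_def by blast
  have "monomial_sum k (\<lambda>x. (\<Sum>(\<kappa>, e)\<leftarrow>J. \<kappa> * (\<Prod>a<k. x a ^ e a)) * Q x)"
  proof (induction J)
    case Nil
    then show ?case using monomial_sum_const[of k 0] by simp
  next
    case (Cons p J)
    obtain \<kappa> e where p: "p = (\<kappa>, e)" by fastforce
    have "monomial_sum k (\<lambda>x. \<kappa> * (\<Prod>a<k. x a ^ e a) * Q x +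
            (\<Sum>(\<kappa>, e)\<leftarrow>J. \<kappa> * (\<Prod>a<k. x a ^ e a)) * Q x)"
      by (intro monomial_sum_add monomial_sum_scaled_monomial assms Cons.IH)
    then show ?case by (simp add: p distrib_right)
  qed
  with J show ?thesis by simp
qed

lemma monomial_sum_diff_var:
  assumes "i < k" "j < k"
  shows "monomial_sum k (\<lambda>x. x i - x j)"
  using monomial_sum_add[OF monomial_sum_var[OF assms(1)]
      monomial_sum_mult[OF monomial_sum_const[of k "-1"] monomial_sum_var[OF assms(2)]]]
  by simp

lemma monomial_sum_prod:
  assumes "finite I" "\<And>i. i \<in> I \<Longrightarrow> monomial_sum k (P i)"
  shows "monomial_sum k (\<lambda>x. \<Prod>i\<in>I. P i x)"
  using assms by (induction I) (simp_all add: monomial_sum_const monomial_sum_mult)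

text \<open>Up to sign the square of the Vandermonde determinant: both orders of each pair occur, so
  the value is invariant under permutations of the coordinates.\<close>

definition discr :: "nat \<Rightarrow> (nat \<Rightarrow> complex) \<Rightarrow> complex" where
  "discr k x = (\<Prod>(i, j)\<in>{(i, j). i < k \<and> j < k \<and> i \<noteq> j}. x i - x j)"

lemma discr_eq_0_iff: "discr k x = 0 \<longleftrightarrow> \<not> inj_on x {..<k}"
proof -
  have "finite {(i, j). i < k \<and> j < k \<and> i \<noteq> j}"
    by (rule finite_subset[of _ "{..<k} \<times> {..<k}"]) auto
  then show ?thesis
    unfolding discr_def by (auto simp: inj_on_def)
qed

lemma monomial_sum_discr: "monomial_sum k (discr k)"
proof -
  have "finite {(i, j). i < k \<and> j < k \<and> i \<noteq> j}"
    by (rule finite_subset[of _ "{..<k} \<times> {..<k}"]) auto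
  then have "monomial_sum k (\<lambda>x. \<Prod>p\<in>{(i, j). i < k \<and> j < k \<and> i \<noteq> j}. x (fst p) - x (snd p))"
    by (rule monomial_sum_prod) (auto intro: monomial_sum_diff_var)
  then show ?thesis
    by (simp add: discr_def[abs_def] case_prod_beta)
qed

text \<open>By Cauchy-Binet this is, up to sign, k! times the Hankel determinant of the moments
  \<open>\<Sum>w\<in>W. c w * w ^ (i + j)\<close> with \<open>i, j < k\<close>. Summing over tuples
  gives the same quantity without determinants.\<close>

definition moment_discr :: "nat \<Rightarrow> (complex \<Rightarrow> complex) \<Rightarrow> complex set \<Rightarrow> complex" where
  "moment_discr k c W = (\<Sum>t\<in>{..<k} \<rightarrow>\<^sub>E W. (\<Prod>a<k. c (t a)) * discr k t)"

lemma moment_discr_eq_0: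
  assumes "finite W" "card W < k"
  shows "moment_discr k c W = 0"
  unfolding moment_discr_def
proof (rule sum.neutral, clarify)
  fix t assume t: "t \<in> {..<k} \<rightarrow>\<^sub>E W"
  have "\<not> inj_on t {..<k}"
  proof
    assume "inj_on t {..<k}"
    then have "card {..<k} \<le> card W"
      using t assms(1) by (intro card_inj_on_le[of t]) auto
    with assms(2) show False by simp
  qed
  then show "(\<Prod>a<k. c (t a)) * discr k t = 0"
    by (simp add: discr_eq_0_iff)
qed

text \<open>The injective tuples of length \<open>card W\<close> all contribute the same summand, as they differ
  by a permutation of the coordinates.\<close>

lemma moment_discr_neq_0:
  assumes "finite W" "card W = k" "\<And>w. w \<in> W \<Longrightarrow> c w \<noteq> 0"
  shows "moment_discr k c W \<noteq> 0"
proof -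
  define X where "X = {t \<in> {..<k} \<rightarrow>\<^sub>E W. inj_on t {..<k}}"
  define Y where "Y = {(w, w'). w \<in> W \<and> w' \<in> W \<and> w \<noteq> w'}"
  define v where "v = (\<Prod>w\<in>W. c w) * (\<Prod>(w, w')\<in>Y. w - w')"
  have finY: "finite Y"
    unfolding Y_def by (rule finite_subset[of _ "W \<times> W"]) (use assms(1) in auto)
  have "finite ({..<k} \<rightarrow>\<^sub>E W)" using assms(1) by (simp add: finite_PiE)
  then have finX: "finite X" by (simp add: X_def)
  have val: "(\<Prod>a<k. c (t a)) * discr k t = v" if "t \<in> X" for t
  proof -
    have inj: "inj_on t {..<k}" and tW: "t ` {..<k} \<subseteq> W" using that by (auto simp: X_def)
    have "card (t ` {..<k}) = card W" using inj assms(2) by (simp add: card_image)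
    then have im: "t ` {..<k} = W" using tW assms(1) by (simp add: card_subset_eq)
    then have bij: "bij_betw t {..<k} W" using inj by (simp add: bij_betw_def)
    have "bij_betw (map_prod t t) {(i, j). i < k \<and> j < k \<and> i \<noteq> j} Y"
      unfolding bij_betw_def
    proof
      show "inj_on (map_prod t t) {(i, j). i < k \<and> j < k \<and> i \<noteq> j}"
        using inj by (auto simp: inj_on_def)
      show "map_prod t t ` {(i, j). i < k \<and> j < k \<and> i \<noteq> j} = Y"
        using im inj unfolding Y_def inj_on_def by (force simp: image_iff)
    qed
    from prod.reindex_bij_betw[OF this, of "\<lambda>(w, w'). w - w'"]
    have "discr k t = (\<Prod>(w, w')\<in>Y. w - w')"
      by (simp add: discr_def case_prod_beta)
    moreover have "(\<Prod>a<k. c (t a)) = (\<Prod>w\<in>W. c w)"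
      by (rule prod.reindex_bij_betw[OF bij])
    ultimately show ?thesis by (simp add: v_def)
  qed
  have "moment_discr k c W = (\<Sum>t\<in>X. (\<Prod>a<k. c (t a)) * discr k t)"
    unfolding moment_discr_def X_def
    using assms(1) by (intro sum.mono_neutral_right) (auto simp: finite_PiE discr_eq_0_iff)
  also have "\<dots> = of_nat (card X) * v"
    by (simp add: val)
  finally have eq: "moment_discr k c W = of_nat (card X) * v" .
  have "v \<noteq> 0"
    unfolding v_def using assms(1,3) finY by (auto simp: Y_def)
  \<comment> \<open>In characteristic zero it suffices that at least one injective tuple exists; any
    enumeration of \<open>W\<close> provides it.\<close>
  moreover obtain h where h: "bij_betw h {..<k} W"
    using ex_bij_betw_nat_finite[OF assms(1)] assms(2) by (auto simp: atLeast0LessThan)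
  have "restrict h {..<k} \<in> X"
    using h by (auto simp: X_def bij_betw_def)
  then have "card X \<noteq> 0" using finX by auto
  ultimately show ?thesis by (simp add: eq)
qed

text \<open>After expansion of \<open>discr\<close> into monomials, the sum over tuples of each
  monomial factorises into one moment per coordinate. The points of \<open>W z\<close> themselves
  need not depend holomorphically, or even continuously, on \<open>z\<close>.\<close>

lemma moment_discr_holomorphic:
  assumes "\<And>z. z \<in> B \<Longrightarrow> finite (W z)"
    and hol: "\<And>e. (\<lambda>z. \<Sum>w\<in>W z. c z w * w ^ e) holomorphic_on B"
  shows "(\<lambda>z. moment_discr k (c z) (W z)) holomorphic_on B"
proof -
  obtain J where J: "\<And>x. discr k x = (\<Sum>(\<kappa>, e)\<leftarrow>J. \<kappa> * (\<Prod>a<k. x a ^ e a))"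
    using monomial_sum_discr unfolding monomial_sum_def by blast
  have eq: "moment_discr k (c z) (W z) =
      (\<Sum>(\<kappa>, e)\<leftarrow>J. \<kappa> * (\<Prod>a<k. \<Sum>w\<in>W z. c z w * w ^ e a))" if "z \<in> B" for z
  proof -
    have "moment_discr k (c z) (W z) =
      (\<Sum>t\<in>{..<k} \<rightarrow>\<^sub>E W z. \<Sum>(\<kappa>, e)\<leftarrow>J. \<kappa> * (\<Prod>a<k. c z (t a) * t a ^ e a))"
      unfolding moment_discr_def J
      by (intro sum.cong refl)
        (simp add: prod.distrib sum_list_const_mult[symmetric] case_prod_unfold mult_ac)
    also have "\<dots> = (\<Sum>(\<kappa>, e)\<leftarrow>J. \<kappa> * (\<Sum>t\<in>{..<k} \<rightarrow>\<^sub>E W z. \<Prod>a<k. c z (t a) * t a ^ e a))"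
      by (induction J) (auto simp: sum.distrib sum_distrib_left)
    also have "\<dots> = (\<Sum>(\<kappa>, e)\<leftarrow>J. \<kappa> * (\<Prod>a<k. \<Sum>w\<in>W z. c z w * w ^ e a))"
      using assms(1)[OF that] by (subst prod_sum_PiE) auto
    finally show ?thesis .
  qed
  have "(\<lambda>z. \<Sum>(\<kappa>, e)\<leftarrow>J. \<kappa> * (\<Prod>a<k. \<Sum>w\<in>W z. c z w * w ^ e a)) holomorphic_on B"
    by (induction J) (auto intro!: holomorphic_intros hol)
  then show ?thesis
    by (rule holomorphic_transform) (simp add: eq)
qed

text \<open>The identity theorem on the connected ball: zeros of a function that is not identically
  zero are isolated. The value at \<open>b\<close> itself is left open.\<close>

lemma holomorphic_eventually_zero_or_nonzero:
  assumes "f holomorphic_on ball b \<rho>" "\<rho> > 0"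
  shows "(\<forall>\<^sub>F z in at b. f z = 0) \<or> (\<forall>\<^sub>F z in at b. f z \<noteq> 0)"
proof (cases "\<forall>z\<in>ball b \<rho>. f z = 0")
  case True
  then have "\<forall>\<^sub>F z in at b. f z = 0"
    using eventually_at_ball[OF assms(2), of b UNIV] by (auto elim!: eventually_mono)
  then show ?thesis ..
next
  case False
  then obtain z0 where "z0 \<in> ball b \<rho>" "f z0 \<noteq> 0" by auto
  then have "\<forall>\<^sub>F z in at b. f z \<noteq> 0"
    using non_zero_neighbour_alt[OF assms(1), of b z0] assms(2)
    by (auto elim!: eventually_mono)
  then show ?thesis ..
qed

text \<open>The cardinality is the largest \<open>k\<close> for which the \<open>k\<close>-th moment discriminant does not vanish.\<close>

lemma eventually_const_card_of_moments:
  fixes W :: "complex \<Rightarrow> complex set"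
  assumes "\<rho> > 0"
    and fin: "\<And>z. z \<in> ball b \<rho> \<Longrightarrow> finite (W z)"
    and nz: "\<And>z w. z \<in> ball b \<rho> \<Longrightarrow> w \<in> W z \<Longrightarrow> c z w \<noteq> 0"
    and bd: "\<forall>\<^sub>F z in at b. card (W z) \<le> N"
    and hol: "\<And>e. (\<lambda>z. \<Sum>w\<in>W z. c z w * w ^ e) holomorphic_on ball b \<rho>"
  shows "\<exists>n. \<forall>\<^sub>F z in at b. card (W z) = n"
proof -
  define D where "D k z = moment_discr k (c z) (W z)" for k z
  have D: "(\<forall>\<^sub>F z in at b. D k z = 0) \<or> (\<forall>\<^sub>F z in at b. D k z \<noteq> 0)" for k
    unfolding D_def
    by (rule holomorphic_eventually_zero_or_nonzero[OF moment_discr_holomorphic[OF fin hol] assms(1)])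
  define s where "s k \<longleftrightarrow> (\<forall>\<^sub>F z in at b. D k z \<noteq> 0)" for k
  have "\<forall>\<^sub>F z in at b. (D k z \<noteq> 0) = s k" for k
  proof (cases "s k")
    case True
    then show ?thesis by (simp add: s_def)
  next
    case False
    then have "\<forall>\<^sub>F z in at b. D k z = 0" using D[of k] by (simp add: s_def)
    with False show ?thesis by simp
  qed
  \<comment> \<open>Each \<open>k\<close> comes with its own punctured neighbourhood of
    \<open>b\<close>; the bound \<open>N\<close> leaves only finitely many of them to
    intersect.\<close>
  then have "\<forall>\<^sub>F z in at b. \<forall>k\<in>{..N}. (D k z \<noteq> 0) = s k"
    by (intro eventually_ball_finite) auto
  moreover have "\<forall>\<^sub>F z in at b. z \<in> ball b \<rho>"
    using eventually_at_ball[OF assms(1), of b UNIV] by eventually_elim auto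
  ultimately have "\<forall>\<^sub>F z in at b. card (W z) = Max {k. k \<le> N \<and> s k}"
    using bd
  proof eventually_elim
    case (elim z)
    have "{k. k \<le> N \<and> s k} = {k. k \<le> N \<and> D k z \<noteq> 0}" using elim(1) by auto
    moreover have "Max {k. k \<le> N \<and> D k z \<noteq> 0} = card (W z)"
    proof (rule Max_eqI)
      show "finite {k. k \<le> N \<and> D k z \<noteq> 0}" by simp
    next
      fix k assume "k \<in> {k. k \<le> N \<and> D k z \<noteq> 0}"
      then have "D k z \<noteq> 0" by simp
      then show "k \<le> card (W z)"
        using moment_discr_eq_0[OF fin[OF elim(2)], of k "c z"] unfolding D_def by linarith
    next
      have "D (card (W z)) z \<noteq> 0"
        unfolding D_def
        by (rule moment_discr_neq_0[OF fin[OF elim(2)] refl nz]) (use elim(2) in auto)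
      with elim(3) show "card (W z) \<in> {k. k \<le> N \<and> D k z \<noteq> 0}" by simp
    qed
    ultimately show ?case by simp
  qed
  then show ?thesis by blast
qed


subsection \<open>Holomorphic functions of two variables\<close>

lemma holomorphic2_on_imp_continuous_on:
  assumes "holomorphic2_on f U"
  shows "continuous_on U f"
  unfolding continuous_on_eq_continuous_within
proof
  fix p assume "p \<in> U"
  with assms obtain a b where "(f has_derivative (\<lambda>(h, k). a * h + b * k)) (at p)"
    unfolding holomorphic2_on_def by blast
  then have "isCont f p" by (rule has_derivative_continuous)
  then show "continuous (at p within U) f" by (rule continuous_at_imp_continuous_at_within)
qed

lemma holomorphic2_on_subset: "holomorphic2_on f U \<Longrightarrow> V \<subseteq> U \<Longrightarrow> holomorphic2_on f V"
  unfolding holomorphic2_on_def by blast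

lemma holomorphic2_on_const: "holomorphic2_on (\<lambda>_. c) U"
  unfolding holomorphic2_on_def
  by (intro ballI exI[of _ 0]) (auto simp: case_prod_unfold)

lemma holomorphic2_on_mult:
  assumes "holomorphic2_on f U" "holomorphic2_on g U"
  shows "holomorphic2_on (\<lambda>p. f p * g p) U"
  unfolding holomorphic2_on_def
proof
  fix p assume "p \<in> U"
  with assms obtain a b a' b' where
    f: "(f has_derivative (\<lambda>(h, k). a * h + b * k)) (at p)" and
    g: "(g has_derivative (\<lambda>(h, k). a' * h + b' * k)) (at p)"
    unfolding holomorphic2_on_def by meson
  have "((\<lambda>p. f p * g p) has_derivative
      (\<lambda>(h, k). (f p * a' + a * g p) * h + (f p * b' + b * g p) * k)) (at p)"
    by (rule has_derivative_eq_rhs[OF has_derivative_mult[OF f g]]) (auto simp: algebra_simps)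
  then show "\<exists>a b. ((\<lambda>p. f p * g p) has_derivative (\<lambda>(h, k). a * h + b * k)) (at p)" by blast
qed

lemma holomorphic2_on_slice_fst:
  assumes "holomorphic2_on f U" "A \<times> {z} \<subseteq> U"
  shows "(\<lambda>w. f (w, z)) holomorphic_on A"
  unfolding holomorphic_on_def
proof
  fix w assume "w \<in> A"
  with assms obtain a b where f: "(f has_derivative (\<lambda>(h, k). a * h + b * k)) (at (w, z))"
    unfolding holomorphic2_on_def by blast
  have "((\<lambda>w. (w, z)) has_derivative (\<lambda>h. (h, 0))) (at w)"
    by (auto intro!: derivative_eq_intros)
  from has_derivative_compose[OF this f] have "((\<lambda>w. f (w, z)) has_field_derivative a) (at w)"
    by (simp add: has_field_derivative_def mult.commute[of a] case_prod_unfold)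
      (simp add: has_derivative_def mult.commute bounded_linear_mult_right)
  then show "(\<lambda>w. f (w, z)) field_differentiable at w within A"
    using field_differentiable_at_within field_differentiable_def by blast
qed

lemma holomorphic2_on_slice_snd:
  assumes "holomorphic2_on f U" "{w} \<times> A \<subseteq> U"
  shows "(\<lambda>z. f (w, z)) holomorphic_on A"
  unfolding holomorphic_on_def
proof
  fix z assume "z \<in> A"
  with assms obtain a b where f: "(f has_derivative (\<lambda>(h, k). a * h + b * k)) (at (w, z))"
    unfolding holomorphic2_on_def by blast
  have "((\<lambda>z. (w, z)) has_derivative (\<lambda>h. (0, h))) (at z)"
    by (auto intro!: derivative_eq_intros)
  from has_derivative_compose[OF this f] have "((\<lambda>z. f (w, z)) has_field_derivative b) (at z)"
    by (simp add: has_field_derivative_def mult.commute[of b] case_prod_unfold)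
      (simp add: has_derivative_def mult.commute bounded_linear_mult_right)
  then show "(\<lambda>z. f (w, z)) field_differentiable at z within A"
    using field_differentiable_at_within field_differentiable_def by blast
qed

section \<open>Contour integrals depending on a parameter\<close>

lemma continuous_on_contour_integral_param:
  fixes \<phi> :: "'a::topological_space \<Rightarrow> complex \<Rightarrow> complex"
  assumes "continuous_on (X \<times> sphere a r) (\<lambda>(x, u). \<phi> x u)" "r > 0"
  shows "continuous_on X (\<lambda>x. contour_integral (circlepath a r) (\<phi> x))"
proof -
  have c: "continuous_on S (\<lambda>p. circlepath a r (snd p))" for S :: "('a \<times> real) set"
    unfolding circlepath by (intro continuous_intros)
  have im: "circlepath a r t \<in> sphere a r" for t
    using assms(2) by (simp add: circlepath dist_norm norm_mult)
  have "continuous_on (X \<times> cbox 0 1) (\<lambda>p. (fst p, circlepath a r (snd p)))"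
    by (intro continuous_on_Pair continuous_on_fst continuous_on_id c)
  then have "continuous_on (X \<times> cbox 0 1) (\<lambda>p. \<phi> (fst p) (circlepath a r (snd p)))"
    using continuous_on_compose2[OF assms(1)] im by force
  then have "continuous_on (X \<times> cbox 0 1)
      (\<lambda>(x, t). \<phi> x (circlepath a r t) * vector_derivative (circlepath a r) (at t))"
    unfolding case_prod_unfold vector_derivative_circlepath
    by (intro continuous_on_mult) (auto intro!: continuous_intros)
  from integral_continuous_on_param[OF this] show ?thesis
    by (simp add: contour_integral_integral cbox_interval)
qed

text \<open>Morera's theorem: exchanging the integrals turns the integral over a triangle into a
  circle integral of triangle integrals, and these vanish by Cauchy's theorem for each fixed
  \<open>u\<close>.\<close>

lemma holomorphic_on_contour_integral_param:
  fixes \<phi> :: "complex \<Rightarrow> complex \<Rightarrow> complex"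
  assumes cont: "continuous_on (B \<times> sphere a r) (\<lambda>(x, u). \<phi> x u)" and "r > 0" "open B"
    and hol: "\<And>u. u \<in> sphere a r \<Longrightarrow> (\<lambda>x. \<phi> x u) holomorphic_on B"
  shows "(\<lambda>x. contour_integral (circlepath a r) (\<phi> x)) holomorphic_on B"
proof (intro analytic_imp_holomorphic Morera_triangle impI \<open>open B\<close>)
  let ?I = "\<lambda>x. contour_integral (circlepath a r) (\<phi> x)"
  show "continuous_on B ?I"
    by (rule continuous_on_contour_integral_param[OF cont \<open>r > 0\<close>])
  have pi: "path_image (circlepath a r) = sphere a r" using \<open>r > 0\<close> by simp
  fix p q s assume sub: "convex hull {p, q, s} \<subseteq> B"
  define T where "T u p q = contour_integral (linepath p q) (\<lambda>x. \<phi> x u)" for u p q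
  have seg: "closed_segment p q \<subseteq> B" "closed_segment q s \<subseteq> B" "closed_segment s p \<subseteq> B"
    by (rule order_trans[OF closed_segment_subset[OF _ _ convex_convex_hull] sub]; simp add: hull_inc)+
  have swap: "contour_integral (linepath p q) ?I = contour_integral (circlepath a r) (\<lambda>u. T u p q)"
    if "closed_segment p q \<subseteq> B" for p q
    unfolding T_def
  proof (rule contour_integral_swap)
    show "continuous_on (path_image (linepath p q) \<times> path_image (circlepath a r)) (\<lambda>(x, u). \<phi> x u)"
      by (rule continuous_on_subset[OF cont]) (use that pi in auto)
    show "continuous_on {0..1} (\<lambda>t. vector_derivative (linepath p q) (at t))"
      unfolding vector_derivative_linepath_at by (rule continuous_on_const)
    show "continuous_on {0..1} (\<lambda>t. vector_derivative (circlepath a r) (at t))"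
      unfolding vector_derivative_circlepath by (intro continuous_intros)
  qed simp_all
  \<comment> \<open>Continuity in \<open>u\<close> makes the three side integrals integrable along
    the circle, so that they may be added under the integral sign.\<close>
  have contT: "continuous_on (sphere a r) (\<lambda>u. T u p q)" if "closed_segment p q \<subseteq> B" for p q
  proof -
    have "continuous_on (sphere a r \<times> cbox 0 1) (\<lambda>p'. (linepath p q (snd p'), fst p'))"
      unfolding linepath_def by (intro continuous_intros)
    then have "continuous_on (sphere a r \<times> cbox 0 1) (\<lambda>p'. \<phi> (linepath p q (snd p')) (fst p'))"
      by (rule continuous_on_compose2[OF cont, unfolded case_prod_unfold, of _ "\<lambda>p'. (linepath p q (snd p'), fst p')", unfolded fst_conv snd_conv])
        (use linepath_in_path[of _ p q] that in fastforce)
    then have "continuous_on (sphere a r \<times> cbox 0 1)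
        (\<lambda>(u, t). \<phi> (linepath p q t) u * vector_derivative (linepath p q) (at t))"
      unfolding case_prod_unfold vector_derivative_linepath_at
      by (intro continuous_on_mult continuous_on_const)
    from integral_continuous_on_param[OF this] show ?thesis
      by (simp add: contour_integral_integral T_def cbox_interval)
  qed
  have int: "(\<lambda>u. T u p q) contour_integrable_on circlepath a r" if "closed_segment p q \<subseteq> B" for p q
    by (rule contour_integrable_continuous_circlepath) (use contT[OF that] pi in simp)
  have "contour_integral (linepath p q) ?I + contour_integral (linepath q s) ?I +
        contour_integral (linepath s p) ?I =
        contour_integral (circlepath a r) (\<lambda>u. T u p q + T u q s + T u s p)"
    unfolding swap[OF seg(1)] swap[OF seg(2)] swap[OF seg(3)]
    using int[OF seg(1)] int[OF seg(2)] int[OF seg(3)]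
    by (simp add: contour_integral_add contour_integrable_add)
  also have "\<dots> = contour_integral (circlepath a r) (\<lambda>u. 0)"
  proof (rule contour_integral_eq)
    fix u assume "u \<in> path_image (circlepath a r)"
    then have h: "(\<lambda>x. \<phi> x u) holomorphic_on B" using pi \<open>r > 0\<close> by (intro hol) simp
    show "T u p q + T u q s + T u s p = 0"
      unfolding T_def
      by (rule has_chain_integral_chain_integral3[OF
            Cauchy_theorem_triangle[OF holomorphic_on_subset[OF h sub]]])
  qed
  finally show "contour_integral (linepath p q) ?I + contour_integral (linepath q s) ?I +
        contour_integral (linepath s p) ?I = 0" by simp
qed

text \<open>The argument principle writes the moment as a circle integral of (df/dw) g / f, which
  depends holomorphically on \<open>z\<close> because \<open>f\<close> has no zeros on the circle.
  The larger radius \<open>R\<close> leaves room for a Cauchy integral that represents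
  df/dw.\<close>

lemma zero_moment_holomorphic:
  fixes f g :: "complex \<times> complex \<Rightarrow> complex"
  assumes f: "holomorphic2_on f V" and g: "holomorphic2_on g V"
    and sub: "cball a R \<times> ball b \<rho> \<subseteq> V" and r: "0 < r" "r < R"
    and nonzero: "\<forall>w\<in>sphere a r. \<forall>z\<in>ball b \<rho>. f (w, z) \<noteq> 0"
  defines "Z \<equiv> \<lambda>z. {w \<in> ball a r. f (w, z) = 0}"
  shows "z \<in> ball b \<rho> \<Longrightarrow> finite (Z z)"
    and "z \<in> ball b \<rho> \<Longrightarrow> w \<in> Z z \<Longrightarrow> zorder (\<lambda>w. f (w, z)) w > 0"
    and "(\<lambda>z. \<Sum>w\<in>Z z. of_int (zorder (\<lambda>w. f (w, z)) w) * g (w, z)) holomorphic_on ball b \<rho>"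
proof -
  have nz: "f (w, z) \<noteq> 0" if "w \<in> sphere a r" "z \<in> ball b \<rho>" for w z
    using nonzero that by blast
  have holf: "(\<lambda>w. f (w, z)) holomorphic_on cball a R" and holg: "(\<lambda>w. g (w, z)) holomorphic_on cball a R"
    if "z \<in> ball b \<rho>" for z
    using that sub by (auto intro!: holomorphic2_on_slice_fst[OF f] holomorphic2_on_slice_fst[OF g])
  have holf': "(\<lambda>w. f (w, z)) holomorphic_on ball a R" if "z \<in> ball b \<rho>" for z
    using holf[OF that] by (rule holomorphic_on_subset) simp
  \<comment> \<open>An intermediate open disc as domain for the argument principle: it contains the
    circle of radius \<open>r\<close>, and its closure is a compact subset of
    \<open>ball a R\<close>, hence contains only finitely many zeros.\<close>
  obtain R' where R': "r < R'" "R' < R" using dense r by blast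
  have ar: "a + of_real r \<in> sphere a r" using r by (simp add: dist_norm)
  have fin: "finite {w \<in> cball a R'. f (w, z) = 0}" if z: "z \<in> ball b \<rho>" for z
  proof (cases "(\<lambda>w. f (w, z)) constant_on ball a R")
    case True
    then obtain c where c: "\<And>w. w \<in> ball a R \<Longrightarrow> f (w, z) = c" unfolding constant_on_def by blast
    have "a + of_real r \<in> ball a R" using r by (simp add: dist_norm)
    with c nz[OF ar z] have "c \<noteq> 0" by metis
    then have "{w \<in> cball a R'. f (w, z) = 0} = {}" using c R' by force
    then show ?thesis by (metis finite.emptyI)
  next
    case False
    then show ?thesis
      using R' by (intro holomorphic_compact_finite_zeros[OF holf'[OF z]]) auto
  qed
  have finZ: "finite (Z z)" if "z \<in> ball b \<rho>" for z
    by (rule finite_subset[OF _ fin[OF that]]) (use R' in \<open>auto simp: Z_def\<close>)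
  show "z \<in> ball b \<rho> \<Longrightarrow> finite (Z z)" by (rule finZ)
  show "zorder (\<lambda>w. f (w, z)) w > 0" if z: "z \<in> ball b \<rho>" and w: "w \<in> Z z"
  proof -
    have "a + of_real r \<in> ball a R" "w \<in> ball a R" using w r by (auto simp: Z_def dist_norm)
    from non_zero_neighbour_alt[OF holf'[OF z] open_ball connected_ball this(2,1) nz[OF ar z]]
    have "\<forall>\<^sub>F w in at w. f (w, z) \<noteq> 0" by (rule eventually_mono) simp
    then have "\<exists>\<^sub>F w in at w. f (w, z) \<noteq> 0"
      by (simp add: eventually_frequently)
    from zorder_pos_iff[OF holf'[OF z] open_ball _ this] w r show ?thesis
      by (auto simp: Z_def)
  qed
  \<comment> \<open>The derivative in the first variable as a Cauchy integral over the outer circle: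
    its joint continuity and its holomorphy in \<open>z\<close> then reduce to those of
    \<open>f\<close>.\<close>
  define df where "df z w = 1 / (2 * of_real pi * \<i>) *
    contour_integral (circlepath a R) (\<lambda>u. f (u, z) / (u - w)\<^sup>2)" for z w
  have R: "R > 0" using r by simp
  have contf: "continuous_on V f" and contg: "continuous_on V g"
    using f g by (auto intro: holomorphic2_on_imp_continuous_on)
  have deriv: "deriv (\<lambda>w. f (w, z)) w = df z w" if z: "z \<in> ball b \<rho>" and w: "w \<in> sphere a r" for z w
    unfolding df_def
  proof (rule DERIV_imp_deriv, rule Cauchy_derivative_integral_circlepath(2))
    show "continuous_on (cball a R) (\<lambda>w. f (w, z))"
      using holf[OF z] by (rule holomorphic_on_imp_continuous_on)
    show "(\<lambda>w. f (w, z)) holomorphic_on ball a R" by (rule holf'[OF z])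
    show "w \<in> ball a R" using w r by simp
  qed
  have cont_df: "continuous_on (ball b \<rho> \<times> sphere a r) (\<lambda>(z, w). df z w)"
    unfolding df_def case_prod_unfold
  proof (intro continuous_intros continuous_on_contour_integral_param \<open>R > 0\<close>)
    show "continuous_on ((ball b \<rho> \<times> sphere a r) \<times> sphere a R)
        (\<lambda>(x, u). f (u, fst x) / (u - snd x)\<^sup>2)"
      unfolding case_prod_unfold
      using r sub by (intro continuous_intros continuous_on_compose2[OF contf]) auto
  qed
  have hol_df: "(\<lambda>z. df z w) holomorphic_on ball b \<rho>" if w: "w \<in> sphere a r" for w
    unfolding df_def
  proof (intro holomorphic_intros holomorphic_on_contour_integral_param \<open>R > 0\<close> open_ball)
    show "continuous_on (ball b \<rho> \<times> sphere a R) (\<lambda>(x, u). f (u, x) / (u - w)\<^sup>2)"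
      unfolding case_prod_unfold
      using r sub w by (intro continuous_intros continuous_on_compose2[OF contf]) auto
    show "(\<lambda>x. f (u, x)) holomorphic_on ball b \<rho>" if "u \<in> sphere a R" for u
      using that sub by (intro holomorphic2_on_slice_snd[OF f]) auto
  qed (use w r in auto)
  let ?I = "\<lambda>z. 1 / (2 * of_real pi * \<i>) *
    contour_integral (circlepath a r) (\<lambda>w. df z w * g (w, z) / f (w, z))"
  have "?I holomorphic_on ball b \<rho>"
  proof (intro holomorphic_intros holomorphic_on_contour_integral_param \<open>r > 0\<close> open_ball)
    show "continuous_on (ball b \<rho> \<times> sphere a r) (\<lambda>(x, u). df x u * g (u, x) / f (u, x))"
      unfolding case_prod_unfold
      using r sub nz
      by (intro continuous_intros continuous_on_compose2[OF contf] continuous_on_compose2[OF contg]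
          cont_df[unfolded case_prod_unfold]) auto
    show "(\<lambda>x. f (u, x)) holomorphic_on ball b \<rho>" "(\<lambda>x. g (u, x)) holomorphic_on ball b \<rho>"
      if "u \<in> sphere a r" for u
      using that sub r
      by (auto intro!: holomorphic2_on_slice_snd[OF f] holomorphic2_on_slice_snd[OF g])
  qed (use hol_df nz in auto)
  moreover have "?I z = (\<Sum>w\<in>Z z. of_int (zorder (\<lambda>w. f (w, z)) w) * g (w, z))"
    if z: "z \<in> ball b \<rho>" for z
  proof -
    \<comment> \<open>The empty set stands for the poles in the form in which the argument principle
      is applied.\<close>
    define pz where "pz = {w \<in> ball a R'. f (w, z) = 0 \<or> w \<in> {}}"
    have finpz: "finite pz" unfolding pz_def by (rule finite_subset[OF _ fin[OF z]]) auto
    have "contour_integral (circlepath a r) (\<lambda>w. df z w * g (w, z) / f (w, z)) =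
          contour_integral (circlepath a r) (\<lambda>w. deriv (\<lambda>w. f (w, z)) w * g (w, z) / f (w, z))"
      using r z by (intro contour_integral_eq) (auto simp: deriv)
    also have "\<dots> = 2 * pi * \<i> *
        (\<Sum>p\<in>pz. winding_number (circlepath a r) p * g (p, z) * zorder (\<lambda>w. f (w, z)) p)"
      unfolding pz_def
    proof (rule argument_principle)
      show "(\<lambda>w. f (w, z)) holomorphic_on ball a R' - {}" "(\<lambda>w. g (w, z)) holomorphic_on ball a R'"
        using R' by (auto intro!: holomorphic_on_subset[OF holf[OF z]] holomorphic_on_subset[OF holg[OF z]])
      show "path_image (circlepath a r) \<subseteq> ball a R' - {w \<in> ball a R'. f (w, z) = 0 \<or> w \<in> {}}"
        using r R' nz z by auto
      show "\<forall>w. w \<notin> ball a R' \<longrightarrow> winding_number (circlepath a r) w = 0"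
        using r R' by (intro allI impI winding_number_zero_outside[of _ "cball a r"]) auto
    qed (use finpz in \<open>auto simp: pz_def\<close>)
    \<comment> \<open>Zeros between the two circles have winding number zero, and none lies on the
      inner circle.\<close>
    also have "(\<Sum>p\<in>pz. winding_number (circlepath a r) p * g (p, z) * zorder (\<lambda>w. f (w, z)) p) =
        (\<Sum>p\<in>Z z. winding_number (circlepath a r) p * g (p, z) * zorder (\<lambda>w. f (w, z)) p)"
    proof (rule sum.mono_neutral_right[OF finpz])
      show "Z z \<subseteq> pz" using R' by (auto simp: Z_def pz_def)
      show "\<forall>p\<in>pz - Z z. winding_number (circlepath a r) p * g (p, z) * zorder (\<lambda>w. f (w, z)) p = 0"
      proof
        fix p assume p: "p \<in> pz - Z z"
        then have "p \<notin> sphere a r" using nz z by (auto simp: pz_def)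
        with p have "p \<notin> cball a r" by (auto simp: Z_def pz_def)
        then have "winding_number (circlepath a r) p = 0"
          using r by (intro winding_number_zero_outside[of _ "cball a r"]) auto
        then show "winding_number (circlepath a r) p * g (p, z) * zorder (\<lambda>w. f (w, z)) p = 0" by simp
      qed
    qed
    also have "\<dots> = (\<Sum>w\<in>Z z. of_int (zorder (\<lambda>w. f (w, z)) w) * g (w, z))"
      by (intro sum.cong refl) (auto simp: Z_def winding_number_circlepath dist_norm norm_minus_commute)
    finally show ?thesis by simp
  qed
  ultimately show "(\<lambda>z. \<Sum>w\<in>Z z. of_int (zorder (\<lambda>w. f (w, z)) w) * g (w, z)) holomorphic_on ball b \<rho>"
    by (rule holomorphic_transform)
qed


subsection \<open>Counting points on slices of analytic sets\<close>

lemma holomorphic2_on_fst: "holomorphic2_on fst U"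
  unfolding holomorphic2_on_def
proof
  fix p :: "complex \<times> complex"
  have "(fst has_derivative (\<lambda>(h, k). 1 * h + 0 * k)) (at p)"
    by (rule has_derivative_eq_rhs[OF has_derivative_fst[OF has_derivative_ident]]) auto
  then show "\<exists>a b. (fst has_derivative (\<lambda>(h, k). a * h + b * k)) (at p)" by blast
qed

lemma holomorphic2_on_snd: "holomorphic2_on snd U"
  unfolding holomorphic2_on_def
proof
  fix p :: "complex \<times> complex"
  have "(snd has_derivative (\<lambda>(h, k). 0 * h + 1 * k)) (at p)"
    by (rule has_derivative_eq_rhs[OF has_derivative_snd[OF has_derivative_ident]]) auto
  then show "\<exists>a b. (snd has_derivative (\<lambda>(h, k). a * h + b * k)) (at p)" by blast
qed

lemma holomorphic2_on_power: "holomorphic2_on f U \<Longrightarrow> holomorphic2_on (\<lambda>p. f p ^ n) U"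
  by (induction n) (simp_all add: holomorphic2_on_const holomorphic2_on_mult)

lemma eventually_compact_slice:
  assumes "compact K" "open W" "K \<times> {b} \<subseteq> W"
  shows "\<forall>\<^sub>F z in nhds b. K \<times> {z} \<subseteq> W"
proof -
  have opn: "open (prod.swap -` W)"
    by (rule open_vimage[OF assms(2) continuous_on_swap])
  have sub: "{b} \<times> K \<subseteq> prod.swap -` W" using assms(3) by auto
  from Elementary_Topology.tube_lemma[OF assms(1) opn sub]
  obtain X where "b \<in> X" "open X" "X \<times> K \<subseteq> prod.swap -` W" by blast
  then show ?thesis
    unfolding eventually_nhds by (intro exI[of _ X]) auto
qed

text \<open>Further equations \<open>h = 0\<close> are imposed one at a time: the zeros with \<open>h = 0\<close> are counted by
  subtracting those at which \<open>g h \<noteq> 0\<close>.\<close>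

lemma eventually_const_zero_count:
  fixes f :: "complex \<times> complex \<Rightarrow> complex"
  assumes f: "holomorphic2_on f V" and sub: "cball a R \<times> ball b \<rho> \<subseteq> V"
    and r: "0 < r" "r < R" and "\<rho> > 0"
    and nz: "\<forall>w\<in>sphere a r. \<forall>z\<in>ball b \<rho>. f (w, z) \<noteq> 0"
    and "finite G" "\<And>h. h \<in> G \<Longrightarrow> holomorphic2_on h V" "holomorphic2_on g V"
  shows "\<exists>n. \<forall>\<^sub>F z in at b.
    card {w \<in> ball a r. f (w, z) = 0 \<and> g (w, z) \<noteq> 0 \<and> (\<forall>h\<in>G. h (w, z) = 0)} = n"
  using assms(7-9)
proof (induction G arbitrary: g)
  case empty
  define Z where "Z z = {w \<in> ball a r. f (w, z) = 0}" for z
  define W where "W z = {w \<in> ball a r. f (w, z) = 0 \<and> g (w, z) \<noteq> 0}" for z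
  define d where "d z w = zorder (\<lambda>w. f (w, z)) w" for z w
  note moments = zero_moment_holomorphic[OF f _ sub r nz, folded Z_def, folded d_def]
  have finZ: "finite (Z z)" if "z \<in> ball b \<rho>" for z
    using moments(1)[OF holomorphic2_on_const that] .
  have d: "d z w > 0" if "z \<in> ball b \<rho>" "w \<in> Z z" for z w
    using moments(2)[OF holomorphic2_on_const that] .
  have WZ: "W z \<subseteq> Z z" for z by (auto simp: W_def Z_def)
  \<comment> \<open>The moment for \<open>g = 1\<close> is the number of zeros counted with order.
    Being continuous at \<open>b\<close>, it is bounded nearby, and it dominates the number of
    distinct zeros because all orders are positive.\<close>
  define S where "S z = (\<Sum>w\<in>Z z. of_int (d z w) * (1 :: complex))" for z
  have "S holomorphic_on ball b \<rho>"
    unfolding S_def by (rule moments(3)[OF holomorphic2_on_const])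
  then have "isCont S b"
    using \<open>\<rho> > 0\<close> by (metis centre_in_ball continuous_on_eq_continuous_at
        holomorphic_on_imp_continuous_on open_ball)
  then have "((\<lambda>z. norm (S z)) \<longlongrightarrow> norm (S b)) (at b)"
    by (intro tendsto_norm) (simp add: isCont_def)
  then have "\<forall>\<^sub>F z in at b. norm (S z) < norm (S b) + 1"
    by (rule order_tendstoD) simp
  moreover have ball: "\<forall>\<^sub>F z in at b. z \<in> ball b \<rho>"
    using eventually_at_ball[OF \<open>\<rho> > 0\<close>, of b UNIV] by simp
  ultimately have bd: "\<forall>\<^sub>F z in at b. card (W z) \<le> nat \<lceil>norm (S b) + 1\<rceil>"
  proof eventually_elim
    case (elim z)
    have "card (W z) \<le> card (Z z)" by (rule card_mono[OF finZ[OF elim(2)] WZ])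
    also have "int (card (Z z)) = (\<Sum>w\<in>Z z. 1)" by simp
    also have "\<dots> \<le> (\<Sum>w\<in>Z z. d z w)"
      by (rule sum_mono) (use d[OF elim(2)] in force)
    finally have "real (card (W z)) \<le> real_of_int (\<Sum>w\<in>Z z. d z w)" by linarith
    also have "\<dots> \<le> norm (S z)"
    proof -
      have "S z = of_int (\<Sum>w\<in>Z z. d z w)" by (simp add: S_def)
      then show ?thesis by (simp only: norm_of_int)
    qed
    also note elim(1)
    finally show ?case by linarith
  qed
  \<comment> \<open>The power of \<open>w\<close> is absorbed into the test function. Zeros with
    \<open>g = 0\<close> contribute nothing, so the moment over \<open>Z z\<close> is already the
    moment over \<open>W z\<close>, where the weights do not vanish.\<close>
  have hol: "(\<lambda>z. \<Sum>w\<in>W z. (of_int (d z w) * g (w, z)) * w ^ e) holomorphic_on ball b \<rho>" for e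
  proof -
    have "holomorphic2_on (\<lambda>p. g p * fst p ^ e) V"
      by (intro holomorphic2_on_mult holomorphic2_on_power holomorphic2_on_fst empty.prems)
    from moments(3)[OF this] show ?thesis
    proof (rule holomorphic_transform)
      fix z assume z: "z \<in> ball b \<rho>"
      show "(\<Sum>w\<in>Z z. of_int (d z w) * (g (w, z) * fst (w, z) ^ e)) =
          (\<Sum>w\<in>W z. (of_int (d z w) * g (w, z)) * w ^ e)"
        by (rule sum.mono_neutral_cong_right[OF finZ[OF z] WZ]) (auto simp: W_def Z_def)
    qed
  qed
  have "\<exists>n. \<forall>\<^sub>F z in at b. card (W z) = n"
  proof (rule eventually_const_card_of_moments[OF \<open>\<rho> > 0\<close> _ _ bd hol])
    show "finite (W z)" if "z \<in> ball b \<rho>" for z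
      using finite_subset[OF WZ finZ[OF that]] .
    show "of_int (d z w) * g (w, z) \<noteq> 0" if "z \<in> ball b \<rho>" "w \<in> W z" for z w
    proof -
      have "w \<in> Z z" using that(2) WZ by blast
      from d[OF that(1) this] show ?thesis using that(2) by (simp add: W_def)
    qed
  qed
  then show ?case by (simp add: W_def)
next
  case (insert h G)
  define C where "C g z = {w \<in> ball a r. f (w, z) = 0 \<and> g (w, z) \<noteq> 0 \<and> (\<forall>h\<in>G. h (w, z) = 0)}"
    for g :: "complex \<times> complex \<Rightarrow> complex" and z
  have "holomorphic2_on (\<lambda>p. g p * h p) V"
    by (intro holomorphic2_on_mult insert.prems) auto
  then obtain m n where mn: "\<forall>\<^sub>F z in at b. card (C g z) = n" "\<forall>\<^sub>F z in at b. card (C (\<lambda>p. g p * h p) z) = m"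
    using insert.IH[of g] insert.IH[of "\<lambda>p. g p * h p"] insert.prems unfolding C_def by auto
  have "\<forall>\<^sub>F z in at b. z \<in> ball b \<rho>"
    using eventually_at_ball[OF \<open>\<rho> > 0\<close>, of b UNIV] by simp
  then have "\<forall>\<^sub>F z in at b. card {w \<in> ball a r. f (w, z) = 0 \<and> g (w, z) \<noteq> 0 \<and>
      (\<forall>h\<in>insert h G. h (w, z) = 0)} = n - m"
    using mn
  proof eventually_elim
    case (elim z)
    have "finite (C g z)"
      using zero_moment_holomorphic(1)[OF f holomorphic2_on_const sub r nz elim(1)]
      by (rule rev_finite_subset) (auto simp: C_def)
    moreover have sub: "C (\<lambda>p. g p * h p) z \<subseteq> C g z" by (auto simp: C_def)
    ultimately have "card (C g z - C (\<lambda>p. g p * h p) z) = n - m"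
      using elim(2,3) by (simp add: card_Diff_subset finite_subset)
    moreover have "C g z - C (\<lambda>p. g p * h p) z =
        {w \<in> ball a r. f (w, z) = 0 \<and> g (w, z) \<noteq> 0 \<and> (\<forall>h\<in>insert h G. h (w, z) = 0)}"
      by (auto simp: C_def)
    ultimately show ?case by simp
  qed
  then show ?case by blast
qed

text \<open>One of the local equations, \<open>f\<close>, does not vanish identically on the slice
  through \<open>b\<close>, and the disc is chosen so that \<open>a\<close> is its only possible
  zero there. For \<open>z\<close> near \<open>b\<close>, compactness pushes the zeros of
  \<open>f\<close> into any prescribed neighbourhood \<open>W\<close> of \<open>a\<close>, so the
  count does not depend on \<open>W\<close>; this uniformity is what \<open>local_mult\<close> asks
  for.\<close>

lemma analytic_slice_count:
  assumes "analytic_subset_C2 A" and iso: "\<forall>\<^sub>F w in at a. (w, b) \<notin> A"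
    and "(a, b) \<in> A"
  shows "\<exists>r>0. \<exists>n. \<forall>W. open W \<and> a \<in> W \<and> W \<subseteq> ball a r \<longrightarrow>
    (\<forall>\<^sub>F z in at b. finite {w \<in> W. (w, z) \<in> A} \<and> card {w \<in> W. (w, z) \<in> A} = n)"
proof -
  obtain V F where V: "open V" "(a, b) \<in> V" and F: "finite F" "\<And>f. f \<in> F \<Longrightarrow> holomorphic2_on f V"
    and A: "A \<inter> V = {q \<in> V. \<forall>f\<in>F. f q = 0}"
    using assms(1) unfolding analytic_subset_C2_def by meson
  have memA: "q \<in> A \<longleftrightarrow> (\<forall>f\<in>F. f q = 0)" if "q \<in> V" for q
    using A that by blast
  obtain R0 \<rho>0 where R0: "R0 > 0" "\<rho>0 > 0" "ball a R0 \<times> ball b \<rho>0 \<subseteq> V"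
  proof -
    obtain X Y where "open X" "open Y" "a \<in> X" "b \<in> Y" "X \<times> Y \<subseteq> V"
      using V by (metis mem_Sigma_iff open_prod_elim)
    moreover then obtain R0 \<rho>0 where "R0 > 0" "ball a R0 \<subseteq> X" "\<rho>0 > 0" "ball b \<rho>0 \<subseteq> Y"
      by (meson open_contains_ball)
    ultimately show ?thesis using that[of R0 \<rho>0] by blast
  qed
  have slice: "(\<lambda>w. f (w, b)) holomorphic_on ball a R0" if "f \<in> F" for f
    using R0 by (intro holomorphic2_on_slice_fst[OF F(2)[OF that]]) auto
  \<comment> \<open>If all equations vanished along the slice, a whole disc would lie in
    \<open>A\<close>, against \<open>iso\<close>.\<close>
  have "\<exists>f\<in>F. \<exists>w\<in>ball a R0. f (w, b) \<noteq> 0"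
  proof (rule ccontr)
    assume "\<not> ?thesis"
    then have "(w, b) \<in> A" if "w \<in> ball a R0" for w
    proof -
      have "(w, b) \<in> ball a R0 \<times> ball b \<rho>0" using that R0(2) by simp
      with R0(3) have "(w, b) \<in> V" by blast
      then show ?thesis using memA \<open>\<not> (\<exists>f\<in>F. _)\<close> that by blast
    qed
    moreover have "\<forall>\<^sub>F w in at a. w \<in> ball a R0"
      using eventually_at_ball[OF R0(1), of a UNIV] by simp
    ultimately have "\<forall>\<^sub>F w in at a. (w, b) \<in> A"
      by (auto elim!: eventually_mono)
    from eventually_conj[OF iso this] have "\<forall>\<^sub>F w in at a. False"
      by simp
    then show False by simp
  qed
  then obtain f w0 where f: "f \<in> F" "w0 \<in> ball a R0" "f (w0, b) \<noteq> 0" by blast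
  have "\<forall>\<^sub>F w in at a. f (w, b) \<noteq> 0 \<and> w \<in> ball a R0"
    using non_zero_neighbour_alt[OF slice[OF f(1)] _ _ _ f(2,3), of a] R0(1) by simp
  then obtain R where R: "R > 0" "\<And>w. w \<noteq> a \<Longrightarrow> dist w a < R \<Longrightarrow> f (w, b) \<noteq> 0 \<and> w \<in> ball a R0"
    unfolding eventually_at by auto
  \<comment> \<open>Any \<open>0 < r < R' < R\<close> would do: \<open>r\<close> is the radius of
    the counting circle, \<open>R'\<close> that of the outer circle for the Cauchy integral, and
    \<open>f\<close> has no zero on the slice at distance strictly between 0 and \<open>R\<close>
    from \<open>a\<close>.\<close>
  define r where "r = R / 2"
  have r: "0 < r" "r < R" using R(1) by (auto simp: r_def)
  define R' where "R' = 3 * R / 4"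
  have R': "r < R'" "R' < R" using R(1) by (auto simp: r_def R'_def)
  have cb: "cball a R' \<subseteq> ball a R0"
  proof
    fix w assume "w \<in> cball a R'"
    then show "w \<in> ball a R0" using R(2)[of w] R0(1) R' by (cases "w = a") (auto simp: dist_commute)
  qed
  have opn: "open {q \<in> V. f q \<noteq> 0}"
    using continuous_open_preimage[OF holomorphic2_on_imp_continuous_on[OF F(2)[OF f(1)]] V(1), of "- {0}"]
    by (simp add: open_Compl vimage_def Int_def)
  \<comment> \<open>Applied twice: to the circle, to keep zeros from crossing it, and to the part of
    the closed disc outside \<open>W\<close>, to keep zeros inside \<open>W\<close>.\<close>
  have ev: "\<forall>\<^sub>F z in nhds b. K \<times> {z} \<subseteq> {q \<in> V. f q \<noteq> 0}" if "compact K" "K \<subseteq> cball a r - {a}" for K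
  proof (rule eventually_compact_slice[OF that(1) opn])
    show "K \<times> {b} \<subseteq> {q \<in> V. f q \<noteq> 0}"
    proof clarify
      fix w assume "w \<in> K"
      then have "w \<noteq> a" "dist w a < R" using that(2) r by (auto simp: dist_commute)
      from R(2)[OF this] show "(w, b) \<in> V \<and> f (w, b) \<noteq> 0"
        using R0 by auto
    qed
  qed
  have "\<forall>\<^sub>F z in nhds b. sphere a r \<times> {z} \<subseteq> {q \<in> V. f q \<noteq> 0}"
    using r by (intro ev) auto
  then obtain \<rho>1 where \<rho>1: "\<rho>1 > 0" "\<And>z. dist z b < \<rho>1 \<Longrightarrow> sphere a r \<times> {z} \<subseteq> {q \<in> V. f q \<noteq> 0}"
    unfolding eventually_nhds_metric by blast
  define \<rho> where "\<rho> = min \<rho>0 \<rho>1"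
  have \<rho>: "\<rho> > 0" "ball b \<rho> \<subseteq> ball b \<rho>0" using R0 \<rho>1 by (auto simp: \<rho>_def)
  have sub: "cball a R' \<times> ball b \<rho> \<subseteq> V" using cb \<rho> R0(3) by blast
  have nz: "\<forall>w\<in>sphere a r. \<forall>z\<in>ball b \<rho>. f (w, z) \<noteq> 0"
    using \<rho>1(2) by (auto simp: \<rho>_def dist_commute subset_iff)
  \<comment> \<open>The test function is the constant 1, whence the conjunct
    \<open>1 \<noteq> 0\<close>. All equations in \<open>F\<close> are imposed on top of
    \<open>f\<close>, so the points of \<open>A\<close> themselves are counted.\<close>
  obtain n where n: "\<forall>\<^sub>F z in at b. card {w \<in> ball a r. f (w, z) = 0 \<and> (1::complex) \<noteq> 0 \<and> (\<forall>h\<in>F. h (w, z) = 0)} = n"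
    using eventually_const_zero_count[OF F(2)[OF f(1)] sub r(1) R'(1) \<rho>(1) nz F(1) F(2)
        holomorphic2_on_const[of 1]] by blast
  have ball: "\<forall>\<^sub>F z in at b. z \<in> ball b \<rho>"
    using eventually_at_ball[OF \<rho>(1), of b UNIV] by simp
  have "\<forall>\<^sub>F z in at b. finite {w \<in> W. (w, z) \<in> A} \<and> card {w \<in> W. (w, z) \<in> A} = n"
    if W: "open W" "a \<in> W" "W \<subseteq> ball a r" for W
  proof -
    have "\<forall>\<^sub>F z in nhds b. (cball a r - W) \<times> {z} \<subseteq> {q \<in> V. f q \<noteq> 0}"
      using W by (intro ev compact_diff) auto
    then have "\<forall>\<^sub>F z in at b. (cball a r - W) \<times> {z} \<subseteq> {q \<in> V. f q \<noteq> 0}"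
      by (simp add: eventually_at_filter eventually_mono)
    with n ball show ?thesis
    proof eventually_elim
      case (elim z)
      have eq: "{w \<in> W. (w, z) \<in> A} =
          {w \<in> ball a r. f (w, z) = 0 \<and> (1::complex) \<noteq> 0 \<and> (\<forall>h\<in>F. h (w, z) = 0)}" (is "?L = ?R")
      proof (intro equalityI subsetI)
        fix w assume w: "w \<in> ?L"
        then have "w \<in> cball a R'" using W(3) R' by auto
        then have "(w, z) \<in> V" using sub elim(2) by blast
        then have "\<forall>h\<in>F. h (w, z) = 0" using w memA[of "(w, z)"] by blast
        moreover have "w \<in> ball a r" using w W(3) by blast
        ultimately show "w \<in> ?R" using f(1) by simp
      next
        fix w assume w: "w \<in> ?R"
        then have "w \<in> cball a R'" using R' by auto
        then have "(w, z) \<in> V" using sub elim(2) by blast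
        then have "(w, z) \<in> A" using w memA[of "(w, z)"] by blast
        moreover have "w \<in> W"
        proof (rule ccontr)
          assume "w \<notin> W"
          then have "(w, z) \<in> (cball a r - W) \<times> {z}" using w by simp
          then have "f (w, z) \<noteq> 0" using elim(3) by blast
          then show False using w by simp
        qed
        ultimately show "w \<in> ?L" by blast
      qed
      have "finite {w \<in> ball a r. f (w, z) = 0}"
        using zero_moment_holomorphic(1)[OF F(2)[OF f(1)] holomorphic2_on_const sub r(1) R'(1) nz elim(2)] .
      then have "finite ?R" by (rule rev_finite_subset) auto
      then show ?case using elim(1) unfolding eq by simp
    qed
  qed
  then show ?thesis using r(1) by blast
qed


subsection \<open>Topology of the Riemann sphere\<close>

lemma vimage_inverse_open:
  fixes A :: "complex set"
  assumes "open A"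
  shows "open {z. z \<noteq> 0 \<and> inverse z \<in> A}"
proof -
  have "continuous_on (- {0 :: complex}) inverse"
    by (intro continuous_on_inverse continuous_on_id) auto
  from continuous_open_preimage[OF this _ assms] have "open (- {0} \<inter> inverse -` A)"
    by (simp add: open_Compl)
  then show ?thesis by (simp add: Int_def vimage_def)
qed

lemma inj_Affine: "inj Affine"
  by (simp add: inj_def)

lemma open_Affine_image: "open U \<Longrightarrow> open (Affine ` U)"
  by (simp add: open_riemann_sphere_def inj_vimage_image_eq[OF inj_Affine] image_iff)

lemma continuous_on_Affine: "continuous_on UNIV Affine"
  by (simp add: continuous_on_open_vimage open_riemann_sphere_def)

lemma inj_Affine_at_Infty: "inj Affine_at_Infty"
  by (auto simp: inj_def Affine_at_Infty_def)

lemma continuous_on_Affine_at_Infty: "continuous_on UNIV Affine_at_Infty"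
  unfolding continuous_on_open_vimage[OF open_UNIV]
proof (intro allI impI)
  fix U :: "riemann_sphere set" assume U: "open U"
  define A where "A = Affine -` U"
  have A: "open A" and cA: "Infty \<in> U \<Longrightarrow> compact (- A)"
    using U by (auto simp: A_def open_riemann_sphere_def)
  have eq: "Affine_at_Infty -` U \<inter> UNIV =
      {z. z \<noteq> 0 \<and> inverse z \<in> A} \<union> (if Infty \<in> U then {0} else {})"
    by (auto simp: A_def Affine_at_Infty_def split: if_splits)
  have op: "open {z. z \<noteq> 0 \<and> inverse z \<in> A}" by (rule vimage_inverse_open[OF A])
  show "open (Affine_at_Infty -` U \<inter> UNIV)"
  proof (cases "Infty \<in> U")
    case False
    then show ?thesis using op eq by simp
  next
    case True
    have "bounded (- A)" using compact_imp_bounded[OF cA[OF True]] .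
    then obtain B where B: "B > 0" "\<forall>z\<in>- A. norm z \<le> B"
      unfolding bounded_pos by blast
    have "inverse z \<in> A" if z: "z \<noteq> 0" "norm z < inverse B" for z
    proof (rule ccontr)
      assume "inverse z \<notin> A"
      then have "norm (inverse z) \<le> B" using B(2) by simp
      moreover have "B < norm (inverse z)"
        using less_imp_inverse_less[OF z(2)] z(1) B(1) by (simp add: norm_inverse)
      ultimately show False by simp
    qed
    then have "{z. z \<noteq> 0 \<and> inverse z \<in> A} \<union> {0} = {z. z \<noteq> 0 \<and> inverse z \<in> A} \<union> ball 0 (inverse B)"
      using B(1) by auto
    moreover have "open ({z. z \<noteq> 0 \<and> inverse z \<in> A} \<union> ball 0 (inverse B))"
      using op by (rule open_Un) simp
    ultimately show ?thesis unfolding eq using True by simp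
  qed
qed

lemma open_Affine_at_Infty_image:
  assumes "open U"
  shows "open (Affine_at_Infty ` U)"
proof -
  have eq: "Affine -` (Affine_at_Infty ` U) = {z. z \<noteq> 0 \<and> inverse z \<in> U}"
  proof (intro set_eqI iffI)
    fix z assume "z \<in> {z. z \<noteq> 0 \<and> inverse z \<in> U}"
    then have "Affine z = Affine_at_Infty (inverse z)" "inverse z \<in> U"
      by (auto simp: Affine_at_Infty_def)
    then show "z \<in> Affine -` (Affine_at_Infty ` U)" by auto
  qed (auto simp: Affine_at_Infty_def split: if_splits)
  have op: "open {z. z \<noteq> 0 \<and> inverse z \<in> U}" by (rule vimage_inverse_open[OF assms])
  have "compact (- {z. z \<noteq> 0 \<and> inverse z \<in> U})" if "Infty \<in> Affine_at_Infty ` U"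
  proof -
    have "0 \<in> U" using that by (auto simp: Affine_at_Infty_def split: if_splits)
    then obtain e where e: "e > 0" "ball 0 e \<subseteq> U" using assms open_contains_ball by blast
    have "norm z \<le> inverse e" if "z \<notin> {z. z \<noteq> 0 \<and> inverse z \<in> U}" for z
    proof (cases "z = 0")
      case False
      then have "e \<le> norm (inverse z)" using that e(2) by (force simp: dist_norm)
      then show ?thesis using e(1) False by (simp add: norm_inverse norm_divide field_simps)
    qed (use e in simp)
    then have "bounded (- {z. z \<noteq> 0 \<and> inverse z \<in> U})"
      by (auto intro: boundedI)
    then show ?thesis using op by (simp add: compact_eq_bounded_closed closed_def)
  qed
  then show ?thesis unfolding open_riemann_sphere_def eq using op by simp
qed

lemma sphere_chart_inj: "\<phi> \<in> sphere_charts \<Longrightarrow> inj \<phi>"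
  by (auto simp: sphere_charts_def inj_Affine inj_Affine_at_Infty)

lemma sphere_chart_continuous: "\<phi> \<in> sphere_charts \<Longrightarrow> continuous_on UNIV \<phi>"
  by (auto simp: sphere_charts_def continuous_on_Affine continuous_on_Affine_at_Infty)

lemma sphere_chart_open_image: "\<phi> \<in> sphere_charts \<Longrightarrow> open U \<Longrightarrow> open (\<phi> ` U)"
  by (auto simp: sphere_charts_def open_Affine_image open_Affine_at_Infty_image)

lemma sphere_chart_open_vimage: "\<phi> \<in> sphere_charts \<Longrightarrow> open U \<Longrightarrow> open (\<phi> -` U)"
  using sphere_chart_continuous by (simp add: continuous_on_open_vimage)

lemma sphere_chart_exists: "\<exists>\<phi>\<in>sphere_charts. \<exists>a. \<phi> a = z"
proof (cases z)
  case (Affine a)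
  then show ?thesis by (auto simp: sphere_charts_def)
next
  case Infty
  then have "Affine_at_Infty 0 = z" by (simp add: Affine_at_Infty_def)
  then show ?thesis by (auto simp: sphere_charts_def)
qed

instance riemann_sphere :: t2_space
proof
  have aux: "\<exists>U V. open U \<and> open V \<and> Affine a \<in> U \<and> Infty \<in> V \<and> U \<inter> V = {}" for a
  proof (intro exI conjI)
    show "open (Affine ` ball a 1)" by (rule open_Affine_image) simp
    have "Affine -` (- Affine ` cball a 1) = - cball a 1" by auto
    then show "open (- Affine ` cball a 1)" by (simp add: open_riemann_sphere_def open_Compl)
  qed auto
  fix x y :: riemann_sphere assume "x \<noteq> y"
  show "\<exists>U V. open U \<and> open V \<and> x \<in> U \<and> y \<in> V \<and> U \<inter> V = {}"
  proof (cases x; cases y)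
    fix a b assume xy: "x = Affine a" "y = Affine b"
    with \<open>x \<noteq> y\<close> obtain U V where "open U" "open V" "a \<in> U" "b \<in> V" "U \<inter> V = {}"
      using hausdorff[of a b] by auto
    then have "open (Affine ` U) \<and> open (Affine ` V) \<and> x \<in> Affine ` U \<and> y \<in> Affine ` V \<and>
        Affine ` U \<inter> Affine ` V = {}"
      using xy by (auto simp: open_Affine_image)
    then show ?thesis by (intro exI)
  next
    fix a assume "x = Affine a" "y = Infty"
    then show ?thesis using aux[of a] by simp
  next
    fix a assume xy: "x = Infty" "y = Affine a"
    obtain U V where "open U" "open V" "Affine a \<in> U" "Infty \<in> V" "U \<inter> V = {}"
      using aux[of a] by blast
    then have "open V \<and> open U \<and> x \<in> V \<and> y \<in> U \<and> V \<inter> U = {}" using xy by auto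
    then show ?thesis by (intro exI)
  qed (use \<open>x \<noteq> y\<close> in simp)
qed

text \<open>Punctured neighbourhoods are nonempty, so a count that holds eventually
  \<open>at z\<close> determines its value.\<close>

instance riemann_sphere :: perfect_space
proof
  fix x :: riemann_sphere
  show "\<not> open {x}"
  proof (cases x)
    case (Affine a)
    then have "Affine -` {x} = {a}" by auto
    then show ?thesis by (simp add: open_riemann_sphere_def not_open_singleton)
  next
    case Infty
    then have "Affine -` {x} = {}" by auto
    then show ?thesis using Infty by (simp add: open_riemann_sphere_def not_compact_UNIV)
  qed
qed

text \<open>The closed unit discs of the two charts cover the sphere.\<close>

lemma compact_riemann_sphere: "compact (UNIV :: riemann_sphere set)"
proof -
  have "x \<in> Affine ` cball 0 1 \<union> Affine_at_Infty ` cball 0 1" for x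
  proof (cases x)
    case (Affine a)
    show ?thesis
    proof (cases "norm a \<le> 1")
      case False
      then have "x = Affine_at_Infty (inverse a)" "inverse a \<in> cball 0 1"
        using Affine by (auto simp: Affine_at_Infty_def norm_inverse inverse_le_1_iff)
      then show ?thesis by blast
    qed (use Affine in auto)
  next
    case Infty
    then have "x = Affine_at_Infty 0" by (simp add: Affine_at_Infty_def)
    then show ?thesis by auto
  qed
  then have "UNIV = Affine ` cball 0 1 \<union> Affine_at_Infty ` cball 0 1" by blast
  moreover have "compact (Affine ` cball 0 1 \<union> Affine_at_Infty ` cball 0 1)"
    by (intro compact_Un compact_continuous_image compact_cball
        continuous_on_subset[OF continuous_on_Affine] continuous_on_subset[OF continuous_on_Affine_at_Infty]) auto
  ultimately show ?thesis by simp
qed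

lemma infinite_riemann_sphere: "infinite (UNIV :: riemann_sphere set)"
proof
  assume "finite (UNIV :: riemann_sphere set)"
  then have "finite (range Affine)" by (rule rev_finite_subset) simp
  then show False using finite_imageD[OF _ inj_Affine] infinite_UNIV_char_0 by blast
qed

text \<open>The plane minus a finite set is connected, which settles affine points; the value at
  \<open>Infty\<close> agrees with the value at some nearby affine point.\<close>

lemma locally_const_cofinite_riemann_sphere:
  fixes h :: "riemann_sphere \<Rightarrow> 'b"
  assumes "finite Z" and loc: "\<And>z. z \<notin> Z \<Longrightarrow> \<forall>\<^sub>F z' in at z. h z' = h z"
    and xy: "x \<notin> Z" "y \<notin> Z"
  shows "h x = h y"
proof -
  have open_Compl: "open (- Z)" using assms(1) by (simp add: finite_imp_closed open_Compl)
  have affine: "h (Affine a) = h (Affine b)" if "Affine a \<notin> Z" "Affine b \<notin> Z" for a b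
  proof (rule connected_local_const[where f = "h \<circ> Affine", unfolded o_def])
    have fin: "finite (Affine -` Z)" using finite_vimageI[OF assms(1) inj_Affine] .
    then show "connected (- (Affine -` Z))"
      using connected_open_delete_finite[OF open_UNIV connected_UNIV, of "Affine -` Z"]
      by (simp add: Compl_eq_Diff_UNIV)
    show "\<forall>a\<in>- (Affine -` Z). \<forall>\<^sub>F b in at a within - (Affine -` Z). h (Affine a) = h (Affine b)"
    proof
      fix a assume a: "a \<in> - (Affine -` Z)"
      then have "\<forall>\<^sub>F z' in at (Affine a). h z' = h (Affine a)" by (intro loc) simp
      then obtain U where U: "open U" "Affine a \<in> U" "\<And>z'. z' \<in> U \<Longrightarrow> z' \<noteq> Affine a \<Longrightarrow> h z' = h (Affine a)"
        unfolding eventually_at_topological by blast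
      show "\<forall>\<^sub>F b in at a within - (Affine -` Z). h (Affine a) = h (Affine b)"
        unfolding eventually_at_topological
      proof (intro exI conjI ballI impI)
        show "open (Affine -` U)" using U(1) by (simp add: open_riemann_sphere_def)
      qed (use U(2,3) in auto)
    qed
  qed (use that in auto)
  have ex: "\<exists>a. Affine a \<notin> Z \<and> h (Affine a) = h x" if "x \<notin> Z" for x
  proof (cases x)
    case Infty
    have "\<forall>\<^sub>F z' in at x. z' \<in> - Z"
      using open_Compl that by (auto simp: eventually_at_topological)
    with loc[OF that] have "\<forall>\<^sub>F z' in at x. h z' = h x \<and> z' \<notin> Z \<and> z' \<noteq> x"
      by (auto simp: eventually_conj_iff eventually_at_filter)
    then obtain z' where "h z' = h x" "z' \<notin> Z" "z' \<noteq> x"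
      using eventually_happens' [OF at_neq_bot] by blast
    then show ?thesis using Infty by (cases z') auto
  qed (use that in auto)
  show ?thesis using ex[OF xy(1)] ex[OF xy(2)] affine by metis
qed


subsection \<open>Local degrees on curves\<close>

definition fib :: "('a \<times> 'b) set \<Rightarrow> 'b \<Rightarrow> 'a set" where
  "fib C z = {w. (w, z) \<in> C}"

lemma open_map_prod_image:
  fixes \<phi> :: "'a::topological_space \<Rightarrow> 'b::topological_space"
    and \<psi> :: "'c::topological_space \<Rightarrow> 'd::topological_space"
  assumes "\<And>U. open U \<Longrightarrow> open (\<phi> ` U)" "\<And>U. open U \<Longrightarrow> open (\<psi> ` U)" "open V"
  shows "open (map_prod \<phi> \<psi> ` V)"
proof (rule open_prod_intro)
  fix p assume "p \<in> map_prod \<phi> \<psi> ` V"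
  then obtain q where q: "p = map_prod \<phi> \<psi> q" "q \<in> V" by (rule imageE)
  obtain X Y where XY: "open X" "open Y" "q \<in> X \<times> Y" "X \<times> Y \<subseteq> V"
    by (rule open_prod_elim[OF assms(3) q(2)])
  have "open (\<phi> ` X) \<and> open (\<psi> ` Y) \<and> p \<in> \<phi> ` X \<times> \<psi> ` Y \<and> \<phi> ` X \<times> \<psi> ` Y \<subseteq> map_prod \<phi> \<psi> ` V"
  proof (intro conjI)
    show "p \<in> \<phi> ` X \<times> \<psi> ` Y" using XY(3) q(1) by (cases q) auto
    show "\<phi> ` X \<times> \<psi> ` Y \<subseteq> map_prod \<phi> \<psi> ` V"
      using image_mono[OF XY(4), of "map_prod \<phi> \<psi>"] by (simp add: map_prod_surj_on)
  qed (use assms(1)[OF XY(1)] assms(2)[OF XY(2)] in auto)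
  then show "\<exists>A B. open A \<and> open B \<and> p \<in> A \<times> B \<and> A \<times> B \<subseteq> map_prod \<phi> \<psi> ` V" by (intro exI)
qed

text \<open>At a point off \<open>C\<close> some local equation is nonzero, and by continuity it
  stays nonzero nearby; charts are open maps.\<close>

lemma analytic_subvariety_closed:
  assumes "analytic_subvariety C"
  shows "closed C"
proof -
  have "\<exists>T. open T \<and> p \<in> T \<and> T \<subseteq> - C" if "p \<in> - C" for p
  proof -
    obtain \<phi> a where \<phi>: "\<phi> \<in> sphere_charts" "\<phi> a = fst p" using sphere_chart_exists[of "fst p"] by blast
    obtain \<psi> b where \<psi>: "\<psi> \<in> sphere_charts" "\<psi> b = snd p" using sphere_chart_exists[of "snd p"] by blast
    define A where "A = chart_preimage \<phi> \<psi> C"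
    have "analytic_subset_C2 A" using assms \<phi> \<psi> by (simp add: A_def analytic_subvariety_def)
    then obtain U F where U: "open U" "(a, b) \<in> U" "\<forall>f\<in>F. holomorphic2_on f U"
      "A \<inter> U = {q \<in> U. \<forall>f\<in>F. f q = 0}"
      unfolding analytic_subset_C2_def by meson
    have p: "p = map_prod \<phi> \<psi> (a, b)" using \<phi> \<psi> by simp
    have "(a, b) \<notin> A" using that p by (simp add: A_def chart_preimage_def)
    then obtain f where f: "f \<in> F" "f (a, b) \<noteq> 0" using U by blast
    define V where "V = {q \<in> U. f q \<noteq> 0}"
    have "open V"
      using continuous_open_preimage[OF holomorphic2_on_imp_continuous_on U(1), of f "- {0}"] U(3) f(1)
      by (simp add: open_Compl vimage_def Int_def V_def)
    then have "open (map_prod \<phi> \<psi> ` V)"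
      using \<phi> \<psi> by (intro open_map_prod_image sphere_chart_open_image)
    moreover have "(a, b) \<in> V" using U(2) f(2) by (simp add: V_def)
    then have "p \<in> map_prod \<phi> \<psi> ` V" using p by blast
    moreover have "V \<inter> A = {}" using U(4) f(1) by (auto simp: V_def)
    then have "map_prod \<phi> \<psi> ` V \<subseteq> - C" by (auto simp: A_def chart_preimage_def)
    ultimately show ?thesis by (intro exI conjI)
  qed
  then have "open (- C)" by (subst open_subopen) blast
  then show ?thesis by (simp add: closed_def)
qed

text \<open>Unlike irreducibility, these properties are visibly symmetric in the two factors, so that images
  can be treated like pre-images.\<close>

definition curve :: "(riemann_sphere \<times> riemann_sphere) set \<Rightarrow> bool" where
  "curve C \<longleftrightarrow> analytic_subvariety C \<and> (\<forall>p\<in>C. \<forall>T. open T \<longrightarrow> C \<inter> T \<noteq> {p}) \<and>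
     (\<forall>z. fib C z \<noteq> {}) \<and> (\<forall>w. fib (C\<inverse>) w \<noteq> {}) \<and>
     (\<forall>\<^sub>F z in cofinite. finite (fib C z)) \<and> (\<forall>\<^sub>F w in cofinite. finite (fib (C\<inverse>) w))"

section \<open>Exchanging the two factors\<close>

lemma has_derivative_swap: "(prod.swap has_derivative prod.swap) F"
proof -
  have "bounded_linear (\<lambda>p. (snd p, fst p))"
    by (intro bounded_linear_Pair bounded_linear_snd bounded_linear_fst)
  then show ?thesis
    by (intro bounded_linear_imp_has_derivative) (simp add: prod.swap_def[abs_def])
qed

lemma holomorphic2_on_swap:
  assumes "holomorphic2_on f U"
  shows "holomorphic2_on (f \<circ> prod.swap) (prod.swap -` U)"
  unfolding holomorphic2_on_def
proof
  fix p :: "complex \<times> complex" assume "p \<in> prod.swap -` U"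
  then obtain a b where f: "(f has_derivative (\<lambda>(h, k). a * h + b * k)) (at (prod.swap p))"
    using assms unfolding holomorphic2_on_def by fastforce
  have "(f \<circ> prod.swap has_derivative (\<lambda>(h, k). b * h + a * k)) (at p)"
    unfolding o_def
    by (rule has_derivative_eq_rhs[OF has_derivative_compose[OF has_derivative_swap f]])
      (auto simp: fun_eq_iff)
  then show "\<exists>a b. (f \<circ> prod.swap has_derivative (\<lambda>(h, k). a * h + b * k)) (at p)" by blast
qed

lemma analytic_subset_C2_swap:
  assumes "analytic_subset_C2 A"
  shows "analytic_subset_C2 (prod.swap -` A)"
  unfolding analytic_subset_C2_def
proof
  fix p
  obtain U F where U: "open U" "prod.swap p \<in> U" "finite F" "\<forall>f\<in>F. holomorphic2_on f U"
      "A \<inter> U = {q \<in> U. \<forall>f\<in>F. f q = 0}"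
    using assms unfolding analytic_subset_C2_def by meson
  show "\<exists>U F. open U \<and> p \<in> U \<and> finite F \<and> (\<forall>f\<in>F. holomorphic2_on f U) \<and>
      prod.swap -` A \<inter> U = {q \<in> U. \<forall>f\<in>F. f q = 0}"
  proof (intro exI conjI)
    show "open (prod.swap -` U)" by (rule open_vimage[OF U(1) continuous_on_swap])
    show "\<forall>f\<in>(\<lambda>f. f \<circ> prod.swap) ` F. holomorphic2_on f (prod.swap -` U)"
      using U(4) holomorphic2_on_swap by blast
    show "prod.swap -` A \<inter> prod.swap -` U =
        {q \<in> prod.swap -` U. \<forall>f\<in>(\<lambda>f. f \<circ> prod.swap) ` F. f q = 0}"
      using U(5) by (auto simp: set_eq_iff)
  qed (use U(2,3) in auto)
qed

lemma analytic_subvariety_converse: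
  assumes "analytic_subvariety C"
  shows "analytic_subvariety (C\<inverse>)"
proof -
  have "chart_preimage \<phi> \<psi> (C\<inverse>) = prod.swap -` chart_preimage \<psi> \<phi> C" for \<phi> \<psi>
    by (auto simp: chart_preimage_def)
  then show ?thesis
    using assms by (auto simp: analytic_subvariety_def intro: analytic_subset_C2_swap)
qed

lemma curve_converse:
  assumes "curve C"
  shows "curve (C\<inverse>)"
proof -
  have "C\<inverse> \<inter> T \<noteq> {p}" if "p \<in> C\<inverse>" "open T" for p T
  proof
    assume eq: "C\<inverse> \<inter> T = {p}"
    have "open (prod.swap -` T)" by (rule open_vimage[OF that(2) continuous_on_swap])
    moreover have "prod.swap p \<in> C" using that(1) by (cases p) auto
    ultimately have "C \<inter> prod.swap -` T \<noteq> {prod.swap p}" using assms unfolding curve_def by blast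
    moreover have "C \<inter> prod.swap -` T = prod.swap ` (C\<inverse> \<inter> T)" by force
    ultimately show False using eq by simp
  qed
  moreover have "analytic_subvariety (C\<inverse>)"
    using assms by (auto simp: curve_def intro: analytic_subvariety_converse)
  ultimately show ?thesis
    using assms unfolding curve_def converse_converse by (intro conjI ballI allI impI) simp_all
qed

lemma eventually_at_open_map:
  assumes "\<forall>\<^sub>F z in at b. P (\<psi> z)" "\<And>U. open U \<Longrightarrow> open (\<psi> ` U)"
  shows "\<forall>\<^sub>F z in at (\<psi> b). P z"
proof -
  obtain S where S: "open S" "b \<in> S" "\<forall>z\<in>S. z \<noteq> b \<longrightarrow> P (\<psi> z)"
    using assms(1) unfolding eventually_at_topological by blast
  then have "open (\<psi> ` S)" "\<psi> b \<in> \<psi> ` S" "\<forall>z\<in>\<psi> ` S. z \<noteq> \<psi> b \<longrightarrow> P z"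
    using assms(2) by auto
  then show ?thesis unfolding eventually_at_topological by blast
qed

lemma eventually_at_notin_finite:
  fixes x :: "'a::t1_space"
  assumes "finite S"
  shows "\<forall>\<^sub>F y in at x. y \<notin> S"
proof -
  have "open (- (S - {x}))" using assms by (intro open_Compl finite_imp_closed) simp
  then show ?thesis unfolding eventually_at_topological by (intro exI[of _ "- (S - {x})"]) auto
qed

text \<open>Off \<open>C\<close> the count is 0 because \<open>C\<close> is closed. On
  \<open>C\<close> the slice count is carried over by charts; finiteness of the fibre makes
  \<open>w\<close> isolated in its slice, and the absence of isolated points of \<open>C\<close>
  makes the count positive.\<close>

lemma curve_local_count:
  assumes "curve C" and fin: "finite (fib C z)"
  shows "\<exists>k U\<^sub>0. open U\<^sub>0 \<and> w \<in> U\<^sub>0 \<and> (0 < k \<longleftrightarrow> (w, z) \<in> C) \<and>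
    (\<forall>U. open U \<and> w \<in> U \<and> U \<subseteq> U\<^sub>0 \<longrightarrow>
      (\<forall>\<^sub>F z' in at z. finite {w'\<in>U. (w', z') \<in> C} \<and> card {w'\<in>U. (w', z') \<in> C} = k))"
proof (cases "(w, z) \<in> C")
  case False
  have "open (- C)" using assms(1) analytic_subvariety_closed by (auto simp: curve_def open_Compl)
  from open_prod_elim[OF this, of "(w, z)"] False
  obtain X Y where XY: "open X" "open Y" "(w, z) \<in> X \<times> Y" "X \<times> Y \<subseteq> - C" by blast
  have "\<forall>\<^sub>F z' in at z. finite {w'\<in>U. (w', z') \<in> C} \<and> card {w'\<in>U. (w', z') \<in> C} = 0"
    if "U \<subseteq> X" for U
    unfolding eventually_at_topological
  proof (intro exI[of _ Y] conjI ballI impI)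
    fix z' assume "z' \<in> Y"
    then have "{w' \<in> U. (w', z') \<in> C} = {}" using XY(4) that by blast
    then show "finite {w'\<in>U. (w', z') \<in> C}" "card {w'\<in>U. (w', z') \<in> C} = 0"
      by (simp_all only: finite.emptyI card.empty)
  qed (use XY in auto)
  then show ?thesis using XY False by (intro exI[of _ 0] exI[of _ X]) auto
next
  case True
  obtain \<phi> a where \<phi>: "\<phi> \<in> sphere_charts" "\<phi> a = w" using sphere_chart_exists by blast
  obtain \<psi> b where \<psi>: "\<psi> \<in> sphere_charts" "\<psi> b = z" using sphere_chart_exists by blast
  note inj = sphere_chart_inj[OF \<phi>(1)]
  define A where "A = chart_preimage \<phi> \<psi> C"
  have memA: "(u, v) \<in> A \<longleftrightarrow> (\<phi> u, \<psi> v) \<in> C" for u v by (simp add: A_def chart_preimage_def)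
  have A: "analytic_subset_C2 A"
    using assms(1) \<phi>(1) \<psi>(1) by (simp add: curve_def A_def analytic_subvariety_def)
  have "finite (\<phi> -` fib C z)" by (rule finite_vimageI[OF fin inj])
  from eventually_at_notin_finite[OF this, of a]
  have "\<forall>\<^sub>F u in at a. (u, b) \<notin> A" by (simp add: memA fib_def \<psi>(2))
  from analytic_slice_count[OF A this] True
  obtain r n where r: "r > 0" and n: "\<And>W. open W \<Longrightarrow> a \<in> W \<Longrightarrow> W \<subseteq> ball a r \<Longrightarrow>
      \<forall>\<^sub>F v in at b. finite {u \<in> W. (u, v) \<in> A} \<and> card {u \<in> W. (u, v) \<in> A} = n"
    unfolding memA \<phi>(2) \<psi>(2) by meson
  define U\<^sub>0 where "U\<^sub>0 = \<phi> ` ball a r"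
  have U0: "open U\<^sub>0" "w \<in> U\<^sub>0"
    using sphere_chart_open_image[OF \<phi>(1)] \<phi>(2) r by (auto simp: U\<^sub>0_def)
  have count: "\<forall>\<^sub>F z' in at z. finite {w'\<in>U. (w', z') \<in> C} \<and> card {w'\<in>U. (w', z') \<in> C} = n"
    if U: "open U" "w \<in> U" "U \<subseteq> U\<^sub>0" for U
  proof -
    have W: "open (\<phi> -` U)" "a \<in> \<phi> -` U" "\<phi> -` U \<subseteq> ball a r"
      using sphere_chart_open_vimage[OF \<phi>(1) U(1)] U \<phi>(2) inj by (auto simp: U\<^sub>0_def inj_def)
    have eq: "{w'\<in>U. (w', \<psi> v) \<in> C} = \<phi> ` {u \<in> \<phi> -` U. (u, v) \<in> A}" for v
      using U(3) by (auto simp: memA U\<^sub>0_def)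
    have card: "card {w'\<in>U. (w', \<psi> v) \<in> C} = card {u \<in> \<phi> -` U. (u, v) \<in> A}" for v
      unfolding eq by (rule card_image) (use inj in \<open>auto simp: inj_on_def\<close>)
    have "\<forall>\<^sub>F v in at b. finite {w'\<in>U. (w', \<psi> v) \<in> C} \<and> card {w'\<in>U. (w', \<psi> v) \<in> C} = n"
      using n[OF W] unfolding card by (rule eventually_mono) (simp add: eq)
    from eventually_at_open_map[OF this sphere_chart_open_image[OF \<psi>(1)]]
    show ?thesis by (simp add: \<psi>(2))
  qed
  \<comment> \<open>With count zero no point of \<open>C\<close> near \<open>(w, z)\<close> lies
    over any \<open>z' \<noteq> z\<close>; deleting the other points of the finite fibre from
    \<open>U\<^sub>0\<close> would then isolate \<open>(w, z)\<close> in \<open>C\<close>.\<close>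
  have "n \<noteq> 0"
  proof
    assume "n = 0"
    with count[OF U0 order_refl] obtain Y where Y: "open Y" "z \<in> Y"
      "\<forall>z'\<in>Y. z' \<noteq> z \<longrightarrow> finite {w'\<in>U\<^sub>0. (w', z') \<in> C} \<and> card {w'\<in>U\<^sub>0. (w', z') \<in> C} = 0"
      unfolding eventually_at_topological by blast
    define U\<^sub>1 where "U\<^sub>1 = U\<^sub>0 - (fib C z - {w})"
    have "open U\<^sub>1" unfolding U\<^sub>1_def using U0(1) fin by (intro open_Diff finite_imp_closed) auto
    then have "open (U\<^sub>1 \<times> Y)" using Y(1) by (rule open_Times)
    moreover have "C \<inter> U\<^sub>1 \<times> Y = {(w, z)}"
    proof (intro equalityI subsetI)
      fix p assume p: "p \<in> C \<inter> U\<^sub>1 \<times> Y"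
      obtain w' z' where wz: "p = (w', z')" by fastforce
      have "z' = z"
      proof (rule ccontr)
        assume "z' \<noteq> z"
        then have "{w'\<in>U\<^sub>0. (w', z') \<in> C} = {}" using Y(3) p wz by auto
        then show False using p wz by (auto simp: U\<^sub>1_def)
      qed
      then show "p \<in> {(w, z)}" using p wz by (auto simp: U\<^sub>1_def fib_def)
    qed (use True Y(2) U0 in \<open>auto simp: U\<^sub>1_def\<close>)
    ultimately show False using assms(1) True unfolding curve_def by blast
  qed
  then show ?thesis using True U0 count by (intro exI[of _ n] exI[of _ U\<^sub>0]) auto
qed

text \<open>Uniqueness of the described number: two candidate neighbourhoods are intersected, and
  both counts hold eventually along the nontrivial filter \<open>at z\<close>.\<close>

lemma local_mult_eq:
  assumes "open U\<^sub>0" "w \<in> U\<^sub>0"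
    and count: "\<And>U. open U \<Longrightarrow> w \<in> U \<Longrightarrow> U \<subseteq> U\<^sub>0 \<Longrightarrow> \<forall>\<^sub>F z' in at z. card {w'\<in>U. (w', z') \<in> C} = k"
  shows "local_mult C w z = k"
  unfolding local_mult_def
proof (rule the_equality)
  show "\<exists>U\<^sub>0. open U\<^sub>0 \<and> w \<in> U\<^sub>0 \<and> (\<forall>U. open U \<and> w \<in> U \<and> U \<subseteq> U\<^sub>0 \<longrightarrow>
           (\<forall>\<^sub>F z' in at z. card {w'\<in>U. (w', z') \<in> C} = k))"
    using assms by blast
next
  fix k' assume "\<exists>U\<^sub>0. open U\<^sub>0 \<and> w \<in> U\<^sub>0 \<and> (\<forall>U. open U \<and> w \<in> U \<and> U \<subseteq> U\<^sub>0 \<longrightarrow>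
           (\<forall>\<^sub>F z' in at z. card {w'\<in>U. (w', z') \<in> C} = k'))"
  then obtain V where V: "open V" "w \<in> V" "\<And>U. open U \<and> w \<in> U \<and> U \<subseteq> V \<longrightarrow>
           (\<forall>\<^sub>F z' in at z. card {w'\<in>U. (w', z') \<in> C} = k')" by blast
  have "\<forall>\<^sub>F z' in at z. card {w'\<in>U\<^sub>0 \<inter> V. (w', z') \<in> C} = k"
    using assms V(1,2) by (intro count) auto
  moreover have "\<forall>\<^sub>F z' in at z. card {w'\<in>U\<^sub>0 \<inter> V. (w', z') \<in> C} = k'"
    using assms(1,2) V(1,2) by (intro V(3)[rule_format]) auto
  ultimately have "\<forall>\<^sub>F z' in at z. k' = k" by eventually_elim simp
  then show "k' = k" by simp
qed

text \<open>Finiteness is recorded separately because \<open>card\<close> is 0 on infinite sets,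
  while the splitting of fibres needs genuine cardinalities.\<close>

definition good_nhd ::
  "(riemann_sphere \<times> riemann_sphere) set \<Rightarrow> riemann_sphere \<Rightarrow> riemann_sphere \<Rightarrow> riemann_sphere set \<Rightarrow> bool"
  where
  "good_nhd C z w U \<longleftrightarrow> (\<forall>\<^sub>F z' in at z.
      finite {w'\<in>U. (w', z') \<in> C} \<and> card {w'\<in>U. (w', z') \<in> C} = local_mult C w z)"

lemma curve_local_mult:
  assumes "curve C" "finite (fib C z)"
  shows "(0 < local_mult C w z \<longleftrightarrow> (w, z) \<in> C) \<and> (\<exists>U\<^sub>0. open U\<^sub>0 \<and> w \<in> U\<^sub>0 \<and>
    (\<forall>U. open U \<and> w \<in> U \<and> U \<subseteq> U\<^sub>0 \<longrightarrow> good_nhd C z w U))"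
proof -
  from curve_local_count[OF assms, of w]
  obtain k U\<^sub>0 where k: "open U\<^sub>0" "w \<in> U\<^sub>0" "0 < k \<longleftrightarrow> (w, z) \<in> C"
    "\<forall>U. open U \<and> w \<in> U \<and> U \<subseteq> U\<^sub>0 \<longrightarrow> (\<forall>\<^sub>F z' in at z.
      finite {w'\<in>U. (w', z') \<in> C} \<and> card {w'\<in>U. (w', z') \<in> C} = k)"
    by (elim exE conjE)
  have "local_mult C w z = k"
    by (rule local_mult_eq[OF k(1,2)]) (use k(4) in \<open>simp add: eventually_conj_iff\<close>)
  with k show ?thesis unfolding good_nhd_def by (intro conjI exI[of _ U\<^sub>0]) simp_all
qed

lemma local_mult_pos_iff:
  assumes "curve C" "finite (fib C z)"
  shows "0 < local_mult C w z \<longleftrightarrow> (w, z) \<in> C"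
  using curve_local_mult[OF assms, of w] by (rule conjunct1)

text \<open>Upper semicontinuity of fibres: the complement of \<open>W\<close> is compact, and the
  tube lemma keeps it away from the closed set \<open>C\<close> for all nearby
  \<open>z'\<close>.\<close>

lemma eventually_fib_subset:
  assumes "curve C" "open W" "fib C z \<subseteq> W"
  shows "\<forall>\<^sub>F z' in at z. fib C z' \<subseteq> W"
proof -
  have opn: "open (- C)" using assms(1) analytic_subvariety_closed by (auto simp: curve_def open_Compl)
  have comp: "compact (- W)"
    using compact_Int_closed[OF compact_riemann_sphere, of "- W"] assms(2) by (simp add: closed_Compl)
  have "(- W) \<times> {z} \<subseteq> - C" using assms(3) by (auto simp: fib_def)
  from eventually_compact_slice[OF comp opn this]
  have "\<forall>\<^sub>F z' in nhds z. fib C z' \<subseteq> W"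
    by (rule eventually_mono) (auto simp: fib_def)
  then show ?thesis unfolding eventually_at_filter by (rule eventually_mono) simp
qed

lemma disjoint_open_neighbourhoods:
  fixes S :: "'a::t2_space set"
  assumes "finite S"
  shows "\<exists>D. (\<forall>x\<in>S. open (D x) \<and> x \<in> D x) \<and> (\<forall>x\<in>S. \<forall>y\<in>S. x \<noteq> y \<longrightarrow> D x \<inter> D y = {})"
proof -
  have "\<forall>(x::'a) (y::'a). \<exists>U V. x \<noteq> y \<longrightarrow> open U \<and> open V \<and> x \<in> U \<and> y \<in> V \<and> U \<inter> V = {}"
    using hausdorff by meson
  then obtain P Q where PQ: "\<And>(x::'a) (y::'a). x \<noteq> y \<Longrightarrow>
      open (P x y) \<and> open (Q x y) \<and> x \<in> P x y \<and> y \<in> Q x y \<and> P x y \<inter> Q x y = {}"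
    by metis
  \<comment> \<open>The chosen separation need not be symmetric in the pair, so for every pair both
    choices are intersected.\<close>
  define D where "D x = (\<Inter>y\<in>S - {x}. P x y \<inter> Q y x)" for x
  show ?thesis
  proof (intro exI[of _ D] conjI[OF ballI] ballI impI)
    fix x assume "x \<in> S"
    have "open (P x y \<inter> Q y x) \<and> x \<in> P x y \<inter> Q y x" if "y \<in> S - {x}" for y
      using PQ[of x y] PQ[of y x] that by auto
    then show "open (D x) \<and> x \<in> D x"
      using assms by (auto simp: D_def intro!: open_INT)
  next
    fix x y assume xy: "x \<in> S" "y \<in> S" "x \<noteq> y"
    then have "D x \<subseteq> P x y" "D y \<subseteq> Q x y" by (auto simp: D_def)
    then show "D x \<inter> D y = {}" using PQ[OF xy(3)] by blast
  qed
qed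

text \<open>Nearby fibres break into disjoint clusters, one at each \<open>w\<close> and of size
  \<open>local_mult C w z\<close>; nothing escapes them by upper semicontinuity. The neighbourhoods
  \<open>N\<close> are left free so that they can be chosen as neighbourhoods on which a continuous
  function varies little.\<close>

lemma curve_fib_split:
  assumes "curve C" and fin: "finite (fib C z)"
    and N: "\<forall>w\<in>fib C z. open (N w) \<and> w \<in> N w"
  shows "\<exists>U. (\<forall>w\<in>fib C z. U w \<subseteq> N w) \<and>
    (\<forall>x\<in>fib C z. \<forall>y\<in>fib C z. x \<noteq> y \<longrightarrow> U x \<inter> U y = {}) \<and>
    (\<forall>\<^sub>F z' in at z. fib C z' = (\<Union>w\<in>fib C z. U w \<inter> fib C z') \<and>
      (\<forall>w\<in>fib C z. finite (U w \<inter> fib C z') \<and> card (U w \<inter> fib C z') = local_mult C w z))"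
proof -
  from disjoint_open_neighbourhoods[OF fin]
  obtain D where D: "\<forall>x\<in>fib C z. open (D x) \<and> x \<in> D x"
    "\<forall>x\<in>fib C z. \<forall>y\<in>fib C z. x \<noteq> y \<longrightarrow> D x \<inter> D y = {}"
    by (elim exE conjE)
  have "\<forall>w. \<exists>U\<^sub>0. open U\<^sub>0 \<and> w \<in> U\<^sub>0 \<and> (\<forall>U. open U \<and> w \<in> U \<and> U \<subseteq> U\<^sub>0 \<longrightarrow> good_nhd C z w U)"
    using curve_local_mult[OF assms(1,2)] by simp
  from choice[OF this] obtain M where
    M: "\<forall>w. open (M w) \<and> w \<in> M w \<and> (\<forall>U. open U \<and> w \<in> U \<and> U \<subseteq> M w \<longrightarrow> good_nhd C z w U)" by (rule exE)
  define U where "U w = N w \<inter> (D w \<inter> M w)" for w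
  have U: "open (U w) \<and> w \<in> U w" if "w \<in> fib C z" for w
    using N that D(1) M by (simp add: U_def open_Int)
  show ?thesis
  proof (intro exI[of _ U] conjI)
    have "\<forall>\<^sub>F z' in at z. fib C z' \<subseteq> (\<Union>w\<in>fib C z. U w)"
    proof (rule eventually_fib_subset[OF assms(1)])
      show "open (\<Union>w\<in>fib C z. U w)" by (rule open_UN) (use U in blast)
      show "fib C z \<subseteq> (\<Union>w\<in>fib C z. U w)" using U by blast
    qed
    moreover have "\<forall>\<^sub>F z' in at z. \<forall>w\<in>fib C z. finite {w'\<in>U w. (w', z') \<in> C} \<and>
        card {w'\<in>U w. (w', z') \<in> C} = local_mult C w z"
    proof (intro eventually_ball_finite[OF fin] ballI)
      fix w assume "w \<in> fib C z"
      then have "open (U w)" "w \<in> U w" using U by simp_all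
      moreover have "U w \<subseteq> M w" by (auto simp: U_def)
      ultimately have "good_nhd C z w (U w)" using M by simp
      then show "\<forall>\<^sub>F z' in at z. finite {w'\<in>U w. (w', z') \<in> C} \<and>
        card {w'\<in>U w. (w', z') \<in> C} = local_mult C w z" by (simp add: good_nhd_def)
    qed
    ultimately show "\<forall>\<^sub>F z' in at z. fib C z' = (\<Union>w\<in>fib C z. U w \<inter> fib C z') \<and>
      (\<forall>w\<in>fib C z. finite (U w \<inter> fib C z') \<and> card (U w \<inter> fib C z') = local_mult C w z)"
    proof eventually_elim
      case (elim z')
      have eq: "U w \<inter> fib C z' = {w'\<in>U w. (w', z') \<in> C}" for w by (auto simp: fib_def)
      have "fib C z' = (\<Union>w\<in>fib C z. U w \<inter> fib C z')" using elim(1) by blast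
      then show ?case using elim(2) unfolding eq by (rule conjI)
    qed
  qed (use D(2) in \<open>auto simp: U_def\<close>)
qed

text \<open>The contribution of one curve to the topological degree. Over an infinite fibre it is 0
  by the convention for sums, and so is \<open>wsum\<close>.\<close>

definition deg :: "(riemann_sphere \<times> riemann_sphere) set \<Rightarrow> riemann_sphere \<Rightarrow> nat" where
  "deg C z = (\<Sum>w\<in>fib C z. local_mult C w z)"

definition wsum ::
  "(riemann_sphere \<times> riemann_sphere) set \<Rightarrow> (riemann_sphere \<Rightarrow> real) \<Rightarrow> riemann_sphere \<Rightarrow> real" where
  "wsum C f z = (\<Sum>w\<in>fib C z. real (local_mult C w z) * f w)"

lemma eventually_card_fib:
  assumes "curve C" and fin: "finite (fib C z)"
  shows "\<forall>\<^sub>F z' in at z. finite (fib C z') \<and> card (fib C z') = deg C z"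
proof -
  have "\<forall>w\<in>fib C z. open (UNIV :: riemann_sphere set) \<and> w \<in> UNIV" by simp
  from curve_fib_split[OF assms this] obtain U where
    U: "\<forall>x\<in>fib C z. \<forall>y\<in>fib C z. x \<noteq> y \<longrightarrow> U x \<inter> U y = {}"
    "\<forall>\<^sub>F z' in at z. fib C z' = (\<Union>w\<in>fib C z. U w \<inter> fib C z') \<and>
      (\<forall>w\<in>fib C z. finite (U w \<inter> fib C z') \<and> card (U w \<inter> fib C z') = local_mult C w z)"
    by (elim exE conjE)
  from U(2) show ?thesis
  proof (rule eventually_mono)
    fix z' assume z': "fib C z' = (\<Union>w\<in>fib C z. U w \<inter> fib C z') \<and>
      (\<forall>w\<in>fib C z. finite (U w \<inter> fib C z') \<and> card (U w \<inter> fib C z') = local_mult C w z)"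
    have "finite (\<Union>w\<in>fib C z. U w \<inter> fib C z')" using z' fin by blast
    moreover have "card (\<Union>w\<in>fib C z. U w \<inter> fib C z') = (\<Sum>w\<in>fib C z. card (U w \<inter> fib C z'))"
      using z' fin U(1) by (intro card_UN_disjoint) blast+
    ultimately show "finite (fib C z') \<and> card (fib C z') = deg C z"
      using z' by (simp add: deg_def)
  qed
qed

lemma fib_sum_tendsto:
  assumes "curve C" and fin: "finite (fib C z)" and f: "continuous_on UNIV f"
  shows "((\<lambda>z'. \<Sum>w\<in>fib C z'. f w) \<longlongrightarrow> wsum C f z) (at z)"
proof (rule tendstoI)
  fix e :: real assume "e > 0"
  \<comment> \<open>At most \<open>deg C z\<close> points each contribute an error below
    \<open>d\<close>; the summand 1 covers degree zero and makes the final inequality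
    strict.\<close>
  define d where "d = e / (real (deg C z) + 1)"
  have "d > 0" using \<open>e > 0\<close> by (simp add: d_def)
  have "open {x. dist (f x) (f w) < d}" for w
    using f by (intro open_Collect_less continuous_intros)
  then have "\<forall>w\<in>fib C z. open {x. dist (f x) (f w) < d} \<and> w \<in> {x. dist (f x) (f w) < d}"
    using \<open>d > 0\<close> by simp
  from curve_fib_split[OF assms(1,2) this] obtain U where
    U: "\<forall>w\<in>fib C z. U w \<subseteq> {x. dist (f x) (f w) < d}"
    "\<forall>x\<in>fib C z. \<forall>y\<in>fib C z. x \<noteq> y \<longrightarrow> U x \<inter> U y = {}"
    "\<forall>\<^sub>F z' in at z. fib C z' = (\<Union>w\<in>fib C z. U w \<inter> fib C z') \<and>
      (\<forall>w\<in>fib C z. finite (U w \<inter> fib C z') \<and> card (U w \<inter> fib C z') = local_mult C w z)"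
    by (elim exE conjE)
  from U(3) show "\<forall>\<^sub>F z' in at z. dist (\<Sum>w\<in>fib C z'. f w) (wsum C f z) < e"
  proof (rule eventually_mono)
    fix z' assume z': "fib C z' = (\<Union>w\<in>fib C z. U w \<inter> fib C z') \<and>
      (\<forall>w\<in>fib C z. finite (U w \<inter> fib C z') \<and> card (U w \<inter> fib C z') = local_mult C w z)"
    have "(\<Sum>x\<in>(\<Union>w\<in>fib C z. U w \<inter> fib C z'). f x) = (\<Sum>w\<in>fib C z. \<Sum>x\<in>U w \<inter> fib C z'. f x)"
      using z' fin U(2) by (intro sum.UNION_disjoint) blast+
    then have "(\<Sum>x\<in>fib C z'. f x) = (\<Sum>w\<in>fib C z. \<Sum>x\<in>U w \<inter> fib C z'. f x)"
      using z' by simp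
    moreover have "wsum C f z = (\<Sum>w\<in>fib C z. \<Sum>x\<in>U w \<inter> fib C z'. f w)"
      using z' by (simp add: wsum_def)
    ultimately have "\<bar>(\<Sum>x\<in>fib C z'. f x) - wsum C f z\<bar> =
        \<bar>\<Sum>w\<in>fib C z. \<Sum>x\<in>U w \<inter> fib C z'. f x - f w\<bar>"
      by (simp add: sum_subtractf)
    also have "\<dots> \<le> (\<Sum>w\<in>fib C z. \<Sum>x\<in>U w \<inter> fib C z'. \<bar>f x - f w\<bar>)"
      by (intro order_trans[OF sum_abs] sum_mono sum_abs)
    also have "\<dots> \<le> (\<Sum>w\<in>fib C z. \<Sum>x\<in>U w \<inter> fib C z'. d)"
      using U(1) by (intro sum_mono) (force simp: dist_real_def)
    also have "\<dots> = real (deg C z) * d" using z' by (simp add: deg_def sum_distrib_right)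
    also have "\<dots> < e"
    proof -
      have "real (deg C z) * e < e * (real (deg C z) + 1)" using \<open>e > 0\<close> by (simp add: algebra_simps)
      then show ?thesis by (simp add: d_def field_simps)
    qed
    finally show "dist (\<Sum>w\<in>fib C z'. f w) (wsum C f z) < e" by (simp add: dist_real_def)
  qed
qed

text \<open>Near \<open>z\<close> a fibre has exactly \<open>deg C z\<close> distinct points. Once
  the degree is seen to be the same there, the positive multiplicities over \<open>z'\<close> add up
  to the number of points and hence are all 1.\<close>

lemma eventually_unramified:
  assumes "curve C" and fin: "finite (fib C z)"
  shows "\<forall>\<^sub>F z' in at z. finite (fib C z') \<and> deg C z' = deg C z \<and>
    (\<forall>w\<in>fib C z'. local_mult C w z' = 1)"
proof -
  obtain Y where Y: "open Y" "z \<in> Y"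
    "\<And>z'. z' \<in> Y \<Longrightarrow> z' \<noteq> z \<Longrightarrow> finite (fib C z') \<and> card (fib C z') = deg C z"
    using eventually_card_fib[OF assms] unfolding eventually_at_topological by blast
  have "finite (fib C z') \<and> deg C z' = deg C z \<and> (\<forall>w\<in>fib C z'. local_mult C w z' = 1)"
    if z': "z' \<in> Y" "z' \<noteq> z" for z'
  proof -
    have fin': "finite (fib C z')" and card': "card (fib C z') = deg C z" using Y(3)[OF z'] by auto
    \<comment> \<open>At a third point \<open>z''\<close> near \<open>z'\<close> the cardinality of
      the fibre is given both by the degree at \<open>z\<close> and by the degree at
      \<open>z'\<close>.\<close>
    have "\<forall>\<^sub>F z'' in at z'. z'' \<in> Y - {z}"
      using Y(1) z' by (intro eventually_at_in_open') (auto intro: open_delete)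
    then have "\<forall>\<^sub>F z'' in at z'. deg C z' = deg C z"
      using eventually_card_fib[OF assms(1) fin']
      by eventually_elim (use Y(3) in auto)
    then have deg: "deg C z' = deg C z" by simp
    have pos: "1 \<le> local_mult C w z'" if "w \<in> fib C z'" for w
      using local_mult_pos_iff[OF assms(1) fin', of w] that by (simp add: fib_def)
    have "(\<Sum>w\<in>fib C z'. local_mult C w z' - 1) = deg C z' - card (fib C z')"
      using pos by (subst sum_subtractf_nat) (auto simp: deg_def)
    then have "(\<Sum>w\<in>fib C z'. local_mult C w z' - 1) = 0" using deg card' by simp
    then have "\<forall>w\<in>fib C z'. local_mult C w z' - 1 = 0" using fin' by simp
    with pos fin' deg show ?thesis by (auto simp: le_antisym)
  qed
  then show ?thesis using Y(1,2) unfolding eventually_at_topological by blast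
qed

text \<open>All points \<open>z' \<noteq> z\<close> near \<open>z\<close> are unramified, so there the weighted sum is a plain sum over
  the fibre.\<close>

lemma isCont_wsum:
  assumes "curve C" "finite (fib C z)" "continuous_on UNIV f"
  shows "isCont (wsum C f) z"
proof -
  have "\<forall>\<^sub>F z' in at z. (\<Sum>w\<in>fib C z'. f w) = wsum C f z'"
    using eventually_unramified[OF assms(1,2)]
    by (rule eventually_mono) (simp add: wsum_def)
  with fib_sum_tendsto[OF assms] show ?thesis
    unfolding isCont_def by (rule Lim_transform_eventually)
qed

text \<open>The degree is locally constant off the finitely many points with infinite fibre, hence
  constant there; nonempty fibres with positive multiplicities make it positive.\<close>

lemma curve_deg_const:
  assumes "curve C"
  obtains D where "D > 0" "\<And>z. finite (fib C z) \<Longrightarrow> deg C z = D"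
proof -
  define Z where "Z = {z. infinite (fib C z)}"
  have "finite Z" using assms by (simp add: curve_def Z_def eventually_cofinite)
  have const: "deg C x = deg C y" if "x \<notin> Z" "y \<notin> Z" for x y
  proof (rule locally_const_cofinite_riemann_sphere[OF \<open>finite Z\<close> _ that])
    fix z assume "z \<notin> Z"
    then show "\<forall>\<^sub>F z' in at z. deg C z' = deg C z"
      using eventually_unramified[OF assms, of z] by (simp add: Z_def eventually_conj_iff)
  qed
  obtain z where z: "z \<notin> Z" by (rule exE[OF ex_new_if_finite[OF infinite_riemann_sphere \<open>finite Z\<close>]])
  have "fib C z \<noteq> {}" using assms by (simp add: curve_def)
  then obtain w where w: "w \<in> fib C z" by blast
  have "0 < local_mult C w z"
    using local_mult_pos_iff[OF assms, of z w] z w by (simp add: Z_def fib_def)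
  moreover have "finite (fib C z)" using z by (simp add: Z_def)
  ultimately have "deg C z > 0" using w unfolding deg_def by (intro sum_pos2[of _ w]) simp_all
  then show thesis
  proof (rule that)
    show "deg C x = deg C z" if "finite (fib C x)" for x
      using const[OF _ z, of x] that by (simp add: Z_def)
  qed
qed


subsection \<open>From correspondences to curves\<close>

lemma holomorphic2_on_diff_const:
  assumes "holomorphic2_on f U"
  shows "holomorphic2_on (\<lambda>p. f p - c) U"
  unfolding holomorphic2_on_def
proof
  fix p assume "p \<in> U"
  then obtain a b where f: "(f has_derivative (\<lambda>(h, k). a * h + b * k)) (at p)"
    using assms unfolding holomorphic2_on_def by meson
  have "((\<lambda>p. f p - c) has_derivative (\<lambda>(h, k). a * h + b * k)) (at p)"
    by (rule has_derivative_eq_rhs[OF has_derivative_diff[OF f has_derivative_const]]) auto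
  then show "\<exists>a b. ((\<lambda>p. f p - c) has_derivative (\<lambda>(h, k). a * h + b * k)) (at p)"
    by (intro exI)
qed

lemma sphere_chart_prod_inj:
  assumes "\<phi> \<in> sphere_charts" "\<psi> \<in> sphere_charts" "map_prod \<phi> \<psi> q = map_prod \<phi> \<psi> q'"
  shows "q = q'"
  using assms(3) injD[OF sphere_chart_inj[OF assms(1)]] injD[OF sphere_chart_inj[OF assms(2)]]
  by (cases q; cases q') auto

lemma sphere_chart_prod_vimage_open:
  assumes "\<phi> \<in> sphere_charts" "\<psi> \<in> sphere_charts" "open T"
  shows "open (map_prod \<phi> \<psi> -` T)"
proof -
  have "continuous_on UNIV (\<lambda>p. (\<phi> (fst p), \<psi> (snd p)))"
    by (intro continuous_on_Pair continuous_on_compose2[OF sphere_chart_continuous[OF assms(1)]]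
        continuous_on_compose2[OF sphere_chart_continuous[OF assms(2)]]
        continuous_on_fst continuous_on_snd continuous_on_id) auto
  then have "continuous_on UNIV (map_prod \<phi> \<psi>)"
    by (simp add: map_prod_def case_prod_unfold)
  then show ?thesis using assms(3) by (simp add: continuous_on_open_vimage)
qed

section \<open>Splitting off isolated points\<close>

lemma analytic_subvariety_singleton: "analytic_subvariety {p}"
  unfolding analytic_subvariety_def
proof (intro ballI)
  fix \<phi> \<psi> assume ch: "\<phi> \<in> sphere_charts" "\<psi> \<in> sphere_charts"
  show "analytic_subset_C2 (chart_preimage \<phi> \<psi> {p})"
    unfolding analytic_subset_C2_def
  proof
    fix q
    show "\<exists>U F. open U \<and> q \<in> U \<and> finite F \<and> (\<forall>f\<in>F. holomorphic2_on f U) \<and>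
        chart_preimage \<phi> \<psi> {p} \<inter> U = {q \<in> U. \<forall>f\<in>F. f q = 0}"
    proof (cases "map_prod \<phi> \<psi> q = p")
      case True
      have "chart_preimage \<phi> \<psi> {p} = {q}"
      proof (intro set_eqI iffI)
        fix x assume "x \<in> chart_preimage \<phi> \<psi> {p}"
        then have "map_prod \<phi> \<psi> x = map_prod \<phi> \<psi> q" using True by (simp add: chart_preimage_def)
        then show "x \<in> {q}" using sphere_chart_prod_inj[OF ch, of x q] by simp
      qed (use True in \<open>simp add: chart_preimage_def\<close>)
      moreover have "{q' \<in> UNIV. \<forall>f\<in>{\<lambda>x. fst x - fst q, \<lambda>x. snd x - snd q}. f q' = 0} = {q}"
        by (auto simp: prod_eq_iff)
      ultimately show ?thesis
        by (intro exI[of _ UNIV] exI[of _ "{\<lambda>x. fst x - fst q, \<lambda>x. snd x - snd q}"])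
          (auto intro!: holomorphic2_on_diff_const holomorphic2_on_fst holomorphic2_on_snd)
    next
      case False
      have op: "open (map_prod \<phi> \<psi> -` (- {p}))"
        by (rule sphere_chart_prod_vimage_open[OF ch]) (simp add: open_Compl)
      show ?thesis
        by (intro exI[of _ "map_prod \<phi> \<psi> -` (- {p})"] exI[of _ "{\<lambda>_. 1}"])
          (use op False in \<open>auto simp: chart_preimage_def holomorphic2_on_const\<close>)
    qed
  qed
qed

text \<open>Near \<open>p\<close> the remaining set is empty, so the constant function 1 is an
  equation for it; elsewhere the old equations survive on a neighbourhood that avoids
  \<open>p\<close>.\<close>

lemma analytic_subvariety_remove_isolated:
  assumes "analytic_subvariety C" "open T" "C \<inter> T = {p}"
  shows "analytic_subvariety (C - {p})"
  unfolding analytic_subvariety_def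
proof (intro ballI)
  fix \<phi> \<psi> assume ch: "\<phi> \<in> sphere_charts" "\<psi> \<in> sphere_charts"
  show "analytic_subset_C2 (chart_preimage \<phi> \<psi> (C - {p}))"
    unfolding analytic_subset_C2_def
  proof
    fix q
    show "\<exists>U F. open U \<and> q \<in> U \<and> finite F \<and> (\<forall>f\<in>F. holomorphic2_on f U) \<and>
        chart_preimage \<phi> \<psi> (C - {p}) \<inter> U = {q \<in> U. \<forall>f\<in>F. f q = 0}"
    proof (cases "map_prod \<phi> \<psi> q = p")
      case True
      have op: "open (map_prod \<phi> \<psi> -` T)"
        by (rule sphere_chart_prod_vimage_open[OF ch assms(2)])
      have "chart_preimage \<phi> \<psi> (C - {p}) \<inter> map_prod \<phi> \<psi> -` T = {}"
      proof (rule equals0I)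
        fix x assume x: "x \<in> chart_preimage \<phi> \<psi> (C - {p}) \<inter> map_prod \<phi> \<psi> -` T"
        then have "map_prod \<phi> \<psi> x \<in> C \<inter> T" by (simp add: chart_preimage_def)
        then have "map_prod \<phi> \<psi> x = p" using assms(3) by simp
        then show False using x by (simp add: chart_preimage_def)
      qed
      moreover have "q \<in> map_prod \<phi> \<psi> -` T" using True assms(3) by blast
      ultimately show ?thesis
        by (intro exI[of _ "map_prod \<phi> \<psi> -` T"] exI[of _ "{\<lambda>_. 1}"])
          (use op in \<open>simp add: holomorphic2_on_const\<close>)
    next
      case False
      have op: "open (map_prod \<phi> \<psi> -` (- {p}))"
        by (rule sphere_chart_prod_vimage_open[OF ch]) (simp add: open_Compl)
      have "analytic_subset_C2 (chart_preimage \<phi> \<psi> C)"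
        using assms(1) ch by (simp add: analytic_subvariety_def)
      then obtain U F where U: "open U" "q \<in> U" "finite F" "\<forall>f\<in>F. holomorphic2_on f U"
        "chart_preimage \<phi> \<psi> C \<inter> U = {q \<in> U. \<forall>f\<in>F. f q = 0}"
        unfolding analytic_subset_C2_def by meson
      define U' where "U' = U \<inter> map_prod \<phi> \<psi> -` (- {p})"
      have "open U'" "q \<in> U'" using U(1,2) op False by (auto simp: U'_def)
      moreover have "\<forall>f\<in>F. holomorphic2_on f U'"
        using U(4) holomorphic2_on_subset[of _ U U'] by (simp add: U'_def)
      moreover have "chart_preimage \<phi> \<psi> (C - {p}) \<inter> U' = (chart_preimage \<phi> \<psi> C \<inter> U) \<inter> U'"
        by (auto simp: chart_preimage_def U'_def)
      then have "chart_preimage \<phi> \<psi> (C - {p}) \<inter> U' = {q \<in> U'. \<forall>f\<in>F. f q = 0}"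
        unfolding U(5) by (auto simp: U'_def)
      ultimately show ?thesis using U(3) by (intro exI conjI)
    qed
  qed
qed

text \<open>An isolated point would split off as a subvariety of its own. Irreducibility then leaves
  only \<open>C = {p}\<close>, which cannot project onto an infinite sphere.\<close>

lemma irreducible_no_isolated_point:
  assumes "irreducible_subvariety C" "fst ` C = UNIV" "p \<in> C" "open T"
  shows "C \<inter> T \<noteq> {p}"
proof
  assume eq: "C \<inter> T = {p}"
  have an: "analytic_subvariety C" using assms(1) by (simp add: irreducible_subvariety_def)
  have "C = (C - {p}) \<union> {p}" using assms(3) by auto
  then have "C - {p} = C \<or> {p} = C"
    using assms(1)[unfolded irreducible_subvariety_def, THEN conjunct2, THEN conjunct2, rule_format,
        of "C - {p}" "{p}"]
      analytic_subvariety_remove_isolated[OF an assms(4) eq] analytic_subvariety_singleton[of p]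
    by (simp only: simp_thms)
  then have "{p} = C" using assms(3) by auto
  then have "(UNIV :: riemann_sphere set) = {fst p}" using assms(2) by auto
  then show False using infinite_riemann_sphere by (metis finite.emptyI finite_insert)
qed

lemma holomorphic_correspondence_curve:
  assumes "holomorphic_correspondence \<Gamma>" "C \<in># \<Gamma>"
  shows "curve C"
proof -
  have C: "irreducible_subvariety C" "fst ` C = UNIV" "snd ` C = UNIV"
    "\<forall>\<^sub>F z\<^sub>0 in cofinite. finite (fst ` (snd -` {z\<^sub>0} \<inter> C)) \<and> finite (snd ` (fst -` {z\<^sub>0} \<inter> C))"
    using assms by (auto simp: holomorphic_correspondence_def)
  have fib1: "fst ` (snd -` {z} \<inter> C) = fib C z" for z by (force simp: fib_def)
  have fib2: "snd ` (fst -` {z} \<inter> C) = fib (C\<inverse>) z" for z by (force simp: fib_def)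
  have "fib C z \<noteq> {}" for z
  proof -
    have "z \<in> snd ` C" using C(3) by simp
    then show ?thesis by (auto simp: fib_def)
  qed
  moreover have "fib (C\<inverse>) z \<noteq> {}" for z
  proof -
    have "z \<in> fst ` C" using C(2) by simp
    then show ?thesis by (auto simp: fib_def)
  qed
  moreover have "\<forall>p\<in>C. \<forall>T. open T \<longrightarrow> C \<inter> T \<noteq> {p}"
    using irreducible_no_isolated_point[OF C(1,2)] by simp
  ultimately show ?thesis
    using C(1,4) unfolding curve_def fib1 fib2 by (simp add: irreducible_subvariety_def eventually_conj_iff)
qed

lemma sum_sum_mset_swap:
  "(\<Sum>w\<in>A. \<Sum>C\<in>#M. g C w) = (\<Sum>C\<in>#M. \<Sum>w\<in>A. g C w)"
  by (induction M) (simp_all add: sum.distrib)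

lemma preimages_eq: "preimages \<Gamma> z = (\<Union>C\<in>set_mset \<Gamma>. fib C z)"
  by (auto simp: preimages_def support_def fib_def)

lemma finite_preimages_iff: "finite (preimages \<Gamma> z) \<longleftrightarrow> (\<forall>C\<in>#\<Gamma>. finite (fib C z))"
  by (simp add: preimages_eq)

lemma holomorphic_correspondence_finite_preimages:
  assumes "holomorphic_correspondence \<Gamma>"
  shows "\<forall>\<^sub>F z in cofinite. finite (preimages \<Gamma> z)"
  unfolding finite_preimages_iff
  using holomorphic_correspondence_curve[OF assms]
  by (intro eventually_ball_finite) (auto simp: curve_def)

text \<open>A pre-image along one component has local multiplicity 0 along every component that does
  not contain it, so extending each fibre to all pre-images changes nothing.\<close>

lemma preimage_sum_eq:
  assumes "holomorphic_correspondence \<Gamma>" "finite (preimages \<Gamma> z)"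
  shows "preimage_sum \<Gamma> f z = (\<Sum>C\<in>#\<Gamma>. wsum C f z)"
proof -
  have "preimage_sum \<Gamma> f z = (\<Sum>w\<in>preimages \<Gamma> z. \<Sum>C\<in>#\<Gamma>. real (local_mult C w z) * f w)"
    unfolding preimage_sum_def preimage_mult_def
    by (simp add: sum_mset_distrib_right of_nat_sum_mset image_mset.compositionality o_def)
  also have "\<dots> = (\<Sum>C\<in>#\<Gamma>. \<Sum>w\<in>preimages \<Gamma> z. real (local_mult C w z) * f w)"
    by (rule sum_sum_mset_swap)
  also have "\<dots> = (\<Sum>C\<in>#\<Gamma>. wsum C f z)"
  proof (intro arg_cong[of _ _ sum_mset] image_mset_cong)
    fix C assume C: "C \<in># \<Gamma>"
    have cv: "curve C" and fin: "finite (fib C z)"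
      using holomorphic_correspondence_curve[OF assms(1) C] assms(2) C by (auto simp: finite_preimages_iff)
    show "(\<Sum>w\<in>preimages \<Gamma> z. real (local_mult C w z) * f w) = wsum C f z"
      unfolding wsum_def
    proof (rule sum.mono_neutral_right[OF assms(2)])
      show "fib C z \<subseteq> preimages \<Gamma> z" using C by (auto simp: preimages_eq)
      show "\<forall>w\<in>preimages \<Gamma> z - fib C z. real (local_mult C w z) * f w = 0"
        using local_mult_pos_iff[OF cv fin] by (auto simp: fib_def)
    qed
  qed
  finally show ?thesis .
qed

text \<open>Each curve has the same degree at all its finite fibres, so the total multiplicity is
  right at every point with finitely many pre-images, and not merely at an unspecified generic one.
  This is what makes the weights sum to one.\<close>

lemma d_top_eq:
  assumes "holomorphic_correspondence \<Gamma>"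
  shows "d_top \<Gamma> > 0"
    and "finite (preimages \<Gamma> z) \<Longrightarrow> (\<Sum>w\<in>preimages \<Gamma> z. preimage_mult \<Gamma> w z) = d_top \<Gamma>"
proof -
  have "\<exists>D. D > 0 \<and> (\<forall>z. finite (fib C z) \<longrightarrow> deg C z = D)" if "C \<in># \<Gamma>" for C
    by (rule curve_deg_const[OF holomorphic_correspondence_curve[OF assms that]]) (intro exI conjI allI impI)
  then have "\<forall>C\<in>set_mset \<Gamma>. \<exists>D. D > 0 \<and> (\<forall>z. finite (fib C z) \<longrightarrow> deg C z = D)" by simp
  from bchoice[OF this] obtain D where
    D: "\<forall>C\<in>set_mset \<Gamma>. D C > (0::nat) \<and> (\<forall>z. finite (fib C z) \<longrightarrow> deg C z = D C)" by (rule exE)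
  define d where "d = (\<Sum>C\<in>#\<Gamma>. D C)"
  have sum: "(\<Sum>w\<in>preimages \<Gamma> z. preimage_mult \<Gamma> w z) = d" if fin: "finite (preimages \<Gamma> z)" for z
  proof -
    have "real (\<Sum>w\<in>preimages \<Gamma> z. preimage_mult \<Gamma> w z) = preimage_sum \<Gamma> (\<lambda>_. 1) z"
      by (simp add: preimage_sum_def)
    also have "\<dots> = (\<Sum>C\<in>#\<Gamma>. wsum C (\<lambda>_. 1) z)" by (rule preimage_sum_eq[OF assms fin])
    also have "\<dots> = (\<Sum>C\<in>#\<Gamma>. real (D C))"
    proof (intro arg_cong[of _ _ sum_mset] image_mset_cong)
      fix C assume "C \<in># \<Gamma>"
      then have "deg C z = D C" using D fin by (simp add: finite_preimages_iff)
      then show "wsum C (\<lambda>_. 1) z = real (D C)" by (simp add: wsum_def deg_def flip: of_nat_sum)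
    qed
    also have "\<dots> = real d"
      by (simp add: d_def of_nat_sum_mset image_mset.compositionality o_def)
    finally show ?thesis by (simp only: of_nat_eq_iff)
  qed
  have ev: "\<forall>\<^sub>F z in cofinite. (\<Sum>w\<in>preimages \<Gamma> z. preimage_mult \<Gamma> w z) = d"
    using holomorphic_correspondence_finite_preimages[OF assms]
    by (rule eventually_mono) (rule sum)
  have "d_top \<Gamma> = d"
    unfolding d_top_def
  proof (rule the_equality)
    fix d' assume "\<forall>\<^sub>F z in cofinite. (\<Sum>w\<in>preimages \<Gamma> z. preimage_mult \<Gamma> w z) = d'"
    with ev have "\<forall>\<^sub>F z::riemann_sphere in cofinite. d' = d" by eventually_elim simp
    \<comment> \<open>On an infinite sphere the cofinite filter is nontrivial, so two generic values
      coincide.\<close>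
    then show "d' = d" using infinite_riemann_sphere by (simp add: eventually_cofinite split: if_splits)
  qed (rule ev)
  then show "finite (preimages \<Gamma> z) \<Longrightarrow> (\<Sum>w\<in>preimages \<Gamma> z. preimage_mult \<Gamma> w z) = d_top \<Gamma>"
    using sum by simp
  obtain C where C: "C \<in># \<Gamma>"
    using assms by (auto simp: holomorphic_correspondence_def elim: multiset_nonemptyE)
  then have "0 < D C" "D C \<le> d"
    using D unfolding d_def by (auto dest!: multi_member_split)
  then show "d_top \<Gamma> > 0" using \<open>d_top \<Gamma> = d\<close> by simp
qed

lemma preimage_mult_pos:
  assumes "holomorphic_correspondence \<Gamma>" "finite (preimages \<Gamma> z)" "w \<in> preimages \<Gamma> z"
  shows "preimage_mult \<Gamma> w z > 0"
proof -
  obtain C where C: "C \<in># \<Gamma>" "w \<in> fib C z" using assms(3) by (auto simp: preimages_eq)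
  have "finite (fib C z)" using assms(2) C(1) by (simp add: finite_preimages_iff)
  then have "0 < local_mult C w z"
    using local_mult_pos_iff[OF holomorphic_correspondence_curve[OF assms(1) C(1)]] C(2)
    by (simp add: fib_def)
  moreover have "local_mult C w z \<le> preimage_mult \<Gamma> w z"
    using C(1) unfolding preimage_mult_def by (auto dest!: multi_member_split)
  ultimately show ?thesis by simp
qed


subsection \<open>Measurability\<close>

text \<open>An intersection-stable generator of the Borel sets. Compact sets of the plane are taken
  because the distance function approximates their indicators by continuous functions with compact
  support.\<close>

definition compact_images :: "riemann_sphere set set" where
  "compact_images = insert UNIV {Affine ` K | K. compact K}"

lemma Int_stable_compact_images: "Int_stable compact_images"
proof (rule Int_stableI)
  fix A B assume AB: "A \<in> compact_images" "B \<in> compact_images"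
  show "A \<inter> B \<in> compact_images"
  proof (cases "A = UNIV \<or> B = UNIV")
    case False
    with AB obtain K L where KL: "A = Affine ` K" "B = Affine ` L" "compact K" "compact L"
      by (auto simp: compact_images_def)
    then have "A \<inter> B = Affine ` (K \<inter> L)" by (simp add: image_Int[OF inj_Affine])
    moreover have "compact (K \<inter> L)" using KL by (simp add: compact_Int)
    ultimately show ?thesis unfolding compact_images_def by blast
  qed (use AB in auto)
qed

text \<open>Open sets of the plane are countable unions of compact ones, and \<open>{Infty}\<close>
  is the complement of the plane; an open set of the sphere is assembled from these two
  kinds.\<close>

lemma borel_eq_sigma_compact_images: "sets (borel :: riemann_sphere measure) = sigma_sets UNIV compact_images"
proof
  interpret sigma_algebra UNIV "sigma_sets UNIV compact_images"
    by (rule sigma_algebra_sigma_sets) simp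
  have cimg: "Affine ` K \<in> sigma_sets UNIV compact_images" if "compact K" for K
    using that by (intro sigma_sets.Basic) (auto simp: compact_images_def)
  have img: "Affine ` V \<in> sigma_sets UNIV compact_images" if "open V" for V
  proof -
    have "\<exists>K :: nat \<Rightarrow> complex set. (\<forall>n. compact (K n)) \<and> \<Union>(range K) = V"
      by (rule open_Union_compact_subsets[OF that]) (intro exI conjI allI)
    then obtain K :: "nat \<Rightarrow> complex set" where K: "\<forall>n. compact (K n)" "\<Union>(range K) = V"
      by (elim exE conjE)
    have "Affine ` V = (\<Union>n. Affine ` K n)" using K(2) by blast
    then show ?thesis using cimg K(1) by auto
  qed
  have "- range Affine = {Infty}"
  proof (intro set_eqI iffI)
    fix x assume "x \<in> - range Affine"
    then show "x \<in> {Infty}" by (cases x) auto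
  qed auto
  then have Infty: "{Infty} \<in> sigma_sets UNIV compact_images"
    using compl_sets[OF img[OF open_UNIV]] by (simp add: Compl_eq_Diff_UNIV)
  have "S \<in> sigma_sets UNIV compact_images" if "open S" for S
  proof -
    have eq: "S = Affine ` (Affine -` S) \<union> (if Infty \<in> S then {Infty} else {})"
    proof (intro set_eqI)
      fix x show "x \<in> S \<longleftrightarrow> x \<in> Affine ` (Affine -` S) \<union> (if Infty \<in> S then {Infty} else {})"
        by (cases x) auto
    qed
    have "Affine ` (Affine -` S) \<in> sigma_sets UNIV compact_images"
      using that by (intro img) (simp add: open_riemann_sphere_def)
    moreover have "(if Infty \<in> S then {Infty} else {}) \<in> sigma_sets UNIV compact_images"
      using Infty by (simp add: sigma_sets.Empty)
    ultimately show ?thesis by (subst eq) (rule Un)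
  qed
  then show "sets (borel :: riemann_sphere measure) \<subseteq> sigma_sets UNIV compact_images"
    unfolding borel_def by (auto intro!: sigma_sets_mono)
  have "compact_images \<subseteq> sets borel"
  proof
    fix A assume A: "A \<in> compact_images"
    have "closed A"
    proof (cases "A = UNIV")
      case False
      with A obtain K where "A = Affine ` K" "compact K" by (auto simp: compact_images_def)
      then show ?thesis
        by (intro compact_imp_closed) (auto intro: compact_continuous_image continuous_on_subset[OF continuous_on_Affine])
    qed simp
    then show "A \<in> sets borel" by simp
  qed
  then show "sigma_sets UNIV compact_images \<subseteq> sets (borel :: riemann_sphere measure)"
    using sets.sigma_sets_subset[of compact_images borel] by simp
qed

text \<open>Dynkin's induction, serving both the measurability of weighted sums and the extension of
  invariance from continuous functions to indicators.\<close>

lemma borel_riemann_sphere_induct [consumes 1, case_names compact UNIV compl union]: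
  assumes "A \<in> sets (borel :: riemann_sphere measure)"
    and "\<And>K. compact K \<Longrightarrow> P (Affine ` K)" and "P UNIV"
    and compl: "\<And>A. A \<in> sets borel \<Longrightarrow> P A \<Longrightarrow> P (- A)"
    and union: "\<And>A. disjoint_family A \<Longrightarrow> range A \<subseteq> sets borel \<Longrightarrow> (\<And>i. P (A i)) \<Longrightarrow> P (\<Union>i::nat. A i)"
  shows "P A"
proof (rule sigma_sets_induct_disjoint[OF Int_stable_compact_images, of UNIV])
  show "A \<in> sigma_sets UNIV compact_images" using assms(1) by (simp add: borel_eq_sigma_compact_images)
  show "P A" if "A \<in> compact_images" for A using that assms(2,3) by (auto simp: compact_images_def)
  show "P {}" using assms(2)[of "{}"] by simp
  show "P (UNIV - A)" if "A \<in> sigma_sets UNIV compact_images" "P A" for A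
    using compl[of A] that by (simp add: borel_eq_sigma_compact_images Compl_eq_Diff_UNIV)
  show "P (\<Union>i. A i)" if "disjoint_family A" "range A \<subseteq> sigma_sets UNIV compact_images" "\<And>i. P (A i)"
    for A :: "nat \<Rightarrow> _"
    using union[of A] that by (simp add: borel_eq_sigma_compact_images)
qed simp

lemma Affine_compact_indicator_limit:
  assumes "compact K"
  shows "\<exists>g :: nat \<Rightarrow> riemann_sphere \<Rightarrow> real. (\<forall>n. continuous_on UNIV (g n)) \<and>
    (\<forall>n x. 0 \<le> g n x \<and> g n x \<le> 1) \<and> (\<forall>x. (\<lambda>n. g n x) \<longlonglongrightarrow> indicator (Affine ` K) x)"
proof (cases "K = {}")
  \<comment> \<open>Treated apart because \<open>infdist\<close> to the empty set is 0, so the tents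
    below would be constantly 1.\<close>
  case True
  then show ?thesis by (intro exI[of _ "\<lambda>_ _. 0"]) simp
next
  case False
  \<comment> \<open>Tents over \<open>K\<close> of slope \<open>Suc n\<close>. Since the slope is at
    least 1, the support stays within distance 1 of \<open>K\<close>; hence it is bounded, and
    extension by 0 is continuous at \<open>Infty\<close>.\<close>
  define h where "h n z = max 0 (1 - real (Suc n) * infdist z K)" for n and z :: complex
  define g where "g n x = (case x of Affine z \<Rightarrow> h n z | Infty \<Rightarrow> 0)" for n x
  have conth: "continuous_on UNIV (h n)" for n
    unfolding h_def by (intro continuous_intros)
  have bdd: "bounded {z. h n z \<noteq> 0}" for n
  proof -
    obtain B where B: "\<forall>x\<in>K. norm x \<le> B" using compact_imp_bounded[OF assms] by (auto simp: bounded_iff)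
    have "norm z \<le> B + 1" if "h n z \<noteq> 0" for z
    proof -
      obtain x where x: "x \<in> K" "infdist z K = dist z x"
        using infdist_attains_inf[OF compact_imp_closed[OF assms] False] by blast
      have "real (Suc n) * infdist z K < 1" using that by (auto simp: h_def max_def split: if_splits)
      moreover have "infdist z K \<le> real (Suc n) * infdist z K"
        using infdist_nonneg[of z K] by (simp add: algebra_simps)
      ultimately have "dist z x < 1" using x by simp
      moreover have "norm z \<le> norm x + dist z x" using norm_triangle_ineq[of x "z - x"] by (simp add: dist_norm)
      ultimately show ?thesis using B x(1) by fastforce
    qed
    then show ?thesis by (auto intro: boundedI)
  qed
  have "continuous_on UNIV (g n)" for n
    unfolding continuous_on_open_vimage[OF open_UNIV]
  proof (intro allI impI)
    fix T :: "real set" assume T: "open T"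
    have eq: "Affine -` (g n -` T) = h n -` T" by (auto simp: g_def)
    have op: "open (h n -` T)" by (rule open_vimage[OF T conth])
    have "compact (- (h n -` T))" if "Infty \<in> g n -` T"
    proof -
      have "0 \<in> T" using that by (simp add: g_def)
      then have "- (h n -` T) \<subseteq> {z. h n z \<noteq> 0}" by auto
      then have "bounded (- (h n -` T))" by (rule bounded_subset[OF bdd])
      then show ?thesis using op by (simp add: compact_eq_bounded_closed closed_def)
    qed
    then show "open (g n -` T \<inter> UNIV)" using op by (simp add: open_riemann_sphere_def eq)
  qed
  moreover have "0 \<le> g n x \<and> g n x \<le> 1" for n x
    using infdist_nonneg[of _ K] by (cases x) (auto simp: g_def h_def)
  moreover have "(\<lambda>n. g n x) \<longlonglongrightarrow> indicator (Affine ` K) x" for x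
  proof (cases x)
    case Infty
    then show ?thesis by (auto simp: g_def indicator_def)
  next
    case (Affine z)
    show ?thesis
    proof (cases "z \<in> K")
      case True
      then show ?thesis using Affine by (simp add: g_def h_def)
    next
      case F: False
      have pos: "infdist z K > 0"
        using infdist_pos_not_in_closed[OF compact_imp_closed[OF assms] False F] .
      obtain N :: nat where N: "1 / infdist z K < real N" using reals_Archimedean2 by blast
      have "g n x = 0" if "n \<ge> N" for n
      proof -
        have "1 < real N * infdist z K" using N pos by (simp add: field_simps)
        also have "\<dots> \<le> real (Suc n) * infdist z K" using that pos by (intro mult_right_mono) auto
        finally show ?thesis using Affine by (simp add: g_def h_def)
      qed
      then have "\<forall>\<^sub>F n in sequentially. g n x = 0" by (auto simp: eventually_sequentially)
      then have "(\<lambda>n. g n x) \<longlonglongrightarrow> 0" by (rule tendsto_eventually)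
      then show ?thesis using Affine F by (simp add: indicator_def image_iff)
    qed
  qed
  ultimately show ?thesis by (intro exI[of _ g]) simp
qed

lemma finite_sets_borel:
  fixes Z :: "'a::t1_space set"
  shows "finite Z \<Longrightarrow> Z \<in> sets borel"
  by (intro borel_closed finite_imp_closed)

lemma wsum_measurable_continuous:
  assumes "curve C" and f: "continuous_on UNIV f"
  shows "wsum C f \<in> borel_measurable borel"
proof -
  define Z where "Z = {z. infinite (fib C z)}"
  have "finite Z" using assms by (simp add: curve_def Z_def eventually_cofinite)
  then show ?thesis
    using isCont_wsum[OF assms(1) _ f]
    by (intro borel_measurable_continuous_countable_exceptions[of Z] continuous_at_imp_continuous_on)
      (auto simp: Z_def countable_finite)
qed

text \<open>For fixed \<open>z\<close> the weighted sum is a finite linear combination of values of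
  \<open>f\<close>, or constantly 0 over an infinite fibre, so it commutes with pointwise limits and
  series.\<close>

lemma wsum_measurable_indicator:
  assumes "curve C" "A \<in> sets borel"
  shows "wsum C (indicator A) \<in> borel_measurable borel"
  using assms(2)
proof (induction rule: borel_riemann_sphere_induct)
  case (compact K)
  from Affine_compact_indicator_limit[OF compact]
  obtain g :: "nat \<Rightarrow> riemann_sphere \<Rightarrow> real" where g: "\<forall>n. continuous_on UNIV (g n)"
    "\<forall>n x. 0 \<le> g n x \<and> g n x \<le> 1" "\<forall>x. (\<lambda>n. g n x) \<longlonglongrightarrow> indicator (Affine ` K) x"
    by (elim exE conjE)
  show ?case
  proof (rule borel_measurable_LIMSEQ_real)
    show "wsum C (g n) \<in> borel_measurable borel" for n
      by (rule wsum_measurable_continuous[OF assms(1) g(1)[rule_format]])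
    show "(\<lambda>n. wsum C (g n) z) \<longlonglongrightarrow> wsum C (indicator (Affine ` K)) z" for z
      unfolding wsum_def by (intro tendsto_intros g(3)[rule_format])
  qed
next
  case UNIV
  show ?case
    using wsum_measurable_continuous[OF assms(1) continuous_on_const[of _ 1]] by (simp add: indicator_def)
next
  case (compl A)
  have "wsum C (indicator (- A)) = (\<lambda>z. wsum C (\<lambda>_. 1) z - wsum C (indicator A) z)"
    by (auto simp: fun_eq_iff wsum_def indicator_def sum_subtractf[symmetric] intro!: sum.cong)
  then show ?case
    using wsum_measurable_continuous[OF assms(1) continuous_on_const[of _ 1]] compl by simp
next
  case (union A)
  show ?case
  proof (rule borel_measurable_LIMSEQ_real)
    show "(\<lambda>z. \<Sum>i<n. wsum C (indicator (A i)) z) \<in> borel_measurable borel" for n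
      using union by (intro borel_measurable_sum) auto
    show "(\<lambda>n. \<Sum>i<n. wsum C (indicator (A i)) z) \<longlonglongrightarrow> wsum C (indicator (\<Union>i. A i)) z" for z
    proof -
      have "(\<lambda>i. indicator (A i) x :: real) sums indicator (\<Union>i. A i) x" for x
        using union(1) by (intro indicator_sums) (auto simp: disjoint_family_on_def)
      then have "(\<lambda>i. wsum C (indicator (A i)) z) sums wsum C (indicator (\<Union>i. A i)) z"
        unfolding wsum_def by (intro sums_sum sums_mult)
      then show ?thesis by (simp add: sums_def)
    qed
  qed
qed

lemma preimage_set_eq: "preimage_set \<Gamma> A = (\<Union>C\<in>set_mset \<Gamma>. {w. fib (C\<inverse>) w \<inter> A \<noteq> {}})"
  by (auto simp: preimage_set_def preimages_def support_def fib_def)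

text \<open>Positive multiplicities turn the condition of meeting \<open>A\<close> into positivity
  of the measurable function \<open>wsum C (indicator A)\<close>, except over the finitely many
  infinite fibres.\<close>

lemma curve_image_borel:
  assumes "curve C" "A \<in> sets borel"
  shows "{z. fib C z \<inter> A \<noteq> {}} \<in> sets borel"
proof -
  define Z where "Z = {z. infinite (fib C z)}"
  have "finite Z" using assms by (simp add: curve_def Z_def eventually_cofinite)
  define S where "S = {z. fib C z \<inter> A \<noteq> {}}"
  have "wsum C (indicator A) z > 0 \<longleftrightarrow> z \<in> S" if "z \<notin> Z" for z
  proof -
    have fin: "finite (fib C z)" using that by (simp add: Z_def)
    have pos: "w \<in> fib C z \<Longrightarrow> 0 < local_mult C w z" for w
      using local_mult_pos_iff[OF assms(1) fin, of w] by (simp add: fib_def)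
    show ?thesis
    proof
      assume "z \<in> S"
      then obtain w where w: "w \<in> fib C z" "w \<in> A" by (auto simp: S_def)
      show "wsum C (indicator A) z > 0"
        unfolding wsum_def
        by (rule sum_pos2[OF fin w(1)]) (use pos[OF w(1)] w(2) in auto)
    next
      assume "wsum C (indicator A) z > 0"
      then have "wsum C (indicator A) z \<noteq> 0" by simp
      then obtain w where "w \<in> fib C z" "real (local_mult C w z) * indicator A w \<noteq> 0"
        unfolding wsum_def by (rule sum.not_neutral_contains_not_neutral)
      then show "z \<in> S" by (auto simp: S_def indicator_def split: if_splits)
    qed
  qed
  \<comment> \<open>Over the exceptional points the weighted sum says nothing, but any set of such
    points is finite and therefore Borel.\<close>
  then have eq: "S = ({z. wsum C (indicator A) z > 0} - Z) \<union> (S \<inter> Z)" by auto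
  have "{z \<in> space borel. 0 < wsum C (indicator A) z} \<in> sets borel"
    using wsum_measurable_indicator[OF assms] by measurable
  then have "{z. wsum C (indicator A) z > 0} - Z \<in> sets borel"
    using finite_sets_borel[OF \<open>finite Z\<close>] by auto
  moreover have "S \<inter> Z \<in> sets borel" using \<open>finite Z\<close> by (intro finite_sets_borel) simp
  ultimately have "S \<in> sets borel" using eq by (metis sets.Un)
  then show ?thesis by (simp add: S_def)
qed

text \<open>\<open>w\<close> is a pre-image of a point of \<open>A\<close> along \<open>C\<close>
  exactly when the fibre of the converse curve over \<open>w\<close> meets \<open>A\<close>.\<close>

lemma preimage_set_borel:
  assumes "holomorphic_correspondence \<Gamma>" "A \<in> sets borel"
  shows "preimage_set \<Gamma> A \<in> sets borel"
  unfolding preimage_set_eq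
  using curve_image_borel[OF curve_converse[OF holomorphic_correspondence_curve[OF assms(1)]] assms(2)]
  by (intro sets.finite_UN) auto


subsection \<open>The Koopman operator of an invariant measure\<close>

locale invariant_correspondence =
  fixes \<Gamma> :: correspondence and \<mu> :: "riemann_sphere measure"
  assumes correspondence: "holomorphic_correspondence \<Gamma>"
    and prob: "\<mu> \<in> borel_prob_measures"
    and invariant: "pullback_invariant \<Gamma> \<mu>"
begin

sublocale prob_space \<mu>
  using prob by (simp add: borel_prob_measures_def)

lemma sets_mu [simp, measurable_cong]: "sets \<mu> = sets borel"
  using prob by (simp add: borel_prob_measures_def)

lemma space_mu [simp]: "space \<mu> = UNIV"
  using sets_eq_imp_space_eq[OF sets_mu] by simp

lemma measurable_mu [simp]: "f \<in> measurable \<mu> N \<longleftrightarrow> f \<in> measurable borel N"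
  by (simp add: measurable_cong_sets[OF sets_mu refl])

abbreviation T :: "(riemann_sphere \<Rightarrow> real) \<Rightarrow> riemann_sphere \<Rightarrow> real" where
  "T \<equiv> koopman \<Gamma>"

definition weight :: "riemann_sphere \<Rightarrow> riemann_sphere \<Rightarrow> real" where
  "weight z w = real (preimage_mult \<Gamma> w z) / real (d_top \<Gamma>)"

lemma T_eq: "T f z = (\<Sum>w\<in>preimages \<Gamma> z. weight z w * f w)"
  by (simp add: koopman_def preimage_sum_def weight_def sum_distrib_left)

lemma weight_nonneg: "0 \<le> weight z w"
  by (simp add: weight_def)

lemma weight_pos: "finite (preimages \<Gamma> z) \<Longrightarrow> w \<in> preimages \<Gamma> z \<Longrightarrow> 0 < weight z w"
  using preimage_mult_pos[OF correspondence] d_top_eq(1)[OF correspondence] by (simp add: weight_def)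

text \<open>The weights sum to one over every finite set of pre-images; over an infinite one the sum
  is 0 by convention.\<close>

lemma T_const: "T (\<lambda>_. c) z = (if finite (preimages \<Gamma> z) then c else 0)"
proof (cases "finite (preimages \<Gamma> z)")
  case True
  have "(\<Sum>w\<in>preimages \<Gamma> z. weight z w) =
      real (\<Sum>w\<in>preimages \<Gamma> z. preimage_mult \<Gamma> w z) / real (d_top \<Gamma>)"
    by (simp add: weight_def sum_divide_distrib)
  also have "\<dots> = 1"
    using d_top_eq(1)[OF correspondence] d_top_eq(2)[OF correspondence True] by simp
  finally show ?thesis using True by (simp add: T_eq flip: sum_distrib_right)
qed (simp add: T_eq)

lemma T_mono: "(\<And>w. f w \<le> g w) \<Longrightarrow> T f z \<le> T g z"
  unfolding T_eq by (intro sum_mono mult_left_mono weight_nonneg)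

lemma T_nonneg: "(\<And>w. 0 \<le> f w) \<Longrightarrow> 0 \<le> T f z"
  unfolding T_eq by (intro sum_nonneg mult_nonneg_nonneg weight_nonneg)

lemma T_diff: "T (\<lambda>w. f w - g w) z = T f z - T g z"
  by (simp add: T_eq right_diff_distrib sum_subtractf)

text \<open>Strict positivity of the weights lets the average control \<open>f\<close> at each
  single pre-image. This is the link between the operator and \<open>preimage_set\<close>.\<close>

lemma T_eq_0_iff:
  assumes "finite (preimages \<Gamma> z)" "\<And>w. 0 \<le> f w"
  shows "T f z = 0 \<longleftrightarrow> (\<forall>w\<in>preimages \<Gamma> z. f w = 0)"
proof -
  have "T f z = 0 \<longleftrightarrow> (\<forall>w\<in>preimages \<Gamma> z. weight z w * f w = 0)"
    unfolding T_eq using assms by (intro sum_nonneg_eq_0_iff) (auto intro: mult_nonneg_nonneg weight_nonneg)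
  then show ?thesis using weight_pos[OF assms(1)] by force
qed

lemma T_indicator_le_1: "0 \<le> T (indicator A) z \<and> T (indicator A) z \<le> 1"
proof -
  have "T (indicator A) z \<le> T (\<lambda>_. 1) z" by (rule T_mono) (simp add: indicator_def)
  also have "\<dots> \<le> 1" by (simp add: T_const)
  finally show ?thesis by (simp add: T_nonneg)
qed

lemma finite_exceptional: "finite {z. infinite (preimages \<Gamma> z)}"
  using holomorphic_correspondence_finite_preimages[OF correspondence] by (simp add: eventually_cofinite)

lemma finite_preimages_borel [measurable]: "Measurable.pred borel (\<lambda>z. finite (preimages \<Gamma> z))"
proof -
  have "- {z. infinite (preimages \<Gamma> z)} \<in> sets borel"
    using finite_sets_borel[OF finite_exceptional] by simp
  then show ?thesis by (simp add: pred_def Compl_eq)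
qed

lemma borel_measurable_sum_mset:
  assumes "\<And>C. C \<in># M \<Longrightarrow> (g C :: riemann_sphere \<Rightarrow> real) \<in> borel_measurable borel"
  shows "(\<lambda>z. \<Sum>C\<in>#M. g C z) \<in> borel_measurable borel"
  using assms by (induction M) simp_all

lemma T_measurable_of_wsum:
  assumes "\<And>C. C \<in># \<Gamma> \<Longrightarrow> wsum C f \<in> borel_measurable borel"
  shows "T f \<in> borel_measurable borel"
proof -
  have "T f = (\<lambda>z. if finite (preimages \<Gamma> z) then 1 / real (d_top \<Gamma>) * (\<Sum>C\<in>#\<Gamma>. wsum C f z) else 0)"
  proof
    fix z
    show "T f z = (if finite (preimages \<Gamma> z) then 1 / real (d_top \<Gamma>) * (\<Sum>C\<in>#\<Gamma>. wsum C f z) else 0)"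
    proof (cases "finite (preimages \<Gamma> z)")
      case True
      then show ?thesis by (simp only: koopman_def preimage_sum_eq[OF correspondence True] if_True)
    qed (simp add: koopman_def preimage_sum_def)
  qed
  moreover have "(\<lambda>z. \<Sum>C\<in>#\<Gamma>. wsum C f z) \<in> borel_measurable borel"
    by (rule borel_measurable_sum_mset[OF assms])
  ultimately show ?thesis by simp
qed

lemma T_measurable_continuous: "continuous_on UNIV f \<Longrightarrow> T f \<in> borel_measurable borel"
  by (rule T_measurable_of_wsum)
    (rule wsum_measurable_continuous[OF holomorphic_correspondence_curve[OF correspondence]])

lemma T_measurable_indicator: "A \<in> sets borel \<Longrightarrow> T (indicator A) \<in> borel_measurable borel"
  by (rule T_measurable_of_wsum)
    (rule wsum_measurable_indicator[OF holomorphic_correspondence_curve[OF correspondence]])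

lemma integrable_bounded:
  fixes f :: "riemann_sphere \<Rightarrow> real"
  shows "f \<in> borel_measurable borel \<Longrightarrow> (\<And>x. \<bar>f x\<bar> \<le> B) \<Longrightarrow> integrable \<mu> f"
  by (rule integrable_const_bound[of _ B]) auto

lemma integrable_T_indicator: "A \<in> sets borel \<Longrightarrow> integrable \<mu> (T (indicator A))"
  using T_indicator_le_1 by (intro integrable_bounded[of _ 1] T_measurable_indicator) auto

lemma integral_T_continuous: "continuous_on UNIV f \<Longrightarrow> (LINT z|\<mu>. T f z) = (LINT z|\<mu>. f z)"
  using invariant by (simp add: pullback_invariant_def koopman_def)

lemma integral_T_one: "(LINT z|\<mu>. T (\<lambda>_. 1) z) = 1"
  using integral_T_continuous[OF continuous_on_const[of _ 1]] prob_space by simp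

lemma integrable_T_one: "integrable \<mu> (T (\<lambda>_. 1))"
  by (intro integrable_bounded[of _ 1] T_measurable_continuous continuous_on_const) (simp add: T_const)

text \<open>A point with infinite fibre has an empty sum of pre-images, so that invariance forces such
  points to carry no mass.\<close>

lemma AE_finite_preimages: "AE z in \<mu>. finite (preimages \<Gamma> z)"
proof -
  have "(LINT z|\<mu>. 1 - T (\<lambda>_. 1) z) = 0"
    using integral_T_one integrable_T_one prob_space by simp
  moreover have "integrable \<mu> (\<lambda>z. 1 - T (\<lambda>_. 1) z)" using integrable_T_one by simp
  moreover have "AE z in \<mu>. 0 \<le> 1 - T (\<lambda>_. 1) z" by (simp add: T_const)
  ultimately have "AE z in \<mu>. 1 - T (\<lambda>_. 1) z = 0"
    using integral_nonneg_eq_0_iff_AE by blast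
  then show ?thesis by (rule eventually_mono) (simp add: T_const split: if_splits)
qed

text \<open>Invariance is given for continuous functions only. Dominated convergence with bound 1
  carries it to compact sets of the plane, and Dynkin's induction to all Borel sets.\<close>

lemma integral_T_indicator:
  assumes "A \<in> sets borel"
  shows "(LINT z|\<mu>. T (indicator A) z) = measure \<mu> A"
  using assms
proof (induction rule: borel_riemann_sphere_induct)
  case (compact K)
  from Affine_compact_indicator_limit[OF compact]
  obtain g :: "nat \<Rightarrow> riemann_sphere \<Rightarrow> real" where g: "\<forall>n. continuous_on UNIV (g n)"
    "\<forall>n x. 0 \<le> g n x \<and> g n x \<le> 1" "\<forall>x. (\<lambda>n. g n x) \<longlonglongrightarrow> indicator (Affine ` K) x"
    by (elim exE conjE)
  have A: "Affine ` K \<in> sets borel"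
    using compact by (intro borel_compact compact_continuous_image continuous_on_subset[OF continuous_on_Affine]) auto
  have gm: "g n \<in> borel_measurable borel" for n
    using g(1) by (intro borel_measurable_continuous_onI) simp
  have bound: "\<bar>T (g n) z\<bar> \<le> 1" for n z
  proof -
    have "T (g n) z \<le> T (\<lambda>_. 1) z" by (rule T_mono) (use g(2) in simp)
    also have "\<dots> \<le> 1" by (simp add: T_const)
    finally show ?thesis using T_nonneg[of "g n" z] g(2) by simp
  qed
  have "(\<lambda>n. LINT z|\<mu>. T (g n) z) \<longlonglongrightarrow> (LINT z|\<mu>. T (indicator (Affine ` K)) z)"
  proof (rule integral_dominated_convergence[where w = "\<lambda>_. 1"])
    show "AE z in \<mu>. (\<lambda>n. T (g n) z) \<longlonglongrightarrow> T (indicator (Affine ` K)) z"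
      unfolding T_eq by (intro AE_I2 tendsto_intros g(3)[rule_format])
    show "T (g n) \<in> borel_measurable \<mu>" for n
      using T_measurable_continuous g(1) by simp
    show "T (indicator (Affine ` K)) \<in> borel_measurable \<mu>"
      using T_measurable_indicator[OF A] by simp
  qed (use bound in auto)
  moreover have "(\<lambda>n. LINT z|\<mu>. g n z) \<longlonglongrightarrow> (LINT z|\<mu>. indicator (Affine ` K) z)"
  proof (rule integral_dominated_convergence[where w = "\<lambda>_. 1"])
    show "AE z in \<mu>. (\<lambda>n. g n z) \<longlonglongrightarrow> indicator (Affine ` K) z"
      by (intro AE_I2 g(3)[rule_format])
    show "AE z in \<mu>. norm (g n z) \<le> 1" for n using g(2) by simp
  qed (use gm A in auto)
  ultimately have "(LINT z|\<mu>. T (indicator (Affine ` K)) z) = (LINT z|\<mu>. indicator (Affine ` K) z)"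
    using integral_T_continuous g(1) LIMSEQ_unique by simp
  then show ?case using A by simp
next
  case UNIV
  show ?case using integral_T_one prob_space by (simp add: indicator_def)
next
  case (compl A)
  have "T (indicator (- A)) z = T (\<lambda>_. 1) z - T (indicator A) z" for z
    unfolding T_diff[symmetric] by (rule arg_cong[of _ _ "\<lambda>f. T f z"]) (auto simp: indicator_def)
  then have "(LINT z|\<mu>. T (indicator (- A)) z) = 1 - measure \<mu> A"
    using integral_T_one integrable_T_one integrable_T_indicator[OF compl(1)] compl(2) by simp
  then show ?case using prob_compl[of A] compl(1) by (simp add: Compl_eq_Diff_UNIV)
next
  case (union A)
  have Ab: "A i \<in> sets borel" for i using union(2) by auto
  have U: "(\<Union>i. A i) \<in> sets borel" using Ab by simp
  have s: "(\<lambda>i. T (indicator (A i)) z) sums T (indicator (\<Union>i. A i)) z" for z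
  proof -
    have "(\<lambda>i. indicator (A i) x :: real) sums indicator (\<Union>i. A i) x" for x
      using union(1) by (intro indicator_sums) (auto simp: disjoint_family_on_def)
    then show ?thesis unfolding T_eq by (intro sums_sum sums_mult)
  qed
  have "(\<lambda>n. LINT z|\<mu>. (\<Sum>i<n. T (indicator (A i)) z)) \<longlonglongrightarrow> (LINT z|\<mu>. T (indicator (\<Union>i. A i)) z)"
  proof (rule integral_dominated_convergence[where w = "\<lambda>_. 1"])
    show "AE z in \<mu>. (\<lambda>n. \<Sum>i<n. T (indicator (A i)) z) \<longlonglongrightarrow> T (indicator (\<Union>i. A i)) z"
      using s by (simp add: sums_def)
    show "AE z in \<mu>. norm (\<Sum>i<n. T (indicator (A i)) z) \<le> 1" for n
    proof (rule AE_I2)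
      fix z
      \<comment> \<open>Disjointness bounds the partial sums uniformly in \<open>n\<close>: the full
        series is \<open>T\<close> of a single indicator.\<close>
      have "(\<Sum>i<n. T (indicator (A i)) z) \<le> (\<Sum>i. T (indicator (A i)) z)"
        using s T_indicator_le_1 by (intro sum_le_suminf) (auto simp: sums_iff)
      also have "\<dots> = T (indicator (\<Union>i. A i)) z" using s by (simp add: sums_iff)
      also have "\<dots> \<le> 1" using T_indicator_le_1 by simp
      finally show "norm (\<Sum>i<n. T (indicator (A i)) z) \<le> 1"
        using T_indicator_le_1 by (simp add: sum_nonneg)
    qed
    show "(\<lambda>z. \<Sum>i<n. T (indicator (A i)) z) \<in> borel_measurable \<mu>" for n
      using T_measurable_indicator[OF Ab] by simp
    show "T (indicator (\<Union>i. A i)) \<in> borel_measurable \<mu>"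
      using T_measurable_indicator[OF U] by simp
  qed simp
  moreover have "(LINT z|\<mu>. (\<Sum>i<n. T (indicator (A i)) z)) = (\<Sum>i<n. measure \<mu> (A i))" for n
    using integrable_T_indicator[OF Ab] union(3) by simp
  ultimately have "(\<lambda>i. measure \<mu> (A i)) sums (LINT z|\<mu>. T (indicator (\<Union>i. A i)) z)"
    by (simp add: sums_def)
  moreover have "(\<lambda>i. measure \<mu> (A i)) sums measure \<mu> (\<Union>i. A i)"
    using union(1,2) by (intro finite_measure_UNION) auto
  ultimately show ?case by (rule sums_unique2)
qed

text \<open>An extended nonnegative version, to which monotone convergence applies before
  \<open>T f\<close> is known to be integrable.\<close>

definition T_ennreal :: "(riemann_sphere \<Rightarrow> ennreal) \<Rightarrow> riemann_sphere \<Rightarrow> ennreal" where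
  "T_ennreal u z = (\<Sum>w\<in>preimages \<Gamma> z. ennreal (weight z w) * u w)"

lemma T_ennreal_of_real: "(\<And>w. 0 \<le> f w) \<Longrightarrow> T_ennreal (\<lambda>w. ennreal (f w)) z = ennreal (T f z)"
  by (simp add: T_ennreal_def T_eq weight_nonneg sum_ennreal flip: ennreal_mult)

lemma T_ennreal_invariant:
  assumes "u \<in> borel_measurable borel"
  shows "T_ennreal u \<in> borel_measurable borel \<and> (\<integral>\<^sup>+ z. T_ennreal u z \<partial>\<mu>) = (\<integral>\<^sup>+ z. u z \<partial>\<mu>)"
  using assms
proof (induction rule: borel_measurable_induct)
  case (cong f g)
  then have "f = g" by (simp add: fun_eq_iff)
  with cong show ?case by simp
next
  case (set A)
  have eq: "T_ennreal (indicator A) z = ennreal (T (indicator A) z)" for z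
    using T_ennreal_of_real[of "indicator A" z] by (simp add: ennreal_indicator)
  have "(\<integral>\<^sup>+ z. ennreal (T (indicator A) z) \<partial>\<mu>) = ennreal (measure \<mu> A)"
    using set T_indicator_le_1 integral_T_indicator[OF set] integrable_T_indicator[OF set]
    by (subst nn_integral_eq_integral) auto
  moreover have "T_ennreal (indicator A) = (\<lambda>z. ennreal (T (indicator A) z))" using eq by auto
  ultimately show ?case
    using set T_measurable_indicator[OF set] by (simp add: emeasure_eq_measure)
next
  case (mult u c)
  have "T_ennreal (\<lambda>x. c * u x) = (\<lambda>z. c * T_ennreal u z)"
    by (simp add: fun_eq_iff T_ennreal_def sum_distrib_left mult_ac)
  moreover have m: "T_ennreal u \<in> borel_measurable borel" using mult by blast
  have "(\<lambda>z. c * T_ennreal u z) \<in> borel_measurable borel" using m by measurable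
  ultimately show ?case using mult m by (simp add: nn_integral_cmult)
next
  case (add u v)
  have "T_ennreal (\<lambda>x. v x + u x) = (\<lambda>z. T_ennreal v z + T_ennreal u z)"
    by (simp add: fun_eq_iff T_ennreal_def distrib_left sum.distrib)
  moreover have m: "T_ennreal u \<in> borel_measurable borel" "T_ennreal v \<in> borel_measurable borel"
    using add by blast+
  have "(\<lambda>z. T_ennreal v z + T_ennreal u z) \<in> borel_measurable borel" using m by measurable
  ultimately show ?case using add m by (simp add: nn_integral_add)
next
  case (seq U)
  have inc: "incseq (\<lambda>i. T_ennreal (U i) z)" for z
    using seq.hyps(3) unfolding T_ennreal_def
    by (intro incseq_SucI sum_mono mult_left_mono) (auto simp: incseq_Suc_iff le_fun_def)
  have "(\<lambda>i. T_ennreal (U i) z) \<longlonglongrightarrow> T_ennreal (SUP i. U i) z" for z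
  proof -
    have "(\<lambda>i. U i w) \<longlonglongrightarrow> (SUP i. U i) w" for w
      using LIMSEQ_SUP[of "\<lambda>i. U i w"] seq.hyps(3) by (simp add: incseq_def le_fun_def image_image)
    then show ?thesis
      unfolding T_ennreal_def by (intro tendsto_sum ennreal_tendsto_cmult) auto
  qed
  then have eq: "T_ennreal (SUP i. U i) = (\<lambda>z. SUP i. T_ennreal (U i) z)"
    using LIMSEQ_unique[OF _ LIMSEQ_SUP[OF inc]] by (simp add: fun_eq_iff)
  have "(\<integral>\<^sup>+ z. T_ennreal (SUP i. U i) z \<partial>\<mu>) = (SUP i. \<integral>\<^sup>+ z. T_ennreal (U i) z \<partial>\<mu>)"
    unfolding eq using seq.IH inc
    by (intro nn_integral_monotone_convergence_SUP) (auto simp: incseq_def le_fun_def)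
  also have "\<dots> = (SUP i. \<integral>\<^sup>+ z. U i z \<partial>\<mu>)" using seq.IH by simp
  also have "\<dots> = (\<integral>\<^sup>+ z. (SUP i. U i z) \<partial>\<mu>)"
    using seq.hyps(1,3) by (intro nn_integral_monotone_convergence_SUP[symmetric]) auto
  finally have "(\<integral>\<^sup>+ z. T_ennreal (SUP i. U i) z \<partial>\<mu>) = (\<integral>\<^sup>+ z. (SUP i. U i) z \<partial>\<mu>)"
    by (simp add: image_image)
  moreover have "T_ennreal (SUP i. U i) \<in> borel_measurable borel"
    unfolding eq using seq.IH by (intro borel_measurable_SUP) auto
  ultimately show ?case by (intro conjI)
qed

lemma T_nonneg_invariant:
  assumes "f \<in> borel_measurable borel" "\<And>w. 0 \<le> f w"
  shows "T f \<in> borel_measurable borel"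
    and "integrable \<mu> f \<Longrightarrow> integrable \<mu> (T f) \<and> (LINT z|\<mu>. T f z) = (LINT z|\<mu>. f z)"
proof -
  have f: "(\<lambda>w. ennreal (f w)) \<in> borel_measurable borel" using assms by simp
  note * = T_ennreal_invariant[OF f, unfolded T_ennreal_of_real[OF assms(2), abs_def]]
  have eq: "T f = (\<lambda>z. enn2real (ennreal (T f z)))" using T_nonneg[OF assms(2)] by simp
  have "(\<lambda>z. enn2real (ennreal (T f z))) \<in> borel_measurable borel"
    using * by (intro borel_measurable_enn2real) (simp add: T_ennreal_of_real[OF assms(2)])
  then show meas: "T f \<in> borel_measurable borel" using eq by simp
  have nn: "(\<integral>\<^sup>+ z. ennreal (T f z) \<partial>\<mu>) = (\<integral>\<^sup>+ z. ennreal (f z) \<partial>\<mu>)"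
    using * by (simp add: T_ennreal_of_real[OF assms(2)])
  assume int: "integrable \<mu> f"
  have "integrable \<mu> (T f)"
    using meas nn T_nonneg[OF assms(2)] assms(2) nn_integral_eq_integral[OF int]
    by (intro integrableI_nonneg) auto
  moreover have "(LINT z|\<mu>. T f z) = (LINT z|\<mu>. f z)"
    using meas nn T_nonneg[OF assms(2)] assms by (simp add: integral_eq_nn_integral)
  ultimately show "integrable \<mu> (T f) \<and> (LINT z|\<mu>. T f z) = (LINT z|\<mu>. f z)" by simp
qed

lemma T_integral:
  assumes "integrable \<mu> f"
  shows "integrable \<mu> (T f)" "(LINT z|\<mu>. T f z) = (LINT z|\<mu>. f z)"
proof -
  have f: "f \<in> borel_measurable borel" using borel_measurable_integrable[OF assms] by simp
  have eq: "T f z = T (\<lambda>w. max 0 (f w)) z - T (\<lambda>w. max 0 (- f w)) z" for z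
    unfolding T_diff[symmetric] by (rule arg_cong[of _ _ "\<lambda>f. T f z"]) auto
  have int: "integrable \<mu> (\<lambda>w. max 0 (f w))" "integrable \<mu> (\<lambda>w. max 0 (- f w))"
    using assms by auto
  have 1: "integrable \<mu> (T (\<lambda>w. max 0 (f w))) \<and> (LINT z|\<mu>. T (\<lambda>w. max 0 (f w)) z) = (LINT z|\<mu>. max 0 (f z))"
    using f int by (intro T_nonneg_invariant(2)) auto
  have 2: "integrable \<mu> (T (\<lambda>w. max 0 (- f w))) \<and> (LINT z|\<mu>. T (\<lambda>w. max 0 (- f w)) z) = (LINT z|\<mu>. max 0 (- f z))"
    using f int by (intro T_nonneg_invariant(2)) auto
  show "integrable \<mu> (T f)" unfolding eq[abs_def] using 1 2 by simp
  have "(LINT z|\<mu>. T f z) = (LINT z|\<mu>. max 0 (f z)) - (LINT z|\<mu>. max 0 (- f z))"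
    unfolding eq using 1 2 by simp
  also have "\<dots> = (LINT z|\<mu>. max 0 (f z) - max 0 (- f z))" using int by simp
  also have "(\<lambda>z. max 0 (f z) - max 0 (- f z)) = f" by auto
  finally show "(LINT z|\<mu>. T f z) = (LINT z|\<mu>. f z)" .
qed


subsection \<open>Ergodicity\<close>

text \<open>\<open>T f - f\<close> is nonnegative almost everywhere, and its integral is zero
  because \<open>T\<close> preserves integrals.\<close>

lemma AE_eq_of_AE_le:
  assumes "integrable \<mu> f" "AE z in \<mu>. f z \<le> T f z"
  shows "AE z in \<mu>. T f z = f z"
proof -
  have int: "integrable \<mu> (\<lambda>z. T f z - f z)" using T_integral(1)[OF assms(1)] assms(1) by simp
  have nn: "AE z in \<mu>. 0 \<le> T f z - f z" using assms(2) by (rule eventually_mono) simp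
  have "(LINT z|\<mu>. T f z - f z) = 0" using T_integral[OF assms(1)] assms(1) by simp
  then have "AE z in \<mu>. T f z - f z = 0" using integral_nonneg_eq_0_iff_AE[OF int nn] by simp
  then show ?thesis by (rule eventually_mono) simp
qed

text \<open>\<open>T f z\<close> sees the values of \<open>f\<close> at pre-images of
  \<open>z\<close> rather than at \<open>z\<close>, so null sets need an argument: the average of
  \<open>\<bar>f - g\<bar>\<close> is nonnegative and has the same integral as
  \<open>\<bar>f - g\<bar>\<close>, namely 0.\<close>

lemma AE_T_cong:
  assumes "integrable \<mu> f" "integrable \<mu> g" "AE z in \<mu>. f z = g z"
  shows "AE z in \<mu>. T f z = T g z"
proof -
  define h where "h w = \<bar>f w - g w\<bar>" for w
  have int: "integrable \<mu> h" unfolding h_def using assms(1,2) by simp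
  have "AE z in \<mu>. h z = 0" using assms(3) by (rule eventually_mono) (simp add: h_def)
  then have "(LINT z|\<mu>. h z) = 0" by (rule integral_eq_zero_AE)
  then have 0: "(LINT z|\<mu>. T h z) = 0" using T_integral(2)[OF int] by simp
  have "AE z in \<mu>. 0 \<le> T h z" by (intro AE_I2 T_nonneg) (simp add: h_def)
  from integral_nonneg_eq_0_iff_AE[OF T_integral(1)[OF int] this] 0
  have "AE z in \<mu>. T h z = 0" by simp
  then show ?thesis
  proof (rule eventually_mono)
    fix z assume h0: "T h z = 0"
    have "T (\<lambda>w. f w - g w) z \<le> T h z" "T (\<lambda>w. g w - f w) z \<le> T h z"
      by (rule T_mono, simp add: h_def)+
    then show "T f z = T g z" unfolding T_diff h0 by simp
  qed
qed

lemma T_indicator_Compl: "T (indicator (- A)) z = T (\<lambda>_. 1) z - T (indicator A) z"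
  unfolding T_diff[symmetric] by (rule arg_cong[of _ _ "\<lambda>f. T f z"]) (auto simp: indicator_def)

text \<open>Expresses containment of all pre-images by an equation for a measurable function: the
  positive weights sum to one, so value 1 means that no pre-image lies outside
  \<open>A\<close>.\<close>

lemma preimages_subset_iff:
  assumes "finite (preimages \<Gamma> z)"
  shows "preimages \<Gamma> z \<subseteq> A \<longleftrightarrow> T (indicator A) z = 1"
proof -
  have "T (indicator (- A)) z = 0 \<longleftrightarrow> (\<forall>w\<in>preimages \<Gamma> z. indicator (- A) w = (0::real))"
    by (rule T_eq_0_iff[OF assms]) simp
  then show ?thesis
    using assms by (auto simp: T_indicator_Compl T_const indicator_def split: if_splits)
qed

lemma preimages_subset_preimage_set: "z \<in> A \<Longrightarrow> preimages \<Gamma> z \<subseteq> preimage_set \<Gamma> A"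
  by (auto simp: preimage_set_def)

text \<open>All pre-images of points of \<open>A'\<close> lie in \<open>A\<close>, and
  \<open>A - A'\<close> is null, so the indicator is subinvariant almost everywhere; preservation of
  the integral upgrades this to equality.\<close>

lemma almost_invariant_AE:
  assumes "almost_invariant \<Gamma> \<mu> A"
  shows "AE z in \<mu>. T (indicator A) z = indicator A z"
proof (rule AE_eq_of_AE_le)
  from assms obtain A' where A: "A \<in> sets borel" and A': "A' \<in> sets borel" "A' \<subseteq> A"
    "measure \<mu> A' = measure \<mu> A" "preimage_set \<Gamma> A' \<subseteq> A"
    unfolding almost_invariant_def by blast
  show "integrable \<mu> (indicator A :: _ \<Rightarrow> real)"
    using A by (intro integrable_bounded[of _ 1]) (auto simp: indicator_def)
  have "measure \<mu> (A - A') = 0"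
    using A A' by (simp add: finite_measure_Diff)
  then have "AE z in \<mu>. z \<notin> A - A'"
    using A A' by (simp add: prob_eq_0)
  then show "AE z in \<mu>. indicator A z \<le> T (indicator A) z"
    using AE_finite_preimages
  proof eventually_elim
    case (elim z)
    show ?case
    proof (cases "z \<in> A")
      case True
      then have "z \<in> A'" using elim(1) by simp
      then have "preimages \<Gamma> z \<subseteq> A" using preimages_subset_preimage_set[of z A'] A'(4) by simp
      then show ?thesis using preimages_subset_iff[OF elim(2)] by simp
    qed (simp add: T_nonneg)
  qed
qed

lemma ergodic_imp_subinvariant_const:
  assumes "ergodic \<Gamma> \<mu>" and f: "integrable \<mu> f" "AE z in \<mu>. f z \<le> T f z"
  shows "ae_constant \<mu> f"
proof -
  \<comment> \<open>With the mean as threshold a single sublevel set suffices: whether it has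
    measure 0 or 1, \<open>f - c\<close> has one sign almost everywhere and integral zero.\<close>
  define c where "c = (LINT z|\<mu>. f z)"
  define g where "g z = max 0 (f z - c)" for z
  define A where "A = {z. f z \<le> c}"
  \<comment> \<open>The witness for almost invariance. \<open>T g = 0\<close> puts every pre-image
    into the zero set of \<open>g\<close>, which is \<open>A\<close>; since \<open>T g = g\<close>
    almost everywhere, only a null set of \<open>A\<close> is lost.\<close>
  define A' where "A' = {z. f z \<le> c \<and> T g z = 0 \<and> finite (preimages \<Gamma> z)}"
  have fm: "f \<in> borel_measurable borel" using borel_measurable_integrable[OF f(1)] by simp
  have int: "integrable \<mu> g" unfolding g_def using f(1) by simp
  have gm: "T g \<in> borel_measurable borel"
    using borel_measurable_integrable[OF T_integral(1)[OF int]] by simp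
  have A: "A \<in> sets borel"
  proof -
    have "{z \<in> space borel. f z \<le> c} \<in> sets borel" using fm by measurable
    then show ?thesis by (simp add: A_def)
  qed
  have A': "A' \<in> sets borel"
  proof -
    have "{z \<in> space borel. f z \<le> c \<and> T g z = 0 \<and> finite (preimages \<Gamma> z)} \<in> sets borel"
      using fm gm by measurable
    then show ?thesis by (simp add: A'_def)
  qed
  have "AE z in \<mu>. g z \<le> T g z"
    using f(2) AE_finite_preimages
  proof eventually_elim
    case (elim z)
    have "f z - c \<le> T f z - T (\<lambda>_. c) z" using elim by (simp add: T_const)
    also have "\<dots> = T (\<lambda>w. f w - c) z" by (rule T_diff[symmetric])
    also have "\<dots> \<le> T g z" by (rule T_mono) (simp add: g_def)
    finally have "f z - c \<le> T g z" .
    moreover have "0 \<le> T g z" by (rule T_nonneg) (simp add: g_def)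
    ultimately show ?case by (simp add: g_def)
  qed
  from AE_eq_of_AE_le[OF int this] have "AE z in \<mu>. z \<in> A \<longleftrightarrow> z \<in> A'"
    using AE_finite_preimages
  proof eventually_elim
    case (elim z)
    have "g z = 0 \<longleftrightarrow> f z \<le> c" by (auto simp: g_def max_def)
    with elim show ?case by (auto simp: A_def A'_def)
  qed
  then have "measure \<mu> A' = measure \<mu> A"
    using A A' by (intro finite_measure_eq_AE) auto
  moreover have "preimage_set \<Gamma> A' \<subseteq> A"
  proof
    fix w assume "w \<in> preimage_set \<Gamma> A'"
    then obtain z where z: "z \<in> A'" "w \<in> preimages \<Gamma> z" by (auto simp: preimage_set_def)
    have "T g z = 0 \<longleftrightarrow> (\<forall>w\<in>preimages \<Gamma> z. g w = 0)"
      using z(1) by (intro T_eq_0_iff) (auto simp: A'_def g_def)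
    then have "g w = 0" using z by (simp add: A'_def)
    then show "w \<in> A" by (simp add: A_def g_def)
  qed
  moreover have "A' \<subseteq> A" by (auto simp: A_def A'_def)
  ultimately have "almost_invariant \<Gamma> \<mu> A"
    unfolding almost_invariant_def using A A' by (intro conjI bexI[of _ A']) auto
  then have "measure \<mu> A = 0 \<or> measure \<mu> A = 1" using assms(1) by (simp add: ergodic_def)
  then have "AE z in \<mu>. f z = c"
  proof
    assume "measure \<mu> A = 0"
    then have "AE z in \<mu>. z \<notin> A" using A by (simp add: prob_eq_0)
    then have nn: "AE z in \<mu>. 0 \<le> f z - c" by (rule eventually_mono) (simp add: A_def)
    have i: "integrable \<mu> (\<lambda>z. f z - c)" using f(1) by simp
    have "(LINT z|\<mu>. f z - c) = 0" using f(1) prob_space by (simp add: c_def)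
    then have "AE z in \<mu>. f z - c = 0" using integral_nonneg_eq_0_iff_AE[OF i nn] by simp
    then show ?thesis by (rule eventually_mono) simp
  next
    assume "measure \<mu> A = 1"
    then have "AE z in \<mu>. z \<in> A" using A by (simp add: prob_eq_1)
    then have nn: "AE z in \<mu>. 0 \<le> c - f z" by (rule eventually_mono) (simp add: A_def)
    have i: "integrable \<mu> (\<lambda>z. c - f z)" using f(1) by simp
    have "(LINT z|\<mu>. c - f z) = 0" using f(1) prob_space by (simp add: c_def)
    then have "AE z in \<mu>. c - f z = 0" using integral_nonneg_eq_0_iff_AE[OF i nn] by simp
    then show ?thesis by (rule eventually_mono) simp
  qed
  then show ?thesis unfolding ae_constant_def by blast
qed

lemma L_1_iff: "f \<in> L_p 1 \<mu> \<longleftrightarrow> integrable \<mu> f"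
proof
  assume "f \<in> L_p 1 \<mu>"
  then have "f \<in> borel_measurable \<mu>" "integrable \<mu> (\<lambda>x. \<bar>f x\<bar>)" by (simp_all add: L_p_def)
  then show "integrable \<mu> f" using integrable_abs_iff by blast
next
  assume f: "integrable \<mu> f"
  then have "f \<in> borel_measurable \<mu>" by (rule borel_measurable_integrable)
  with f show "f \<in> L_p 1 \<mu>" by (simp add: L_p_def)
qed

lemma L_p_integrable:
  assumes "1 \<le> p" "f \<in> L_p p \<mu>"
  shows "integrable \<mu> f"
proof (rule Bochner_Integration.integrable_bound)
  show "integrable \<mu> (\<lambda>x. 1 + \<bar>f x\<bar> powr p)" using assms(2) by (simp add: L_p_def)
  show "f \<in> borel_measurable \<mu>" using assms(2) by (simp add: L_p_def)
  show "AE x in \<mu>. norm (f x) \<le> norm (1 + \<bar>f x\<bar> powr p)"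
  proof (rule AE_I2)
    fix x
    have "\<bar>f x\<bar> \<le> 1 + \<bar>f x\<bar> powr p"
    proof (cases "\<bar>f x\<bar> \<le> 1")
      case False
      then have "\<bar>f x\<bar> powr 1 \<le> \<bar>f x\<bar> powr p" using assms(1) by (intro powr_mono) auto
      then show ?thesis by simp
    qed (use powr_ge_zero[of "\<bar>f x\<bar>" p] in linarith)
    then show "norm (f x) \<le> norm (1 + \<bar>f x\<bar> powr p)" by simp
  qed
qed

text \<open>The indicator of an almost invariant set is an invariant integrable function; an
  indicator that is constant almost everywhere belongs to a null or a full set.\<close>

lemma ergodic_of_invariant_const:
  assumes const: "\<And>f. f \<in> L_p 1 \<mu> \<Longrightarrow> AE z in \<mu>. T f z = f z \<Longrightarrow> ae_constant \<mu> f"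
  shows "ergodic \<Gamma> \<mu>"
  unfolding ergodic_def
proof (intro allI impI)
  fix A assume inv: "almost_invariant \<Gamma> \<mu> A"
  then have A: "A \<in> sets borel" by (simp add: almost_invariant_def)
  have "integrable \<mu> (indicator A :: _ \<Rightarrow> real)"
    using A by (intro integrable_bounded[of _ 1]) (auto simp: indicator_def)
  then have "ae_constant \<mu> (indicator A)"
    using almost_invariant_AE[OF inv] by (intro const) (simp_all add: L_1_iff)
  then obtain c where c: "AE z in \<mu>. indicator A z = (c :: real)" unfolding ae_constant_def by blast
  show "measure \<mu> A = 0 \<or> measure \<mu> A = 1"
  proof (cases "c = 1")
    case True
    have "AE z in \<mu>. z \<in> A" using c by (rule eventually_mono) (use True in \<open>auto simp: indicator_def split: if_splits\<close>)
    then show ?thesis using A by (simp add: prob_eq_1)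
  next
    case False
    have "AE z in \<mu>. z \<notin> A" using c by (rule eventually_mono) (use False in \<open>auto simp: indicator_def\<close>)
    then show ?thesis using A by (simp add: prob_eq_0)
  qed
qed

lemma preimage_set_funpow_borel: "E \<in> sets borel \<Longrightarrow> (preimage_set \<Gamma> ^^ n) E \<in> sets borel"
  by (induction n) (simp_all add: preimage_set_borel[OF correspondence])

lemma preimage_set_mono: "A \<subseteq> B \<Longrightarrow> preimage_set \<Gamma> A \<subseteq> preimage_set \<Gamma> B"
  by (auto simp: preimage_set_def)

text \<open>The backward orbit is closed under pre-images and thus its own witness for almost
  invariance. It remains to exclude measure 0.\<close>

lemma ergodic_imp_full_orbit:
  assumes "ergodic \<Gamma> \<mu>" and E: "E \<in> sets borel" "measure \<mu> E > 0"
  shows "measure \<mu> (\<Union>n\<in>{1..}. (preimage_set \<Gamma> ^^ n) E) = 1"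
proof -
  define B where "B = (\<Union>n\<in>{1..}. (preimage_set \<Gamma> ^^ n) E)"
  have B: "B \<in> sets borel"
    unfolding B_def using preimage_set_funpow_borel[OF E(1)] by (intro sets.countable_UN) auto
  have "preimage_set \<Gamma> B \<subseteq> B"
  proof
    fix w assume "w \<in> preimage_set \<Gamma> B"
    then obtain n where n: "w \<in> preimage_set \<Gamma> ((preimage_set \<Gamma> ^^ n) E)"
      by (auto simp: preimage_set_def B_def)
    then have "w \<in> (preimage_set \<Gamma> ^^ Suc n) E" by simp
    then show "w \<in> B" unfolding B_def by (intro UN_I[of "Suc n"]) simp_all
  qed
  then have "almost_invariant \<Gamma> \<mu> B"
    unfolding almost_invariant_def using B by (intro conjI bexI[of _ B]) simp_all
  \<comment> \<open>As the union starts at \<open>n = 1\<close>, the set \<open>E\<close> need not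
    lie in \<open>B\<close>. Its pre-images do, however, so
    \<open>indicator E \<le> T (indicator B)\<close> almost everywhere; integrating bounds the
    measure of \<open>E\<close> by that of \<open>B\<close>.\<close>
  moreover have "measure \<mu> B \<noteq> 0"
  proof -
    have EB: "preimage_set \<Gamma> E \<subseteq> B"
    proof
      fix w assume "w \<in> preimage_set \<Gamma> E"
      then show "w \<in> B" unfolding B_def by (intro UN_I[of 1]) simp_all
    qed
    have "measure \<mu> E = (LINT z|\<mu>. indicator E z)" using E(1) by simp
    also have "\<dots> \<le> (LINT z|\<mu>. T (indicator B) z)"
    proof (rule integral_mono_AE)
      show "integrable \<mu> (indicator E :: _ \<Rightarrow> real)"
        using E(1) by (intro integrable_bounded[of _ 1]) (auto simp: indicator_def)
      show "AE z in \<mu>. indicator E z \<le> T (indicator B) z"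
        using AE_finite_preimages
      proof (rule eventually_mono)
        fix z assume fin: "finite (preimages \<Gamma> z)"
        show "indicator E z \<le> T (indicator B) z"
        proof (cases "z \<in> E")
          case True
          then have "preimages \<Gamma> z \<subseteq> B" using preimages_subset_preimage_set[of z E] EB by simp
          then show ?thesis using preimages_subset_iff[OF fin] by simp
        qed (simp add: T_nonneg)
      qed
    qed (rule integrable_T_indicator[OF B])
    also have "\<dots> = measure \<mu> B" by (rule integral_T_indicator[OF B])
    finally show ?thesis using E(2) by simp
  qed
  ultimately have "measure \<mu> B = 1" using assms(1) by (auto simp: ergodic_def)
  then show ?thesis by (simp add: B_def)
qed

text \<open>Otherwise \<open>E'\<close> would meet each of countably many sets in a null set and
  hence be null outside and inside the full orbit.\<close>

lemma full_orbit_imp_hitting: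
  assumes "measure \<mu> (\<Union>n\<in>{1..}. (preimage_set \<Gamma> ^^ n) E) = 1"
    and "E \<in> sets borel" "E' \<in> sets borel" "measure \<mu> E' > 0"
  shows "\<exists>n\<ge>1. measure \<mu> ((preimage_set \<Gamma> ^^ n) E \<inter> E') > 0"
proof (rule ccontr)
  assume not: "\<not> (\<exists>n\<ge>1. measure \<mu> ((preimage_set \<Gamma> ^^ n) E \<inter> E') > 0)"
  have null: "AE z in \<mu>. \<not> (z \<in> (preimage_set \<Gamma> ^^ n) E \<and> z \<in> E')" if "n \<ge> 1" for n
  proof -
    have "measure \<mu> ((preimage_set \<Gamma> ^^ n) E \<inter> E') = 0"
      using not that measure_nonneg[of \<mu> "(preimage_set \<Gamma> ^^ n) E \<inter> E'"] by (metis less_eq_real_def)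
    moreover have "(preimage_set \<Gamma> ^^ n) E \<inter> E' \<in> sets borel"
      using preimage_set_funpow_borel[OF assms(2)] assms(3) by (rule sets.Int)
    ultimately have "AE z in \<mu>. z \<notin> (preimage_set \<Gamma> ^^ n) E \<inter> E'" by (simp add: prob_eq_0)
    then show ?thesis by (rule eventually_mono) simp
  qed
  have "AE z in \<mu>. \<forall>n\<in>{1..}. \<not> (z \<in> (preimage_set \<Gamma> ^^ n) E \<and> z \<in> E')"
    using null by (intro AE_ball_countable[THEN iffD2]) auto
  moreover have "(\<Union>n\<in>{1..}. (preimage_set \<Gamma> ^^ n) E) \<in> sets borel"
    using preimage_set_funpow_borel[OF assms(2)] by (intro sets.countable_UN) auto
  then have "AE z in \<mu>. z \<in> (\<Union>n\<in>{1..}. (preimage_set \<Gamma> ^^ n) E)"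
    using assms(1) by (simp add: prob_eq_1)
  ultimately have "AE z in \<mu>. z \<notin> E'"
    by eventually_elim auto
  then have "measure \<mu> E' = 0" using assms(3) by (simp add: prob_eq_0)
  then show False using assms(4) by simp
qed

primrec core :: "riemann_sphere set \<Rightarrow> nat \<Rightarrow> riemann_sphere set" where
  "core A 0 = A"
| "core A (Suc n) = {z \<in> core A n. finite (preimages \<Gamma> z) \<and> preimages \<Gamma> z \<subseteq> core A n}"

text \<open>Each stage loses only a null set: since the current core agrees with \<open>A\<close>
  almost everywhere, so do the averages of the two indicators, and the average of
  \<open>indicator A\<close> is 1 almost everywhere on \<open>A\<close>.\<close>

lemma core_AE:
  assumes "almost_invariant \<Gamma> \<mu> A"
  shows "core A n \<in> sets borel \<and> (AE z in \<mu>. z \<in> core A n \<longleftrightarrow> z \<in> A)"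
proof (induction n)
  case 0
  then show ?case using assms by (simp add: almost_invariant_def)
next
  case (Suc n)
  then have C: "core A n \<in> sets borel" and AE: "AE z in \<mu>. z \<in> core A n \<longleftrightarrow> z \<in> A" by simp_all
  have A: "A \<in> sets borel" using assms by (simp add: almost_invariant_def)
  have eq: "core A (Suc n) = core A n \<inter> {z \<in> space borel. finite (preimages \<Gamma> z) \<and> T (indicator (core A n)) z = 1}"
    using preimages_subset_iff by auto
  have "{z \<in> space borel. finite (preimages \<Gamma> z) \<and> T (indicator (core A n)) z = 1} \<in> sets borel"
    using T_measurable_indicator[OF C] by measurable
  then have S: "core A (Suc n) \<in> sets borel" unfolding eq using C by (intro sets.Int)
  have "AE z in \<mu>. T (indicator (core A n)) z = T (indicator A) z"
  proof (rule AE_T_cong)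
    show "integrable \<mu> (indicator (core A n) :: _ \<Rightarrow> real)" "integrable \<mu> (indicator A :: _ \<Rightarrow> real)"
      using A C by (intro integrable_bounded[of _ 1]; auto simp: indicator_def)+
    show "AE z in \<mu>. indicator (core A n) z = (indicator A z :: real)"
      using AE by (rule eventually_mono) (simp add: indicator_def)
  qed
  then have "AE z in \<mu>. z \<in> core A (Suc n) \<longleftrightarrow> z \<in> A"
    using AE almost_invariant_AE[OF assms] AE_finite_preimages
  proof eventually_elim
    case (elim z)
    then show ?case unfolding eq by (auto simp: indicator_def split: if_splits)
  qed
  with S show ?case by simp
qed

text \<open>An almost invariant set \<open>A\<close> of intermediate measure contains a set
  \<open>E\<close> of the same measure closed under pre-images. Its backward orbit never reaches the
  complement of \<open>A\<close>, although both sets have positive measure.\<close>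

lemma ergodic_of_hitting:
  assumes hit: "\<And>E E'. E \<in> sets borel \<Longrightarrow> E' \<in> sets borel \<Longrightarrow> measure \<mu> E > 0 \<Longrightarrow> measure \<mu> E' > 0 \<Longrightarrow>
    \<exists>n\<ge>1. measure \<mu> ((preimage_set \<Gamma> ^^ n) E \<inter> E') > 0"
  shows "ergodic \<Gamma> \<mu>"
  unfolding ergodic_def
proof (intro allI impI, rule ccontr)
  fix A assume inv: "almost_invariant \<Gamma> \<mu> A" and not: "\<not> (measure \<mu> A = 0 \<or> measure \<mu> A = 1)"
  have A: "A \<in> sets borel" using inv by (simp add: almost_invariant_def)
  define E where "E = (\<Inter>n. core A n)"
  have E: "E \<in> sets borel" unfolding E_def using core_AE[OF inv] by (intro sets.countable_INT) auto
  have "AE z in \<mu>. \<forall>n. z \<in> core A n \<longleftrightarrow> z \<in> A"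
    using core_AE[OF inv] by (simp add: AE_all_countable)
  then have "AE z in \<mu>. z \<in> E \<longleftrightarrow> z \<in> A" by (rule eventually_mono) (auto simp: E_def)
  then have "measure \<mu> E = measure \<mu> A" using A E by (intro finite_measure_eq_AE) auto
  then have "measure \<mu> E > 0" using not by (simp add: zero_less_measure_iff)
  moreover have "measure \<mu> (- A) > 0"
  proof -
    have "measure \<mu> (- A) = 1 - measure \<mu> A"
      using prob_compl[of A] A by (simp add: Compl_eq_Diff_UNIV)
    then show ?thesis using not prob_le_1[of A] by linarith
  qed
  ultimately obtain n where n: "measure \<mu> ((preimage_set \<Gamma> ^^ n) E \<inter> - A) > 0"
    using hit[OF E, of "- A"] A by auto
  have step: "preimage_set \<Gamma> E \<subseteq> E"
  proof
    fix w assume "w \<in> preimage_set \<Gamma> E"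
    then obtain z where z: "z \<in> E" "w \<in> preimages \<Gamma> z" by (auto simp: preimage_set_def)
    have "w \<in> core A k" for k
    proof -
      \<comment> \<open>Membership one stage later is what places the pre-images in stage
        \<open>k\<close>; the intersection over all stages absorbs the shift.\<close>
      have "z \<in> core A (Suc k)" using z(1) unfolding E_def by blast
      then show ?thesis using z(2) by auto
    qed
    then show "w \<in> E" by (simp add: E_def)
  qed
  have "(preimage_set \<Gamma> ^^ n) E \<subseteq> E"
  proof (induction n)
    case (Suc n)
    have "preimage_set \<Gamma> ((preimage_set \<Gamma> ^^ n) E) \<subseteq> preimage_set \<Gamma> E"
      using Suc by (rule preimage_set_mono)
    also note step
    finally show ?case by simp
  qed simp
  moreover have "E \<subseteq> A"
  proof
    fix z assume "z \<in> E"
    then have "z \<in> core A 0" unfolding E_def by blast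
    then show "z \<in> A" by simp
  qed
  ultimately have "(preimage_set \<Gamma> ^^ n) E \<inter> - A = {}" by blast
  then show False using n by simp
qed

end

theorem theorem5p4:
  fixes \<Gamma> :: correspondence and \<mu> :: "riemann_sphere measure"
  assumes "holomorphic_correspondence \<Gamma>"
    and "\<mu> \<in> borel_prob_measures"
    and "pullback_invariant \<Gamma> \<mu>"
  shows
    "(ergodic \<Gamma> \<mu> \<longleftrightarrow>
        (\<forall>E\<in>sets borel. measure \<mu> E > 0 \<longrightarrow>
           measure \<mu> (\<Union>n\<in>{1..}. (preimage_set \<Gamma> ^^ n) E) = 1)) \<and>
     (ergodic \<Gamma> \<mu> \<longleftrightarrow>
        (\<forall>E\<in>sets borel. \<forall>E'\<in>sets borel. measure \<mu> E > 0 \<and> measure \<mu> E' > 0 \<longrightarrow>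
           (\<exists>n\<ge>1. measure \<mu> ((preimage_set \<Gamma> ^^ n) E \<inter> E') > 0))) \<and>
     (ergodic \<Gamma> \<mu> \<longleftrightarrow>
        (\<forall>f\<in>L_p 1 \<mu>. (AE z in \<mu>. koopman \<Gamma> f z \<ge> f z) \<longrightarrow> ae_constant \<mu> f)) \<and>
     (ergodic \<Gamma> \<mu> \<longleftrightarrow>
        (\<forall>p\<ge>1. \<forall>f\<in>L_p p \<mu>. (AE z in \<mu>. koopman \<Gamma> f z = f z) \<longrightarrow> ae_constant \<mu> f))"
    (is "(_ \<longleftrightarrow> ?orbit) \<and> (_ \<longleftrightarrow> ?hit) \<and> (_ \<longleftrightarrow> ?sub) \<and> (_ \<longleftrightarrow> ?inv)")
proof -
  interpret invariant_correspondence \<Gamma> \<mu>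
    using assms by unfold_locales
  \<comment> \<open>Two cycles pass through ergodicity: by \<open>?orbit\<close> and
    \<open>?hit\<close>, and by \<open>?sub\<close> and \<open>?inv\<close>.\<close>
  have 1: ?orbit if "ergodic \<Gamma> \<mu>"
    using ergodic_imp_full_orbit[OF that] by simp
  have 2: ?hit if ?orbit
    using full_orbit_imp_hitting that by simp
  have 3: "ergodic \<Gamma> \<mu>" if ?hit
    by (rule ergodic_of_hitting) (use that in simp)
  have 4: ?sub if "ergodic \<Gamma> \<mu>"
    using ergodic_imp_subinvariant_const[OF that] by (simp add: L_1_iff)
  have 5: ?inv if ?sub
  proof (intro allI impI ballI)
    fix p :: real and f assume p: "1 \<le> p" "f \<in> L_p p \<mu>" and inv: "AE z in \<mu>. koopman \<Gamma> f z = f z"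
    have "f \<in> L_p 1 \<mu>" using L_p_integrable[OF p] by (simp add: L_1_iff)
    moreover have "AE z in \<mu>. koopman \<Gamma> f z \<ge> f z" using inv by (rule eventually_mono) simp
    ultimately show "ae_constant \<mu> f" using that by simp
  qed
  \<comment> \<open>The instance \<open>p = 1\<close> already contains the indicators of almost
    invariant sets.\<close>
  have 6: "ergodic \<Gamma> \<mu>" if ?inv
    by (rule ergodic_of_invariant_const, rule that[rule_format, of 1]) simp_all
  show ?thesis using 1 2 3 4 5 6 by argo
qed

end
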